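(* Assume (A.1), (A.2), (A.3) and fix $T>0$. Then the family $(X^\varepsilon,\nu^\varepsilon)$ (restricted to $[0,T]$, resp. $[0,T]\times\mathbb R$) is exponentially tight in $(\mathbb C_{[0,T]}\times\mathbb M_{[0,T]},r_T\times\rho_T)$: there is an increasing sequence of compact sets $K_j$ with $$\lim_{j\to\infty}\limsup_{\varepsilon\to0}\varepsilon\log P\big((X^\varepsilon,\nu^\varepsilon)\notin K_j\big)=-\infty.$$
   Context: Let $\varepsilon>0$; $W,V$ independent standard Wiener processes on a filtered probability space; $(X^\varepsilon,\xi^\varepsilon)$ solves $dX^\varepsilon_t=A(X^\varepsilon_t,\xi^\varepsilon_t)dt+\sqrt\varepsilon B(X^\varepsilon_t,\xi^\varepsilon_t)dW_t$, $d\xi^\varepsilon_t=\varepsilon^{-1}b(\xi^\varepsilon_t)dt+\varepsilon^{-1/2}\sigma(\xi^\varepsilon_t)dV_t$, $(X^\varepsilon_0,\xi^\varepsilon_0)=(x_0,z_0)$. (A.1) $A,B$ continuous, Lipschitz in $x$ uniformly in $z$, $\sup_z(|A(0,z)|+|B(0,z)|)<\infty$; (A.2) $\sigma^2$ bounded and bounded away from $0$, $\sigma$ continuously differentiable with bounded Lipschitz derivative; (A.3) $b$ Lipschitz, $\lim_{|z|\to\infty}b(z)\,\mathrm{sign}\,z=-\infty$. $\nu^\varepsilon(\Delta\times\Gamma)=\int_0^\infty I(t\in\Delta,\xi^\varepsilon_t\in\Gamma)dt$. $\mathbb C_{[0,T]}$: continuous functions on $[0,T]$ with the uniform metric $r_T$.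 $\mathbb M_{[0,T]}$: finite measures on $[0,T]\times\mathbb R$ of the form $\nu(dt,dz)=K_\nu(t,dz)dt$ with $K_\nu$ a probability kernel, with the Lévy–Prokhorov metric $\rho_T$. *)

theory Defs
  imports "HOL-Probability.Probability" "HOL-Analysis.Analysis"
begin

definition filtered_prob_space :: "'w measure \<Rightarrow> (real \<Rightarrow> 'w set set) \<Rightarrow> bool" where
  "filtered_prob_space M F \<longleftrightarrow> prob_space M \<and>
     (\<forall>t. sigma_algebra (space M) (F t) \<and> F t \<subseteq> sets M) \<and>
     (\<forall>s t. s \<le> t \<longrightarrow> F s \<subseteq> F t)"

definition adapted_proc :: "'w measure \<Rightarrow> (real \<Rightarrow> 'w set set) \<Rightarrow> (real \<Rightarrow> 'w \<Rightarrow> real) \<Rightarrow> bool" where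
  "adapted_proc M F Y \<longleftrightarrow>
     (\<forall>t\<ge>0. \<forall>S\<in>sets (borel :: real measure). {\<omega>\<in>space M. Y t \<omega> \<in> S} \<in> F t)"

definition gauss2 :: "real \<Rightarrow> (real \<times> real) measure" where
  "gauss2 v = density lborel (normal_density 0 (sqrt v)) \<Otimes>\<^sub>M density lborel (normal_density 0 (sqrt v))"

definition indep_wiener_pair ::
  "'w measure \<Rightarrow> (real \<Rightarrow> 'w set set) \<Rightarrow> (real \<Rightarrow> 'w \<Rightarrow> real) \<Rightarrow> (real \<Rightarrow> 'w \<Rightarrow> real) \<Rightarrow> bool" where
  "indep_wiener_pair M F W V \<longleftrightarrow>
     adapted_proc M F W \<and> adapted_proc M F V \<and>
     (\<forall>\<omega>\<in>space M. W 0 \<omega> = 0 \<and> V 0 \<omega> = 0 \<and>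
        continuous_on {0..} (\<lambda>t. W t \<omega>) \<and> continuous_on {0..} (\<lambda>t. V t \<omega>)) \<and>
     (\<forall>s t. 0 \<le> s \<longrightarrow> s < t \<longrightarrow>
        (\<forall>E\<in>F s. \<forall>S\<in>sets (borel :: (real \<times> real) measure).
           measure M (E \<inter> {\<omega>\<in>space M. (W t \<omega> - W s \<omega>, V t \<omega> - V s \<omega>) \<in> S})
             = measure M E * measure (gauss2 (t - s)) S))"

definition ito_sum :: "(real \<Rightarrow> 'w \<Rightarrow> real) \<Rightarrow> (real \<Rightarrow> 'w \<Rightarrow> real) \<Rightarrow> real \<Rightarrow> nat \<Rightarrow> 'w \<Rightarrow> real" where
  "ito_sum H W t n \<omega> = (\<Sum>k<2^n. H (real k * t / 2^n) \<omega> *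
        (W (real (Suc k) * t / 2^n) \<omega> - W (real k * t / 2^n) \<omega>))"

text \<open>I is (a version of) the Ito integral of the continuous adapted integrand H
  against W over [0,t]: the limit in probability of the left-point Riemann sums.\<close>
definition is_ito_integral ::
  "'w measure \<Rightarrow> (real \<Rightarrow> 'w \<Rightarrow> real) \<Rightarrow> (real \<Rightarrow> 'w \<Rightarrow> real) \<Rightarrow> real \<Rightarrow> ('w \<Rightarrow> real) \<Rightarrow> bool" where
  "is_ito_integral M H W t I \<longleftrightarrow> I \<in> borel_measurable M \<and>
     (\<forall>\<delta>>0. (\<lambda>n. measure M {\<omega>\<in>space M. \<bar>ito_sum H W t n \<omega> - I \<omega>\<bar> > \<delta>}) \<longlonglongrightarrow> 0)"

definition sde_solution ::
  "'w measure \<Rightarrow> (real \<Rightarrow> 'w set set) \<Rightarrow> (real \<Rightarrow> 'w \<Rightarrow> real) \<Rightarrow> (real \<Rightarrow> 'w \<Rightarrow> real) \<Rightarrow>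
   (real \<Rightarrow> real \<Rightarrow> real) \<Rightarrow> (real \<Rightarrow> real \<Rightarrow> real) \<Rightarrow> (real \<Rightarrow> real) \<Rightarrow> (real \<Rightarrow> real) \<Rightarrow>
   real \<Rightarrow> real \<Rightarrow> real \<Rightarrow> (real \<Rightarrow> 'w \<Rightarrow> real) \<Rightarrow> (real \<Rightarrow> 'w \<Rightarrow> real) \<Rightarrow> bool" where
  "sde_solution M F W V A B b \<sigma> \<epsilon> x0 z0 X \<xi> \<longleftrightarrow>
     adapted_proc M F X \<and> adapted_proc M F \<xi> \<and>
     (\<forall>\<omega>\<in>space M. continuous_on {0..} (\<lambda>t. X t \<omega>) \<and> continuous_on {0..} (\<lambda>t. \<xi> t \<omega>)) \<and>
     (\<forall>t\<ge>0. \<exists>I J.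
        is_ito_integral M (\<lambda>s \<omega>. B (X s \<omega>) (\<xi> s \<omega>)) W t I \<and>
        is_ito_integral M (\<lambda>s \<omega>. \<sigma> (\<xi> s \<omega>)) V t J \<and>
        (AE \<omega> in M.
           X t \<omega> = x0 + integral {0..t} (\<lambda>s. A (X s \<omega>) (\<xi> s \<omega>)) + sqrt \<epsilon> * I \<omega> \<and>
           \<xi> t \<omega> = z0 + integral {0..t} (\<lambda>s. b (\<xi> s \<omega>) / \<epsilon>) + J \<omega> / sqrt \<epsilon>))"

definition occ_measure :: "real \<Rightarrow> (real \<Rightarrow> 'w \<Rightarrow> real) \<Rightarrow> 'w \<Rightarrow> (real \<times> real) measure" where
  "occ_measure T \<xi> \<omega> = distr (restrict_space lborel {0..T}) borel (\<lambda>t. (t, \<xi> t \<omega>))"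

definition path_on :: "real \<Rightarrow> (real \<Rightarrow> 'w \<Rightarrow> real) \<Rightarrow> 'w \<Rightarrow> real \<Rightarrow> real" where
  "path_on T X \<omega> = restrict (\<lambda>t. X t \<omega>) {0..T}"

definition CT :: "real \<Rightarrow> (real \<Rightarrow> real) set" where
  "CT T = {f. continuous_on {0..T} f \<and> f \<in> extensional {0..T}}"

definition rT :: "real \<Rightarrow> (real \<Rightarrow> real) \<Rightarrow> (real \<Rightarrow> real) \<Rightarrow> real" where
  "rT T f g = Sup ((\<lambda>t. \<bar>f t - g t\<bar>) ` {0..T})"

definition MT :: "real \<Rightarrow> (real \<times> real) measure set" where
  "MT T = {\<nu>. sets \<nu> = sets (borel :: (real \<times> real) measure) \<and>
     (\<exists>K :: real \<Rightarrow> real measure.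
        (\<forall>t. prob_space (K t) \<and> sets (K t) = sets (borel :: real measure)) \<and>
        (\<forall>S\<in>sets (borel :: (real \<times> real) measure).
            (\<lambda>t. emeasure (K t) (Pair t -` S)) \<in> borel_measurable lborel) \<and>
        (\<forall>S\<in>sets (borel :: (real \<times> real) measure).
            emeasure \<nu> S = (\<integral>\<^sup>+ t. indicator {0..T} t * emeasure (K t) (Pair t -` S) \<partial>lborel)))}"

definition levy_prokhorov :: "(real \<times> real) measure \<Rightarrow> (real \<times> real) measure \<Rightarrow> real" where
  "levy_prokhorov \<mu> \<nu> = Inf {\<delta>. \<delta> > 0 \<and> (\<forall>S. closed S \<longrightarrow>
      measure \<mu> S \<le> measure \<nu> {x. infdist x S < \<delta>} + \<delta> \<and>
      measure \<nu> S \<le> measure \<mu> {x. infdist x S < \<delta>} + \<delta>)}"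

definition prod_dist :: "real \<Rightarrow> ((real \<Rightarrow> real) \<times> (real \<times> real) measure) \<Rightarrow>
     ((real \<Rightarrow> real) \<times> (real \<times> real) measure) \<Rightarrow> real" where
  "prod_dist T p q = max (rT T (fst p) (fst q)) (levy_prokhorov (snd p) (snd q))"

definition CM_topology :: "real \<Rightarrow> ((real \<Rightarrow> real) \<times> (real \<times> real) measure) topology" where
  "CM_topology T = Metric_space.mtopology (CT T \<times> MT T) (prod_dist T)"

definition outer_prob :: "'w measure \<Rightarrow> 'w set \<Rightarrow> real" where
  "outer_prob M E = Inf {measure M B | B. B \<in> sets M \<and> E \<subseteq> B}"

definition eps_log :: "real \<Rightarrow> real \<Rightarrow> ereal" where
  "eps_log \<epsilon> p = (if p = 0 then -\<infinity> else ereal (\<epsilon> * ln p))"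

end

(* No Ito formula is needed. Weighted exponential moments show that increments of a stochastic
   integral with integrand bounded by h are sub-Gaussian given the past, first for Riemann sums on a
   common dyadic grid and then, by Fatou's lemma, for their limits in probability.

   Slow component: for each of finitely many levels R = 4^k (1 + |x0|), the dyadic increments of the
   martingale part of X at scale m exceed c (3/4)^m R before |X| leaves [-R, R] with probability
   exp (- const / eps) only. Off this event X needs a fixed time to grow by a factor 4, so it stays
   bounded and has dyadic increments of order (3/4)^m; such paths form a compact set.

   Fast component: the second order Taylor bound for f(z) = sqrt (1 + z^2) along a fine grid and the
   sub-Gaussian bounds control the integral of -f'(xi) b(xi) over [0, T], hence the mass that the
   occupation measure gives to large |z|. Tight sets are compact in the space of kernel measures: the
   functions t |-> nu ([0, t] x (-oo, q]), q rational, are 1-Lipschitz, so a subsequence converges, and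
   the Radon-Nikodym densities in t of the limits are the distribution functions of a limit kernel. *)
theory Submission
  imports Defs "HOL-Library.Diagonal_Subsequence"
begin

section \<open>Sub-Gaussian increments\<close>

text \<open>The stochastic integral is given only at each fixed time, up to null sets, as a limit in
  probability. Estimates therefore concern countably many grid times, and path continuity extends
  them to all times. Stopping times are avoided: since \<open>B\<close> grows linearly, its integral
  is estimated on the event \<open>Q\<close> that the path stays below a level up to the end of the
  increment. This event looks into the future, which is harmless: the clipped sums are bounded on
  the whole space, and the indicator is inserted only when passing to the limit.

  The ratio 3/4 is chosen because \<open>(3/4)^2 * 2 = 9/8\<close> exceeds 1: the Gaussian exponents
  grow with the scale and beat the \<open>2^m\<close> increments of scale \<open>m\<close>. The
  factor 4 between levels fits a start below a quarter of the new level and a gain below three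
  quarters of it. The noise threshold \<open>c\<close> grows with the rate \<open>j\<close>, so the
  number of levels grows as well, but independently of \<epsilon>, and \<open>eps_log\<close>
  forgets constant factors.

  For the fast component the martingale and the squared noise may reach order
  \<open>1 / \<epsilon>\<close> at the cost of a probability \<open>exp (- j / \<epsilon>)\<close>;
  multiplying the Taylor sum by \<epsilon> then bounds the drift integral.\<close>

lemma nn_integral_normal_exp:
  fixes a r :: real
  assumes "r > 0"
  shows "(\<integral>\<^sup>+ x. ennreal (exp (a * x)) \<partial>density lborel (normal_density 0 r)) = ennreal (exp (a\<^sup>2 * r\<^sup>2 / 2))"
proof -
  \<comment> \<open>Exponential tilting by completing the square: the factor
    \<open>exp (a * x)\<close> shifts the mean to \<open>a * r\<^sup>2\<close>, and the shifted
    density has total mass 1.\<close>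
  have eq: "normal_density 0 r x * exp (a * x) = exp (a\<^sup>2 * r\<^sup>2 / 2) * normal_density (a * r\<^sup>2) r x" for x
  proof -
    have "- x\<^sup>2 / (2 * r\<^sup>2) + a * x = a\<^sup>2 * r\<^sup>2 / 2 + - (x - a * r\<^sup>2)\<^sup>2 / (2 * r\<^sup>2)"
      using assms by (simp add: field_simps power2_eq_square)
    then have "exp (- x\<^sup>2 / (2 * r\<^sup>2)) * exp (a * x) = exp (a\<^sup>2 * r\<^sup>2 / 2) * exp (- (x - a * r\<^sup>2)\<^sup>2 / (2 * r\<^sup>2))"
      by (metis exp_add)
    then show ?thesis
      by (simp add: normal_density_def)
  qed
  have "(\<integral>\<^sup>+ x. ennreal (exp (a * x)) \<partial>density lborel (normal_density 0 r))
      = (\<integral>\<^sup>+ x. ennreal (normal_density 0 r x) * ennreal (exp (a * x)) \<partial>lborel)"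
    by (subst nn_integral_density) auto
  also have "\<dots> = (\<integral>\<^sup>+ x. ennreal (exp (a\<^sup>2 * r\<^sup>2 / 2)) * ennreal (normal_density (a * r\<^sup>2) r x) \<partial>lborel)"
    by (intro nn_integral_cong) (simp add: ennreal_mult[symmetric] eq)
  also have "\<dots> = ennreal (exp (a\<^sup>2 * r\<^sup>2 / 2)) * (\<integral>\<^sup>+ x. ennreal (normal_density (a * r\<^sup>2) r x) \<partial>lborel)"
    by (rule nn_integral_cmult) auto
  also have "(\<integral>\<^sup>+ x. ennreal (normal_density (a * r\<^sup>2) r x) \<partial>lborel) = 1"
    using assms by (subst nn_integral_eq_integral) auto
  finally show ?thesis by simp
qed

locale filtration_space = prob_space M for M :: "'w measure" +
  fixes F :: "real \<Rightarrow> 'w set set"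
  assumes F_sigma_algebra: "\<And>t. sigma_algebra (space M) (F t)"
    and F_subset: "\<And>t. F t \<subseteq> sets M"
    and F_mono: "\<And>s t. s \<le> t \<Longrightarrow> F s \<subseteq> F t"
begin

text \<open>Bundles \<open>F t\<close> into a measure space, so that
  \<open>F t\<close>-measurability becomes the library notion of a measurable function.\<close>

definition G :: "real \<Rightarrow> 'w measure" where "G t = sigma (space M) (F t)"

lemma space_G [simp]: "space (G t) = space M"
  using sigma_algebra.space_measure_of_eq[OF F_sigma_algebra] by (simp add: G_def)

lemma sets_G [simp]: "sets (G t) = F t"
  using sigma_algebra.sets_measure_of_eq[OF F_sigma_algebra] by (simp add: G_def)

lemma subalgebra_G: "subalgebra M (G t)"
  using F_subset by (simp add: subalgebra_def)

lemma measurable_G_mono: "f \<in> measurable (G s) N \<Longrightarrow> s \<le> t \<Longrightarrow> f \<in> measurable (G t) N"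
  using F_mono[of s t] by (fastforce simp: measurable_def)

lemma measurable_G: "f \<in> measurable (G s) N \<Longrightarrow> f \<in> measurable M N"
  using measurable_from_subalg[OF subalgebra_G] .

lemma adapted_proc_measurable: "adapted_proc M F Y \<Longrightarrow> 0 \<le> t \<Longrightarrow> Y t \<in> borel_measurable (G t)"
  by (auto simp: adapted_proc_def measurable_def vimage_def Int_def conj_commute)

text \<open>Multiplying by an arbitrary nonnegative \<open>F s\<close>-measurable weight expresses a conditional
  bound given \<open>F s\<close> without conditional expectations.\<close>
definition subgaussian :: "real \<Rightarrow> real \<Rightarrow> real \<Rightarrow> ('w \<Rightarrow> real) \<Rightarrow> bool" where
  "subgaussian s q h D \<longleftrightarrow> (\<forall>Z g H. Z \<in> borel_measurable (G s) \<longrightarrow> H \<in> borel_measurable (G s) \<longrightarrow>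
     (\<forall>\<omega>\<in>space M. \<bar>H \<omega>\<bar> \<le> g) \<longrightarrow>
     (\<integral>\<^sup>+\<omega>. Z \<omega> * ennreal (exp (H \<omega> * D \<omega>)) \<partial>M) \<le> ennreal (exp (g\<^sup>2 * h\<^sup>2 * q / 2)) * (\<integral>\<^sup>+\<omega>. Z \<omega> \<partial>M))"

lemma subgaussianD:
  assumes "subgaussian s q h D" "Z \<in> borel_measurable (G s)" "H \<in> borel_measurable (G s)"
    "\<And>\<omega>. \<omega> \<in> space M \<Longrightarrow> \<bar>H \<omega>\<bar> \<le> g"
  shows "(\<integral>\<^sup>+\<omega>. Z \<omega> * ennreal (exp (H \<omega> * D \<omega>)) \<partial>M) \<le> ennreal (exp (g\<^sup>2 * h\<^sup>2 * q / 2)) * (\<integral>\<^sup>+\<omega>. Z \<omega> \<partial>M)"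
  using assms unfolding subgaussian_def by blast

text \<open>Independence of \<open>D\<close> from \<open>F s\<close> says that the outcome, seen
  through \<open>F s\<close>, and \<open>D\<close> have a product law. By Fubini the Gaussian
  exponential is integrated first with \<open>H\<close> frozen, which gives
  \<open>exp ((H \<omega>)\<^sup>2 * (t - s) / 2)\<close>.\<close>

lemma gaussian_increment_subgaussian:
  assumes st: "s < t" and D[measurable]: "D \<in> borel_measurable M"
    and indep: "\<And>E S. E \<in> F s \<Longrightarrow> S \<in> sets borel \<Longrightarrow>
       measure M (E \<inter> {\<omega>\<in>space M. D \<omega> \<in> S})
        = measure M E * measure (density lborel (normal_density 0 (sqrt (t - s)))) S"
  shows "subgaussian s (t - s) 1 D"
  unfolding subgaussian_def
proof (intro allI impI)
  fix Z :: "'w \<Rightarrow> ennreal" and H :: "'w \<Rightarrow> real" and g :: real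
  assume Z: "Z \<in> borel_measurable (G s)" and H: "H \<in> borel_measurable (G s)"
    and Hg: "\<forall>\<omega>\<in>space M. \<bar>H \<omega>\<bar> \<le> g"
  define N where "N = density lborel (normal_density 0 (sqrt (t - s)))"
  define R where "R = restr_to_subalg M (G s)"
  interpret N: prob_space N
    unfolding N_def using st by (intro prob_space_normal_density) simp
  interpret R: prob_space R
    unfolding R_def by (rule prob_space_restr_to_subalg[OF subalgebra_G prob_space_axioms])
  have setsN[measurable_cong]: "sets N = sets borel"
    by (simp add: N_def)
  have setsR: "sets R = F s"
    using sets_restr_to_subalg[OF subalgebra_G] by (simp add: R_def)
  have spR: "space R = space M"
    by (simp add: R_def space_restr_to_subalg)
  have id: "(\<lambda>\<omega>. \<omega>) \<in> measurable M R"
    using F_subset by (auto simp: measurable_def setsR spR dest: sets.sets_into_space)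
  have pair[measurable]: "(\<lambda>\<omega>. (\<omega>, D \<omega>)) \<in> measurable M (R \<Otimes>\<^sub>M N)"
    using id by (intro measurable_Pair) auto
  \<comment> \<open>Rectangles determine a product of sigma-finite measures, and on them the
    equality is the hypothesis \<open>indep\<close>.\<close>
  have eq: "R \<Otimes>\<^sub>M N = distr M (R \<Otimes>\<^sub>M N) (\<lambda>\<omega>. (\<omega>, D \<omega>))"
  proof (rule pair_measure_eqI)
    fix A B assume A: "A \<in> sets R" and B: "B \<in> sets N"
    have AF: "A \<in> F s" "A \<in> sets M" using A setsR F_subset by auto
    have "emeasure (distr M (R \<Otimes>\<^sub>M N) (\<lambda>\<omega>. (\<omega>, D \<omega>))) (A \<times> B)
        = emeasure M (A \<inter> {\<omega>\<in>space M. D \<omega> \<in> B})"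
      using A B AF by (subst emeasure_distr) (auto intro!: arg_cong[where f="emeasure M"] dest: sets.sets_into_space)
    also have "\<dots> = ennreal (measure M A * measure N B)"
      using indep[of A B] AF B setsN by (simp add: emeasure_eq_measure N_def)
    also have "\<dots> = emeasure R A * emeasure N B"
      using AF by (simp add: R_def emeasure_restr_to_subalg[OF subalgebra_G] emeasure_eq_measure N.emeasure_eq_measure ennreal_mult)
    finally show "emeasure R A * emeasure N B = emeasure (distr M (R \<Otimes>\<^sub>M N) (\<lambda>\<omega>. (\<omega>, D \<omega>))) (A \<times> B)" ..
  qed (auto intro: R.sigma_finite_measure_axioms N.sigma_finite_measure_axioms)
  have ZR[measurable]: "Z \<in> borel_measurable R" and HR[measurable]: "H \<in> borel_measurable R"
    unfolding R_def using measurable_in_subalg[OF subalgebra_G] Z H by blast+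
  define f where "f p = Z (fst p) * ennreal (exp (H (fst p) * snd p))" for p
  have f[measurable]: "f \<in> borel_measurable (R \<Otimes>\<^sub>M N)"
    unfolding f_def by measurable
  have "(\<integral>\<^sup>+\<omega>. Z \<omega> * ennreal (exp (H \<omega> * D \<omega>)) \<partial>M) = (\<integral>\<^sup>+p. f p \<partial>distr M (R \<Otimes>\<^sub>M N) (\<lambda>\<omega>. (\<omega>, D \<omega>)))"
    using nn_integral_distr[OF pair, of f] f by (simp add: f_def[abs_def])
  also have "\<dots> = (\<integral>\<^sup>+\<omega>. (\<integral>\<^sup>+w. Z \<omega> * ennreal (exp (H \<omega> * w)) \<partial>N) \<partial>R)"
    unfolding eq[symmetric] using N.nn_integral_fst[OF f] by (simp add: f_def[abs_def])
  also have "\<dots> = (\<integral>\<^sup>+\<omega>. Z \<omega> * ennreal (exp ((H \<omega>)\<^sup>2 * (t - s) / 2)) \<partial>R)"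
    using st by (intro nn_integral_cong, subst nn_integral_cmult) (auto simp: N_def nn_integral_normal_exp)
  also have "\<dots> \<le> (\<integral>\<^sup>+\<omega>. ennreal (exp (g\<^sup>2 * 1\<^sup>2 * (t - s) / 2)) * Z \<omega> \<partial>R)"
  proof (intro nn_integral_mono)
    fix \<omega> assume "\<omega> \<in> space R"
    then have "(H \<omega>)\<^sup>2 \<le> g\<^sup>2" using Hg spR power_mono[of "\<bar>H \<omega>\<bar>" g 2] by simp
    then have "exp ((H \<omega>)\<^sup>2 * (t - s) / 2) \<le> exp (g\<^sup>2 * 1\<^sup>2 * (t - s) / 2)"
      using st by (auto intro!: mult_right_mono divide_right_mono)
    then show "Z \<omega> * ennreal (exp ((H \<omega>)\<^sup>2 * (t - s) / 2)) \<le> ennreal (exp (g\<^sup>2 * 1\<^sup>2 * (t - s) / 2)) * Z \<omega>"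
      by (subst mult.commute) (intro mult_right_mono ennreal_leI, auto)
  qed
  also have "\<dots> = ennreal (exp (g\<^sup>2 * 1\<^sup>2 * (t - s) / 2)) * (\<integral>\<^sup>+\<omega>. Z \<omega> \<partial>R)"
    by (rule nn_integral_cmult) auto
  also have "(\<integral>\<^sup>+\<omega>. Z \<omega> \<partial>R) = (\<integral>\<^sup>+\<omega>. Z \<omega> \<partial>M)"
    unfolding R_def by (rule nn_integral_subalgebra2[OF subalgebra_G Z])
  finally show "(\<integral>\<^sup>+\<omega>. Z \<omega> * ennreal (exp (H \<omega> * D \<omega>)) \<partial>M)
     \<le> ennreal (exp (g\<^sup>2 * 1\<^sup>2 * (t - s) / 2)) * (\<integral>\<^sup>+\<omega>. Z \<omega> \<partial>M)" .
qed

text \<open>Tower property without conditional expectations: the exponential of the first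
  \<open>n\<close> terms is absorbed into the weight \<open>Z\<close> and the last coefficient into
  \<open>H\<close>, which is why \<open>subgaussian\<close> quantifies over both. The variances
  \<open>q l\<close> add up.\<close>

lemma subgaussian_sum:
  fixes \<tau> :: "nat \<Rightarrow> real" and c D :: "nat \<Rightarrow> 'w \<Rightarrow> real"
  assumes sg: "\<And>l. l < n \<Longrightarrow> subgaussian (\<tau> l) (q l) k (D l)"
    and \<tau>: "\<And>l m. l \<le> m \<Longrightarrow> \<tau> l \<le> \<tau> m"
    and D: "\<And>l. l < n \<Longrightarrow> D l \<in> borel_measurable (G (\<tau> (Suc l)))"
    and c: "\<And>l. l < n \<Longrightarrow> c l \<in> borel_measurable (G (\<tau> l))"
    and ch: "\<And>l \<omega>. l < n \<Longrightarrow> \<omega> \<in> space M \<Longrightarrow> \<bar>c l \<omega>\<bar> \<le> h"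
    and q: "\<And>l. l < n \<Longrightarrow> 0 \<le> q l"
  shows "subgaussian (\<tau> 0) (\<Sum>l<n. q l) (h * k) (\<lambda>\<omega>. \<Sum>l<n. c l \<omega> * D l \<omega>)"
  using sg D c ch q
proof (induction n)
  case 0
  then show ?case by (simp add: subgaussian_def)
next
  case (Suc n)
  have IH: "subgaussian (\<tau> 0) (\<Sum>l<n. q l) (h * k) (\<lambda>\<omega>. \<Sum>l<n. c l \<omega> * D l \<omega>)"
    using Suc.prems by (intro Suc.IH) auto
  show ?case unfolding subgaussian_def
  proof (intro allI impI)
    fix Z :: "'w \<Rightarrow> ennreal" and H :: "'w \<Rightarrow> real" and g :: real
    assume Z: "Z \<in> borel_measurable (G (\<tau> 0))" and H: "H \<in> borel_measurable (G (\<tau> 0))"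
      and Hg: "\<forall>\<omega>\<in>space M. \<bar>H \<omega>\<bar> \<le> g"
    have Hn: "H \<in> borel_measurable (G (\<tau> n))" and Zn: "Z \<in> borel_measurable (G (\<tau> n))"
      using H Z \<tau> by (auto intro: measurable_G_mono)
    have "D l \<in> borel_measurable (G (\<tau> n))" "c l \<in> borel_measurable (G (\<tau> n))" if "l < n" for l
      using that measurable_G_mono[OF Suc.prems(2)[of l], of "\<tau> n"]
        measurable_G_mono[OF Suc.prems(3)[of l], of "\<tau> n"] \<tau>[of "Suc l" n] \<tau>[of l n] by auto
    then have "(\<lambda>\<omega>. \<Sum>l<n. c l \<omega> * D l \<omega>) \<in> borel_measurable (G (\<tau> n))"
      by (intro borel_measurable_sum borel_measurable_times) auto
    note [measurable] = this Hn Zn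
    have Z': "(\<lambda>\<omega>. Z \<omega> * ennreal (exp (H \<omega> * (\<Sum>l<n. c l \<omega> * D l \<omega>)))) \<in> borel_measurable (G (\<tau> n))"
      by measurable
    have "c n \<in> borel_measurable (G (\<tau> n))" using Suc.prems by auto
    then have H': "(\<lambda>\<omega>. H \<omega> * c n \<omega>) \<in> borel_measurable (G (\<tau> n))"
      using Hn by auto
    have bd: "\<bar>H \<omega> * c n \<omega>\<bar> \<le> g * h" if "\<omega> \<in> space M" for \<omega>
      using that Hg Suc.prems(4)[of n \<omega>] by (auto simp: abs_mult intro!: mult_mono)
    have "(\<integral>\<^sup>+\<omega>. Z \<omega> * ennreal (exp (H \<omega> * (\<Sum>l<Suc n. c l \<omega> * D l \<omega>))) \<partial>M)
       = (\<integral>\<^sup>+\<omega>. (Z \<omega> * ennreal (exp (H \<omega> * (\<Sum>l<n. c l \<omega> * D l \<omega>)))) * ennreal (exp (H \<omega> * c n \<omega> * D n \<omega>)) \<partial>M)"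
      by (intro nn_integral_cong) (simp add: ring_distribs exp_add ennreal_mult mult.assoc)
    also have "\<dots> \<le> ennreal (exp ((g * h)\<^sup>2 * k\<^sup>2 * q n / 2)) * (\<integral>\<^sup>+\<omega>. Z \<omega> * ennreal (exp (H \<omega> * (\<Sum>l<n. c l \<omega> * D l \<omega>))) \<partial>M)"
      using Suc.prems(1)[of n] by (intro subgaussianD[OF _ Z' H' bd]) auto
    also have "\<dots> \<le> ennreal (exp ((g * h)\<^sup>2 * k\<^sup>2 * q n / 2)) *
        (ennreal (exp (g\<^sup>2 * (h * k)\<^sup>2 * (\<Sum>l<n. q l) / 2)) * (\<integral>\<^sup>+\<omega>. Z \<omega> \<partial>M))"
      using Hg by (intro mult_left_mono subgaussianD[OF IH Z H]) auto
    also have "\<dots> = ennreal (exp (g\<^sup>2 * (h * k)\<^sup>2 * (\<Sum>l<Suc n. q l) / 2)) * (\<integral>\<^sup>+\<omega>. Z \<omega> \<partial>M)"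
      by (simp add: mult.assoc[symmetric] ennreal_mult[symmetric] exp_add[symmetric])
        (simp add: power_mult_distrib ring_distribs add_divide_distrib mult_ac add.commute)
    finally show "(\<integral>\<^sup>+\<omega>. Z \<omega> * ennreal (exp (H \<omega> * (\<Sum>l<Suc n. c l \<omega> * D l \<omega>))) \<partial>M)
      \<le> ennreal (exp (g\<^sup>2 * (h * k)\<^sup>2 * (\<Sum>l<Suc n. q l) / 2)) * (\<integral>\<^sup>+\<omega>. Z \<omega> \<partial>M)" .
  qed
qed

text \<open>Chernoff bound relative to an event \<open>Q\<close> on which alone the exponential
  moment is controlled.\<close>

lemma exponential_tail:
  assumes Q[measurable]: "Q \<in> sets M" and D[measurable]: "D \<in> borel_measurable M"
    and exp_le: "\<And>l. (\<integral>\<^sup>+\<omega>. indicator Q \<omega> * ennreal (exp (l * D \<omega>)) \<partial>M) \<le> ennreal (exp (l\<^sup>2 * v / 2))"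
    and a: "a \<ge> 0" and v: "v > 0"
  shows "measure M {\<omega>\<in>Q. D \<omega> > a} \<le> exp (- a\<^sup>2 / (2 * v))"
proof -
  \<comment> \<open>Minimises \<open>- l * a + l\<^sup>2 * v / 2\<close> over
    \<open>l\<close>.\<close>
  let ?l = "a / v"
  have Qs: "Q \<subseteq> space M" using Q by (rule sets.sets_into_space)
  have "{\<omega>\<in>Q. D \<omega> > a} = Q \<inter> {\<omega>\<in>space M. D \<omega> > a}" using Qs by auto
  then have [measurable]: "{\<omega>\<in>Q. D \<omega> > a} \<in> sets M" by simp
  have "emeasure M {\<omega>\<in>Q. D \<omega> > a} = (\<integral>\<^sup>+\<omega>. indicator {\<omega>\<in>Q. D \<omega> > a} \<omega> \<partial>M)"
    by simp
  also have "\<dots> \<le> (\<integral>\<^sup>+\<omega>. ennreal (exp (- ?l * a)) * (indicator Q \<omega> * ennreal (exp (?l * D \<omega>))) \<partial>M)"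
  proof (intro nn_integral_mono)
    fix \<omega> assume "\<omega> \<in> space M"
    show "indicator {\<omega>\<in>Q. D \<omega> > a} \<omega> \<le> ennreal (exp (- ?l * a)) * (indicator Q \<omega> * ennreal (exp (?l * D \<omega>)))"
    proof (cases "\<omega> \<in> Q \<and> D \<omega> > a")
      case True
      then have "0 \<le> - ?l * a + ?l * D \<omega>" using a v by (simp add: divide_right_mono mult_left_mono)
      then have "1 \<le> exp (- ?l * a) * exp (?l * D \<omega>)"
        by (simp only: exp_add[symmetric] one_le_exp_iff)
      then show ?thesis
        by (simp add: ennreal_mult[symmetric] indicator_def)
    qed auto
  qed
  also have "\<dots> = ennreal (exp (- ?l * a)) * (\<integral>\<^sup>+\<omega>. indicator Q \<omega> * ennreal (exp (?l * D \<omega>)) \<partial>M)"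
    by (rule nn_integral_cmult) auto
  also have "\<dots> \<le> ennreal (exp (- ?l * a)) * ennreal (exp (?l\<^sup>2 * v / 2))"
    by (intro mult_left_mono exp_le) auto
  also have "\<dots> = ennreal (exp (- ?l * a + ?l\<^sup>2 * v / 2))"
    by (simp add: ennreal_mult[symmetric] exp_add[symmetric])
  also have "- ?l * a + ?l\<^sup>2 * v / 2 = - a\<^sup>2 / (2 * v)"
    using v by (simp add: field_simps power2_eq_square)
  finally show ?thesis by (simp add: emeasure_eq_measure)
qed

lemma exponential_tail_abs:
  assumes Q[measurable]: "Q \<in> sets M" and D[measurable]: "D \<in> borel_measurable M"
    and exp_le: "\<And>l. (\<integral>\<^sup>+\<omega>. indicator Q \<omega> * ennreal (exp (l * D \<omega>)) \<partial>M) \<le> ennreal (exp (l\<^sup>2 * v / 2))"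
    and a: "a \<ge> 0" and v: "v > 0"
  shows "measure M {\<omega>\<in>Q. \<bar>D \<omega>\<bar> > a} \<le> 2 * exp (- a\<^sup>2 / (2 * v))"
proof -
  have Qs: "Q \<subseteq> space M" using Q by (rule sets.sets_into_space)
  have "{\<omega>\<in>Q. D \<omega> > a} = Q \<inter> {\<omega>\<in>space M. D \<omega> > a}" "{\<omega>\<in>Q. - D \<omega> > a} = Q \<inter> {\<omega>\<in>space M. - D \<omega> > a}"
    using Qs by auto
  then have [measurable]: "{\<omega>\<in>Q. D \<omega> > a} \<in> sets M" "{\<omega>\<in>Q. - D \<omega> > a} \<in> sets M" by simp_all
  have "{\<omega>\<in>Q. \<bar>D \<omega>\<bar> > a} = {\<omega>\<in>Q. D \<omega> > a} \<union> {\<omega>\<in>Q. - D \<omega> > a}" by auto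
  then have "measure M {\<omega>\<in>Q. \<bar>D \<omega>\<bar> > a} \<le> measure M {\<omega>\<in>Q. D \<omega> > a} + measure M {\<omega>\<in>Q. - D \<omega> > a}"
    by (simp add: measure_Un_le)
  also have "\<dots> \<le> exp (- a\<^sup>2 / (2 * v)) + exp (- a\<^sup>2 / (2 * v))"
    using exp_le[of "- l" for l] exp_le
    by (intro add_mono exponential_tail Q a v) auto
  finally show ?thesis by simp
qed

lemma subgaussian_exp_le:
  assumes sg: "subgaussian s q h D" and q: "h\<^sup>2 * q \<le> v"
  shows "(\<integral>\<^sup>+\<omega>. ennreal (exp (l * D \<omega>)) \<partial>M) \<le> ennreal (exp (l\<^sup>2 * v / 2))"
proof -
  have "(\<integral>\<^sup>+\<omega>. 1 * ennreal (exp (l * D \<omega>)) \<partial>M) \<le> ennreal (exp (\<bar>l\<bar>\<^sup>2 * h\<^sup>2 * q / 2)) * (\<integral>\<^sup>+\<omega>. 1 \<partial>M)"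
    by (intro subgaussianD[OF sg]) auto
  also have "\<dots> \<le> ennreal (exp (l\<^sup>2 * v / 2))"
    using mult_left_mono[OF q, of "l\<^sup>2"] by (simp add: emeasure_space_1 ennreal_leI mult.assoc)
  finally show ?thesis by simp
qed

lemma subgaussian_tail:
  assumes sg: "subgaussian s q h D" and D[measurable]: "D \<in> borel_measurable M"
    and a: "a \<ge> 0" and q: "h\<^sup>2 * q \<le> v" "v > 0"
  shows "measure M {\<omega>\<in>space M. D \<omega> > a} \<le> exp (- a\<^sup>2 / (2 * v))"
proof (rule exponential_tail[OF _ D _ a q(2)])
  show "(\<integral>\<^sup>+\<omega>. indicator (space M) \<omega> * ennreal (exp (l * D \<omega>)) \<partial>M) \<le> ennreal (exp (l\<^sup>2 * v / 2))" for l
    using subgaussian_exp_le[OF sg q(1)] by (simp cong: nn_integral_cong_simp)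
qed simp

lemma subgaussian_tail_abs:
  assumes sg: "subgaussian s q h D" and D[measurable]: "D \<in> borel_measurable M"
    and a: "a \<ge> 0" and q: "h\<^sup>2 * q \<le> v" "v > 0"
  shows "measure M {\<omega>\<in>space M. \<bar>D \<omega>\<bar> > a} \<le> 2 * exp (- a\<^sup>2 / (2 * v))"
proof (rule exponential_tail_abs[OF _ D _ a q(2)])
  show "(\<integral>\<^sup>+\<omega>. indicator (space M) \<omega> * ennreal (exp (l * D \<omega>)) \<partial>M) \<le> ennreal (exp (l\<^sup>2 * v / 2))" for l
    using subgaussian_exp_le[OF sg q(1)] by (simp cong: nn_integral_cong_simp)
qed simp

text \<open>On \<open>Q\<close> only, since the approximations of a stochastic integral have bounded coefficients
  only after clipping, and clipping is harmless only where the integrand is bounded.\<close>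
lemma subgaussian_limit:
  assumes sg: "\<And>n. subgaussian s q h (D n)" and D[measurable]: "\<And>n. D n \<in> borel_measurable M"
    and L[measurable]: "L \<in> borel_measurable M"
    and lim: "AE \<omega> in M. \<omega> \<in> Q \<longrightarrow> (\<lambda>n. D n \<omega>) \<longlonglongrightarrow> L \<omega>"
    and Z: "Z \<in> borel_measurable (G s)" and H: "H \<in> borel_measurable (G s)"
    and Hg: "\<And>\<omega>. \<omega> \<in> space M \<Longrightarrow> \<bar>H \<omega>\<bar> \<le> g"
  shows "(\<integral>\<^sup>+\<omega>. indicator Q \<omega> * (Z \<omega> * ennreal (exp (H \<omega> * L \<omega>))) \<partial>M)
     \<le> ennreal (exp (g\<^sup>2 * h\<^sup>2 * q / 2)) * (\<integral>\<^sup>+\<omega>. Z \<omega> \<partial>M)"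
proof -
  note [measurable] = measurable_G[OF Z] measurable_G[OF H]
  have "(\<integral>\<^sup>+\<omega>. indicator Q \<omega> * (Z \<omega> * ennreal (exp (H \<omega> * L \<omega>))) \<partial>M)
     \<le> (\<integral>\<^sup>+\<omega>. liminf (\<lambda>n. Z \<omega> * ennreal (exp (H \<omega> * D n \<omega>))) \<partial>M)"
  proof (rule nn_integral_mono_AE)
    show "AE \<omega> in M. indicator Q \<omega> * (Z \<omega> * ennreal (exp (H \<omega> * L \<omega>)))
        \<le> liminf (\<lambda>n. Z \<omega> * ennreal (exp (H \<omega> * D n \<omega>)))"
      using lim
    proof (eventually_elim)
      case (elim \<omega>)
      show ?case
      proof (cases "\<omega> \<in> Q")
        case True
        then have "(\<lambda>n. D n \<omega>) \<longlonglongrightarrow> L \<omega>" using elim by simp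
        \<comment> \<open>The product rule for limits in \<open>ennreal\<close> wants a finite
          factor; for \<open>Z \<omega> = top\<close> both sides are constantly \<open>top\<close>,
          because exponentials are positive.\<close>
        then have "(\<lambda>n. Z \<omega> * ennreal (exp (H \<omega> * D n \<omega>))) \<longlonglongrightarrow> Z \<omega> * ennreal (exp (H \<omega> * L \<omega>))"
          by (cases "Z \<omega> = top")
            (auto simp: ennreal_top_mult top.not_eq_extremum intro!: ennreal_tendsto_cmult tendsto_ennrealI tendsto_intros)
        then have "liminf (\<lambda>n. Z \<omega> * ennreal (exp (H \<omega> * D n \<omega>))) = Z \<omega> * ennreal (exp (H \<omega> * L \<omega>))"
          by (intro lim_imp_Liminf) auto
        then show ?thesis using True by simp
      qed simp
    qed
  qed
  also have "\<dots> \<le> liminf (\<lambda>n. \<integral>\<^sup>+\<omega>. Z \<omega> * ennreal (exp (H \<omega> * D n \<omega>)) \<partial>M)"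
    by (rule nn_integral_liminf) auto
  also have "\<dots> \<le> liminf (\<lambda>n::nat. ennreal (exp (g\<^sup>2 * h\<^sup>2 * q / 2)) * (\<integral>\<^sup>+\<omega>. Z \<omega> \<partial>M))"
    by (intro Liminf_mono always_eventually allI subgaussianD[OF sg Z H Hg])
  also have "\<dots> = ennreal (exp (g\<^sup>2 * h\<^sup>2 * q / 2)) * (\<integral>\<^sup>+\<omega>. Z \<omega> \<partial>M)"
    by (simp add: Liminf_const)
  finally show ?thesis .
qed

end

section \<open>Stochastic integrals as limits of Riemann sums\<close>

text \<open>Continuity from above: the tail unions of \<open>E\<close> decrease to the empty set, as
  each outcome lies in only finitely many \<open>E n\<close>. This turns uniform continuity of the
  individual paths into smallness in probability.\<close>

lemma (in prob_space) measure_tendsto_0_eventually: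
  assumes E[measurable]: "\<And>n::nat. E n \<in> sets M"
    and ev: "\<And>\<omega>. \<omega> \<in> space M \<Longrightarrow> eventually (\<lambda>n. \<omega> \<notin> E n) sequentially"
  shows "(\<lambda>n. measure M (E n)) \<longlonglongrightarrow> 0"
proof -
  define A where "A n = (\<Union>k\<in>{n..}. E k)" for n
  have A[measurable]: "A n \<in> sets M" for n unfolding A_def by auto
  have dec: "decseq A"
    unfolding decseq_def A_def by (intro allI impI UN_mono) auto
  have "(\<lambda>n. measure M (A n)) \<longlonglongrightarrow> measure M (\<Inter>n. A n)"
    using A by (intro finite_Lim_measure_decseq) (auto simp: dec)
  moreover have "(\<Inter>n. A n) = {}"
  proof -
    have "\<omega> \<notin> (\<Inter>n. A n)" for \<omega>
    proof
      assume *: "\<omega> \<in> (\<Inter>n. A n)"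
      then have "\<omega> \<in> space M" using sets.sets_into_space[OF A[of 0]] by auto
      then obtain N where "\<And>n. n \<ge> N \<Longrightarrow> \<omega> \<notin> E n" using ev by (auto simp: eventually_sequentially)
      then have "\<omega> \<notin> A N" by (auto simp: A_def)
      then show False using * by auto
    qed
    then show ?thesis by auto
  qed
  ultimately have lim: "(\<lambda>n. measure M (A n)) \<longlonglongrightarrow> 0" by simp
  have "E n \<subseteq> A n" for n by (auto simp: A_def)
  then show ?thesis
    by (intro tendsto_sandwich[OF _ _ tendsto_const lim]) (auto intro!: always_eventually finite_measure_mono)
qed

text \<open>For the truncations \<open>min \<bar>D n \<omega>\<bar> 1\<close> convergence in
  probability becomes convergence in mean, which yields an almost surely convergent subsequence;
  near 0 the truncation changes nothing.\<close>

lemma (in prob_space) tendsto_prob_AE_subseq: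
  fixes D :: "nat \<Rightarrow> 'a \<Rightarrow> real"
  assumes D[measurable]: "\<And>n. D n \<in> borel_measurable M"
    and lim: "\<And>\<zeta>. \<zeta> > 0 \<Longrightarrow> (\<lambda>n. measure M {\<omega>\<in>space M. \<bar>D n \<omega>\<bar> > \<zeta>}) \<longlonglongrightarrow> 0"
  shows "\<exists>r::nat\<Rightarrow>nat. strict_mono r \<and> (AE \<omega> in M. (\<lambda>n. D (r n) \<omega>) \<longlonglongrightarrow> 0)"
proof -
  define u where "u n \<omega> = min \<bar>D n \<omega>\<bar> 1" for n \<omega>
  have u[measurable]: "u n \<in> borel_measurable M" for n unfolding u_def by measurable
  have int: "integrable M (u n)" for n
    by (rule integrable_const_bound[where B=1]) (auto simp: u_def)
  have "(\<lambda>n. (\<integral>\<omega>. norm (u n \<omega>) \<partial>M)) \<longlonglongrightarrow> 0"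
  proof (rule LIMSEQ_I)
    fix e :: real assume e: "e > 0"
    obtain N where N: "\<And>n. n \<ge> N \<Longrightarrow> measure M {\<omega>\<in>space M. \<bar>D n \<omega>\<bar> > e/2} < e/2"
      using LIMSEQ_D[OF lim[of "e/2"], of "e/2"] e by auto
    have "norm ((\<integral>\<omega>. norm (u n \<omega>) \<partial>M) - 0) < e" if n: "n \<ge> N" for n
    proof -
      have "integrable M (\<lambda>\<omega>. indicator {\<omega>\<in>space M. \<bar>D n \<omega>\<bar> > e/2} \<omega> :: real)"
        by (intro integrable_const_bound[where B=1]) auto
      then have "(\<integral>\<omega>. norm (u n \<omega>) \<partial>M) \<le> (\<integral>\<omega>. e/2 + indicator {\<omega>\<in>space M. \<bar>D n \<omega>\<bar> > e/2} \<omega> \<partial>M)"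
        using e by (intro integral_mono integrable_norm int Bochner_Integration.integrable_add)
          (auto simp: u_def split: split_indicator)
      also have "\<dots> = e/2 + measure M {\<omega>\<in>space M. \<bar>D n \<omega>\<bar> > e/2}"
        by (subst Bochner_Integration.integral_add) (auto simp: prob_space emeasure_eq_measure)
      also have "\<dots> < e" using N[OF n] by simp
      finally show ?thesis by simp
    qed
    then show "\<exists>N. \<forall>n\<ge>N. norm ((\<integral>\<omega>. norm (u n \<omega>) \<partial>M) - 0) < e" by blast
  qed
  from tendsto_L1_AE_subseq[OF int this] obtain r :: "nat \<Rightarrow> nat"
    where r: "strict_mono r" "AE \<omega> in M. (\<lambda>n. u (r n) \<omega>) \<longlonglongrightarrow> 0" by blast
  from r(2) have "AE \<omega> in M. (\<lambda>n. D (r n) \<omega>) \<longlonglongrightarrow> 0"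
  proof eventually_elim
    case (elim \<omega>)
    show ?case
    proof (rule LIMSEQ_I)
      fix e :: real assume e: "e > 0"
      obtain N where "\<And>n. n \<ge> N \<Longrightarrow> \<bar>u (r n) \<omega>\<bar> < min e 1"
        using LIMSEQ_D[OF elim, of "min e 1"] e by auto
      then have "\<And>n. n \<ge> N \<Longrightarrow> norm (D (r n) \<omega> - 0) < e"
        by (fastforce simp: u_def min_def split: if_splits)
      then show "\<exists>N. \<forall>n\<ge>N. norm (D (r n) \<omega> - 0) < e" by blast
    qed
  qed
  with r(1) show ?thesis by blast
qed

section \<open>Riemann sums for stochastic integrals on a common grid\<close>

lemma sum_lessThan_add:
  fixes f :: "nat \<Rightarrow> 'a::comm_monoid_add"
  shows "sum f {..<a + b} = sum f {..<a} + (\<Sum>l<b. f (a + l))"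
  by (induction b) (auto simp: add.assoc)

text \<open>Splitting each cell of a dyadic partition of \<open>[0, j\<delta>]\<close> into \<open>j\<close> parts puts the
  partitions for all \<open>j\<close> on the common grid of mesh \<open>\<delta> / 2 ^ n\<close>.\<close>
lemma ito_sum_refine:
  "ito_sum H Y (real j * \<delta>) n \<omega> =
     (\<Sum>l<2^n*j. H (real (l div j * j) * (\<delta> / 2^n)) \<omega> *
       (Y (real (Suc l) * (\<delta> / 2^n)) \<omega> - Y (real l * (\<delta> / 2^n)) \<omega>))"
proof -
  let ?d = "\<delta> / 2^n"
  let ?g = "\<lambda>l. H (real (l div j * j) * ?d) \<omega> * (Y (real (Suc l) * ?d) \<omega> - Y (real l * ?d) \<omega>)"
  have "(\<Sum>l<2^n*j. ?g l) = (\<Sum>m<2^n. sum ?g {m*j..<m*j+j})"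
    by (rule sum.nat_group[symmetric])
  also have "\<dots> = (\<Sum>m<2^n. H (real m * (real j * \<delta>) / 2^n) \<omega> *
       (Y (real (Suc m) * (real j * \<delta>) / 2^n) \<omega> - Y (real m * (real j * \<delta>) / 2^n) \<omega>))"
  proof (rule sum.cong[OF refl])
    fix m :: nat
    have "sum ?g {m*j..<m*j+j} = (\<Sum>l\<in>{m*j..<m*j+j}. H (real (m * j) * ?d) \<omega> * (Y (real (Suc l) * ?d) \<omega> - Y (real l * ?d) \<omega>))"
    proof (rule sum.cong[OF refl])
      fix l assume l: "l \<in> {m*j..<m*j+j}"
      then have "l div j = m"
        by (intro div_nat_eqI) (auto simp: mult.commute)
      then show "?g l = H (real (m * j) * ?d) \<omega> * (Y (real (Suc l) * ?d) \<omega> - Y (real l * ?d) \<omega>)" by simp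
    qed
    also have "\<dots> = H (real (m * j) * ?d) \<omega> * (Y (real (m * j + j) * ?d) \<omega> - Y (real (m * j) * ?d) \<omega>)"
      unfolding sum_distrib_left[symmetric]
      by (subst sum_Suc_diff'[of "m*j" "m*j+j" "\<lambda>l. Y (real l * ?d) \<omega>"]) auto
    also have "\<dots> = H (real m * (real j * \<delta>) / 2^n) \<omega> *
       (Y (real (Suc m) * (real j * \<delta>) / 2^n) \<omega> - Y (real m * (real j * \<delta>) / 2^n) \<omega>)"
      by (simp add: algebra_simps add_divide_distrib)
    finally show "sum ?g {m*j..<m*j+j} = \<dots>" .
  qed
  finally show ?thesis by (simp add: ito_sum_def)
qed

text \<open>Makes a coefficient bounded on the whole space, as sub-Gaussian sums demand, while
  keeping it measurable and unchanged where it is already at most \<open>h\<close> in absolute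
  value.\<close>

definition clip :: "real \<Rightarrow> real \<Rightarrow> real" where "clip h x = max (- h) (min h x)"

lemma clip_eq: "\<bar>x\<bar> \<le> h \<Longrightarrow> clip h x = x"
  by (auto simp: clip_def)

lemma abs_clip_le: "0 \<le> h \<Longrightarrow> \<bar>clip h x\<bar> \<le> h"
  by (auto simp: clip_def)

lemma borel_measurable_clip[measurable]: "clip h \<in> borel_measurable borel"
  unfolding clip_def by measurable

text \<open>The interface to the Wiener process: all bounds on stochastic integrals rest on this
  conditional estimate of single increments.\<close>

locale brownian = filtration_space M F for M :: "'w measure" and F +
  fixes Y :: "real \<Rightarrow> 'w \<Rightarrow> real"
  assumes Y_adapted: "adapted_proc M F Y"
    and Y_incr: "\<And>s t. 0 \<le> s \<Longrightarrow> s < t \<Longrightarrow> subgaussian s (t - s) 1 (\<lambda>\<omega>. Y t \<omega> - Y s \<omega>)"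
begin

lemma Y_measurable: "0 \<le> t \<Longrightarrow> Y t \<in> borel_measurable (G t)"
  using Y_adapted by (rule adapted_proc_measurable)

text \<open>The start index \<open>k\<close> admits sums over a late part of the grid, which are
  sub-Gaussian given the past at time \<open>k * d\<close>.\<close>

lemma grid_sum:
  assumes d: "d > 0" and h: "h \<ge> 0"
    and c: "\<And>l. l < N \<Longrightarrow> c l \<in> borel_measurable (G (real (k + l) * d))"
    and ch: "\<And>l \<omega>. l < N \<Longrightarrow> \<omega> \<in> space M \<Longrightarrow> \<bar>c l \<omega>\<bar> \<le> h"
  defines "S \<equiv> \<lambda>\<omega>. \<Sum>l<N. c l \<omega> * (Y (real (Suc (k + l)) * d) \<omega> - Y (real (k + l) * d) \<omega>)"
  shows "subgaussian (real k * d) (real N * d) h S" and "S \<in> borel_measurable M"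
proof -
  define \<tau> where "\<tau> l = real (k + l) * d" for l
  have [measurable]: "Y (real (Suc (k + l)) * d) \<in> borel_measurable (G (\<tau> (Suc l)))"
      "Y (real (k + l) * d) \<in> borel_measurable (G (\<tau> (Suc l)))" for l
    using d Y_measurable[of "\<tau> (Suc l)"] measurable_G_mono[OF Y_measurable[of "\<tau> l"], of "\<tau> (Suc l)"]
    by (auto simp: \<tau>_def mult_right_mono)
  have D: "(\<lambda>\<omega>. Y (real (Suc (k + l)) * d) \<omega> - Y (real (k + l) * d) \<omega>) \<in> borel_measurable (G (\<tau> (Suc l)))" for l
    by measurable
  have "subgaussian (\<tau> 0) (\<Sum>l<N. d) (h * 1) S"
    unfolding S_def
  proof (rule subgaussian_sum[where D="\<lambda>l \<omega>. Y (real (Suc (k + l)) * d) \<omega> - Y (real (k + l) * d) \<omega>"])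
    fix l
    have "subgaussian (real (k + l) * d) (real (Suc (k + l)) * d - real (k + l) * d) 1
        (\<lambda>\<omega>. Y (real (Suc (k + l)) * d) \<omega> - Y (real (k + l) * d) \<omega>)"
      using d by (intro Y_incr) auto
    then show "subgaussian (\<tau> l) d 1 (\<lambda>\<omega>. Y (real (Suc (k + l)) * d) \<omega> - Y (real (k + l) * d) \<omega>)"
      by (simp add: \<tau>_def algebra_simps)
  qed (use D c ch d in \<open>auto simp: \<tau>_def mult_right_mono\<close>)
  then show "subgaussian (real k * d) (real N * d) h S" by (simp add: \<tau>_def)
  show "S \<in> borel_measurable M"
    unfolding S_def using measurable_G[OF D] measurable_G[OF c]
    by (intro borel_measurable_sum borel_measurable_times) auto
qed

end

locale ito_integrand = brownian M F Y for M :: "'w measure" and F Y +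
  fixes H :: "real \<Rightarrow> 'w \<Rightarrow> real"
  assumes H_meas: "\<And>t. 0 \<le> t \<Longrightarrow> H t \<in> borel_measurable (G t)"
    and H_cont: "\<And>\<omega>. \<omega> \<in> space M \<Longrightarrow> continuous_on {0..} (\<lambda>t. H t \<omega>)"
begin

lemma H_grid_measurable:
  assumes "d \<ge> 0" "m \<le> k"
  shows "H (real m * d) \<in> borel_measurable (G (real k * d))"
  using assms by (intro measurable_G_mono[OF H_meas]) (auto simp: mult_right_mono)

text \<open>The sums for the integrals up to \<open>i * \<delta>\<close> and
  \<open>j * \<delta>\<close> freeze \<open>H\<close> at the left ends of blocks of \<open>i\<close>
  and of \<open>j\<close> grid cells. These left ends are at most \<open>j\<close> cells apart, so
  by path continuity the coefficients of the difference eventually fall below any \<eta>, and a sum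
  with such coefficients has small sub-Gaussian variance.\<close>

lemma coarse_fine_difference_tendsto_0:
  fixes \<delta> :: real and i j :: nat
  assumes \<delta>: "\<delta> > 0" and z: "\<zeta> > 0" and i: "0 < i" "i \<le> j"
  defines "S \<equiv> \<lambda>n \<omega>. \<Sum>l<2^n*i. (H (real (l div j * j) * (\<delta> / 2^n)) \<omega> - H (real (l div i * i) * (\<delta> / 2^n)) \<omega>) *
       (Y (real (Suc l) * (\<delta> / 2^n)) \<omega> - Y (real l * (\<delta> / 2^n)) \<omega>)"
  shows "(\<lambda>n. measure M {\<omega>\<in>space M. \<bar>S n \<omega>\<bar> > \<zeta>}) \<longlonglongrightarrow> 0"
proof (rule LIMSEQ_I)
  fix e :: real assume e: "e > 0"
  define d where "d n = \<delta> / 2^n" for n :: nat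
  have d: "d n > 0" for n using \<delta> by (simp add: d_def)
  define c where "c n l \<omega> = H (real (l div j * j) * d n) \<omega> - H (real (l div i * i) * d n) \<omega>" for n l \<omega>
  have c_G: "c n l \<in> borel_measurable (G (real l * d n))" for n l
    unfolding c_def using d by (intro borel_measurable_diff H_grid_measurable) (auto intro: less_imp_le)
  have c_M[measurable]: "c n l \<in> borel_measurable M" for n l using c_G by (rule measurable_G)
  define w where "w = real i * \<delta>"
  have w: "w > 0" using i \<delta> by (simp add: w_def)
  \<comment> \<open>The exponent is to equal \<open>- m\<close> with
    \<open>exp (- m) < e / 4\<close>; solving for \<eta> gives the witness below.\<close>
  obtain \<eta> where \<eta>: "\<eta> > 0" "2 * exp (- \<zeta>\<^sup>2 / (2 * (\<eta>\<^sup>2 * w))) < e / 2"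
  proof -
    obtain m :: real where m: "m > 0" "exp (- m) < e / 4"
    proof -
      have "((\<lambda>m::real. exp (- m)) \<longlongrightarrow> 0) at_top"
        by (intro filterlim_compose[OF exp_at_bot]) (simp add: filterlim_uminus_at_bot_at_top)
      then have "\<forall>\<^sub>F m in at_top. exp (- m) < e / 4" using e by (intro order_tendstoD(2)) auto
      then have "\<forall>\<^sub>F m::real in at_top. m > 0 \<and> exp (- m) < e / 4"
        using eventually_gt_at_top by (rule eventually_conj[rotated])
      from eventually_happens[OF this] show ?thesis using that by auto
    qed
    show ?thesis
    proof (rule that[of "sqrt (\<zeta>\<^sup>2 / (2 * w * m))"])
      show "2 * exp (- \<zeta>\<^sup>2 / (2 * ((sqrt (\<zeta>\<^sup>2 / (2 * w * m)))\<^sup>2 * w))) < e / 2"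
      proof -
        have "(sqrt (\<zeta>\<^sup>2 / (2 * w * m)))\<^sup>2 = \<zeta>\<^sup>2 / (2 * w * m)" using w m by simp
        moreover have "- \<zeta>\<^sup>2 / (2 * (\<zeta>\<^sup>2 / (2 * w * m) * w)) = - m" using m w z by simp
        ultimately show ?thesis using m by simp
      qed
    qed (use z w m in auto)
  qed
  define E where "E n = {\<omega>\<in>space M. \<exists>l<2^n*i. \<bar>c n l \<omega>\<bar> > \<eta>}" for n
  have [measurable]: "E n \<in> sets M" for n unfolding E_def by measurable
  have "(\<lambda>n. measure M (E n)) \<longlonglongrightarrow> 0"
  proof (rule measure_tendsto_0_eventually)
    fix \<omega> assume om: "\<omega> \<in> space M"
    have "uniformly_continuous_on {0..w} (\<lambda>t. H t \<omega>)"
      using H_cont[OF om] by (intro compact_uniformly_continuous) (auto elim: continuous_on_subset)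
    then obtain \<rho> where \<rho>: "\<rho> > 0" "\<And>s t. s \<in> {0..w} \<Longrightarrow> t \<in> {0..w} \<Longrightarrow> \<bar>s - t\<bar> < \<rho> \<Longrightarrow> \<bar>H s \<omega> - H t \<omega>\<bar> < \<eta>"
      using \<eta>(1) unfolding uniformly_continuous_on_def dist_real_def by (metis abs_minus_commute)
    have "(\<lambda>n. \<delta> / 2^n) \<longlonglongrightarrow> 0" by (rule LIMSEQ_divide_realpow_zero) auto
    then have "\<forall>\<^sub>F n in sequentially. \<delta> / 2^n < \<rho> / (real j + 1)"
      using \<rho>(1) by (intro order_tendstoD) auto
    then show "\<forall>\<^sub>F n in sequentially. \<omega> \<notin> E n"
    proof eventually_elim
      case (elim n)
      have jd: "real j * d n < \<rho>"
      proof -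
        have "(real j + 1) * d n < \<rho>" using elim by (simp add: d_def field_simps)
        then show ?thesis using d[of n] by (simp add: algebra_simps)
      qed
      have "\<bar>c n l \<omega>\<bar> < \<eta>" if l: "l < 2^n*i" for l
      proof -
        let ?a = "l div j * j" and ?b = "l div i * i"
        have ab: "?a \<le> l" "?b \<le> l" by auto
        \<comment> \<open>Each left end is less than one block behind \<open>l\<close>, so the two
          differ by at most the longer block.\<close>
        have "l < ?a + j" "l < ?b + i"
          using i mod_less_divisor[of j l] mod_less_divisor[of i l] div_mult_mod_eq[of l j] div_mult_mod_eq[of l i] by linarith+
        then have "?a \<le> ?b + j" "?b \<le> ?a + j" using ab i by linarith+
        then have "real ?a \<le> real ?b + real j" "real ?b \<le> real ?a + real j"
          by (simp_all only: of_nat_add[symmetric] of_nat_le_iff)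
        then have "\<bar>real ?a - real ?b\<bar> \<le> real j" by linarith
        then have "\<bar>real ?a - real ?b\<bar> * d n \<le> real j * d n" using d[of n] by (intro mult_right_mono) auto
        moreover have "\<bar>real ?a * d n - real ?b * d n\<bar> = \<bar>real ?a - real ?b\<bar> * d n"
          using d[of n] by (simp add: abs_mult left_diff_distrib[symmetric] del: of_nat_mult)
        ultimately have "\<bar>real ?a * d n - real ?b * d n\<bar> < \<rho>"
          using jd by linarith
        moreover have "real m * d n \<in> {0..w}" if "m \<le> l" for m
        proof -
          have "real m \<le> real (2^n * i)" using that l by (intro of_nat_mono) linarith
          then have "real m \<le> 2^n * real i" by simp
          then have "real m * d n \<le> (2^n * real i) * d n" using d[of n] by (intro mult_right_mono) auto
          moreover have "0 \<le> real m * d n" using d[of n] by simp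
          ultimately show ?thesis by (simp add: w_def d_def)
        qed
        ultimately show ?thesis unfolding c_def using \<rho>(2) ab by blast
      qed
      then show ?case by (force simp: E_def)
    qed
  qed simp
  then obtain N where N: "\<And>n. n \<ge> N \<Longrightarrow> measure M (E n) < e / 2"
    using LIMSEQ_D[of "\<lambda>n. measure M (E n)" 0 "e/2"] e by auto
  have "norm (measure M {\<omega>\<in>space M. \<bar>S n \<omega>\<bar> > \<zeta>} - 0) < e" if n: "n \<ge> N" for n
  proof -
    define S' where "S' \<omega> = (\<Sum>l<2^n*i. clip \<eta> (c n l \<omega>) * (Y (real (Suc (0 + l)) * d n) \<omega> - Y (real (0 + l) * d n) \<omega>))" for \<omega>
    have sg: "subgaussian (real 0 * d n) (real (2^n*i) * d n) \<eta> S'" and S'[measurable]: "S' \<in> borel_measurable M"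
      unfolding S'_def using \<eta>(1) d c_G[of n]
      by (intro grid_sum[where h=\<eta>] measurable_compose[OF _ borel_measurable_clip] abs_clip_le; simp)+
    have "real (2^n*i) * d n = w" by (simp add: d_def w_def)
    then have tail: "measure M {\<omega>\<in>space M. \<bar>S' \<omega>\<bar> > \<zeta>} \<le> 2 * exp (- \<zeta>\<^sup>2 / (2 * (\<eta>\<^sup>2 * w)))"
      using z w \<eta>(1) by (intro subgaussian_tail_abs[OF sg]) auto
    \<comment> \<open>Off \<open>E n\<close> clipping changes no coefficient, so the sum equals its
      sub-Gaussian counterpart \<open>S'\<close>.\<close>
    have "{\<omega>\<in>space M. \<bar>S n \<omega>\<bar> > \<zeta>} \<subseteq> {\<omega>\<in>space M. \<bar>S' \<omega>\<bar> > \<zeta>} \<union> E n"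
    proof -
      have "S n \<omega> = S' \<omega>" if om: "\<omega> \<in> space M" "\<omega> \<notin> E n" for \<omega>
      proof -
        have "clip \<eta> (c n l \<omega>) = c n l \<omega>" if "l < 2^n*i" for l
          using om that by (intro clip_eq) (auto simp: E_def not_less dest!: spec[of _ l])
        then have "S' \<omega> = (\<Sum>l<2^n*i. c n l \<omega> * (Y (real (Suc (0 + l)) * d n) \<omega> - Y (real (0 + l) * d n) \<omega>))"
          unfolding S'_def by (intro sum.cong) auto
        then show ?thesis by (simp add: S_def c_def d_def)
      qed
      then show ?thesis by auto
    qed
    then have "measure M {\<omega>\<in>space M. \<bar>S n \<omega>\<bar> > \<zeta>} \<le> measure M ({\<omega>\<in>space M. \<bar>S' \<omega>\<bar> > \<zeta>} \<union> E n)"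
      by (intro finite_measure_mono) auto
    also have "\<dots> \<le> measure M {\<omega>\<in>space M. \<bar>S' \<omega>\<bar> > \<zeta>} + measure M (E n)"
      by (intro measure_Un_le) auto
    also have "\<dots> < e" using tail \<eta>(2) N[OF n] by linarith
    finally show ?thesis by simp
  qed
  then show "\<exists>N. \<forall>n\<ge>N. norm (measure M {\<omega>\<in>space M. \<bar>S n \<omega>\<bar> > \<zeta>} - 0) < e" by blast
qed

text \<open>On the common grid the sum for \<open>j\<close> splits at the cell
  \<open>2^n * i\<close>. Its head differs from the sum for \<open>i\<close> by \<open>Od n\<close>,
  which vanishes in probability; the rest \<open>S n\<close> involves only increments of
  \<open>Y\<close> after time \<open>i * \<delta>\<close>, which makes it accessible to estimates
  given the past. Its first coefficients may be frozen slightly before that time, which does no harm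
  to measurability.\<close>

lemma ito_increment_approx:
  fixes \<delta> :: real and i j :: nat
  assumes \<delta>: "\<delta> > 0" and i: "i < j"
    and I: "is_ito_integral M H Y (real i * \<delta>) I" and J: "is_ito_integral M H Y (real j * \<delta>) J"
  defines "S \<equiv> \<lambda>n \<omega>. \<Sum>l<2^n*(j-i). H (real ((2^n*i+l) div j * j) * (\<delta> / 2^n)) \<omega> *
       (Y (real (Suc (2^n*i+l)) * (\<delta> / 2^n)) \<omega> - Y (real (2^n*i+l) * (\<delta> / 2^n)) \<omega>)"
  shows "\<exists>r. strict_mono r \<and> (AE \<omega> in M. (\<lambda>n. S (r n) \<omega>) \<longlonglongrightarrow> J \<omega> - I \<omega>)"
proof -
  have [measurable]: "I \<in> borel_measurable M" "J \<in> borel_measurable M"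
    using I J by (auto simp: is_ito_integral_def)
  have H_M[measurable]: "H (real m * (\<delta> / 2^n)) \<in> borel_measurable M" for m n :: nat
    using \<delta> by (intro measurable_G[OF H_meas]) auto
  have Y_M[measurable]: "Y (real m * (\<delta> / 2^n)) \<in> borel_measurable M" for m n :: nat
    using \<delta> by (intro measurable_G[OF Y_measurable]) auto
  define Od where "Od n \<omega> = (\<Sum>l<2^n*i. (H (real (l div j * j) * (\<delta> / 2^n)) \<omega> - H (real (l div i * i) * (\<delta> / 2^n)) \<omega>) *
       (Y (real (Suc l) * (\<delta> / 2^n)) \<omega> - Y (real l * (\<delta> / 2^n)) \<omega>))" for n \<omega>
  have [measurable]: "S n \<in> borel_measurable M" "Od n \<in> borel_measurable M" for n
    unfolding S_def Od_def by measurable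
  define a where "a n \<omega> = ito_sum H Y (real i * \<delta>) n \<omega>" for n \<omega>
  define b where "b n \<omega> = ito_sum H Y (real j * \<delta>) n \<omega>" for n \<omega>
  have [measurable]: "a n \<in> borel_measurable M" "b n \<in> borel_measurable M" for n
    unfolding a_def b_def ito_sum_refine by measurable
  have dec: "b n \<omega> - a n \<omega> = Od n \<omega> + S n \<omega>" for n \<omega>
  proof -
    have "(2::nat)^n*j = 2^n*i + 2^n*(j-i)" using i by (simp add: algebra_simps)
    then show ?thesis
      unfolding a_def b_def ito_sum_refine Od_def S_def
      by (simp only: sum_lessThan_add) (simp add: left_diff_distrib sum_subtractf)
  qed
  have Olim: "(\<lambda>n. measure M {\<omega>\<in>space M. \<bar>Od n \<omega>\<bar> > \<zeta>}) \<longlonglongrightarrow> 0" if "\<zeta> > 0" for \<zeta>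
  proof (cases "i = 0")
    case True
    then show ?thesis using that by (simp add: Od_def)
  next
    case False
    then show ?thesis unfolding Od_def
      using \<delta> i that by (intro coarse_fine_difference_tendsto_0) auto
  qed
  have "\<exists>r. strict_mono r \<and> (AE \<omega> in M. (\<lambda>n. S (r n) \<omega> - (J \<omega> - I \<omega>)) \<longlonglongrightarrow> 0)"
  proof (rule tendsto_prob_AE_subseq)
    fix \<zeta> :: real assume z: "\<zeta> > 0"
    let ?P = "\<lambda>f. measure M {\<omega>\<in>space M. \<bar>f \<omega>\<bar> > \<zeta> / 3}"
    have Il: "\<zeta> > 0 \<Longrightarrow> (\<lambda>n. measure M {\<omega>\<in>space M. \<bar>a n \<omega> - I \<omega>\<bar> > \<zeta>}) \<longlonglongrightarrow> 0"
      and Jl: "\<zeta> > 0 \<Longrightarrow> (\<lambda>n. measure M {\<omega>\<in>space M. \<bar>b n \<omega> - J \<omega>\<bar> > \<zeta>}) \<longlonglongrightarrow> 0" for \<zeta>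
      using I J by (auto simp: is_ito_integral_def a_def b_def)
    have "(\<lambda>n. ?P (Od n) + ?P (\<lambda>\<omega>. a n \<omega> - I \<omega>) + ?P (\<lambda>\<omega>. b n \<omega> - J \<omega>)) \<longlonglongrightarrow> 0 + 0 + 0"
      using z by (intro tendsto_add Olim Il Jl) auto
    then have lim: "(\<lambda>n. ?P (Od n) + ?P (\<lambda>\<omega>. a n \<omega> - I \<omega>) + ?P (\<lambda>\<omega>. b n \<omega> - J \<omega>)) \<longlonglongrightarrow> 0" by simp
    have le: "measure M {\<omega>\<in>space M. \<bar>S n \<omega> - (J \<omega> - I \<omega>)\<bar> > \<zeta>}
        \<le> ?P (Od n) + ?P (\<lambda>\<omega>. a n \<omega> - I \<omega>) + ?P (\<lambda>\<omega>. b n \<omega> - J \<omega>)" for n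
    proof -
      have "measure M {\<omega>\<in>space M. \<bar>S n \<omega> - (J \<omega> - I \<omega>)\<bar> > \<zeta>} \<le>
         measure M ({\<omega>\<in>space M. \<bar>Od n \<omega>\<bar> > \<zeta> / 3} \<union> {\<omega>\<in>space M. \<bar>a n \<omega> - I \<omega>\<bar> > \<zeta> / 3} \<union> {\<omega>\<in>space M. \<bar>b n \<omega> - J \<omega>\<bar> > \<zeta> / 3})"
      proof (rule finite_measure_mono)
        show "{\<omega>\<in>space M. \<bar>S n \<omega> - (J \<omega> - I \<omega>)\<bar> > \<zeta>} \<subseteq>
         {\<omega>\<in>space M. \<bar>Od n \<omega>\<bar> > \<zeta> / 3} \<union> {\<omega>\<in>space M. \<bar>a n \<omega> - I \<omega>\<bar> > \<zeta> / 3} \<union> {\<omega>\<in>space M. \<bar>b n \<omega> - J \<omega>\<bar> > \<zeta> / 3}"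
        proof (intro subsetI, rule ccontr)
          fix \<omega> assume "\<omega> \<in> {\<omega>\<in>space M. \<bar>S n \<omega> - (J \<omega> - I \<omega>)\<bar> > \<zeta>}"
            "\<omega> \<notin> {\<omega>\<in>space M. \<bar>Od n \<omega>\<bar> > \<zeta> / 3} \<union> {\<omega>\<in>space M. \<bar>a n \<omega> - I \<omega>\<bar> > \<zeta> / 3} \<union> {\<omega>\<in>space M. \<bar>b n \<omega> - J \<omega>\<bar> > \<zeta> / 3}"
          then have "\<bar>S n \<omega> - (J \<omega> - I \<omega>)\<bar> > \<zeta>" "\<bar>Od n \<omega>\<bar> \<le> \<zeta> / 3" "\<bar>a n \<omega> - I \<omega>\<bar> \<le> \<zeta> / 3" "\<bar>b n \<omega> - J \<omega>\<bar> \<le> \<zeta> / 3"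
            by (auto simp: not_less)
          then show False using dec[of n \<omega>] by linarith
        qed
      qed measurable
      also have "\<dots> \<le> measure M ({\<omega>\<in>space M. \<bar>Od n \<omega>\<bar> > \<zeta> / 3} \<union> {\<omega>\<in>space M. \<bar>a n \<omega> - I \<omega>\<bar> > \<zeta> / 3}) + ?P (\<lambda>\<omega>. b n \<omega> - J \<omega>)"
        by (rule measure_Un_le) measurable
      also have "\<dots> \<le> ?P (Od n) + ?P (\<lambda>\<omega>. a n \<omega> - I \<omega>) + ?P (\<lambda>\<omega>. b n \<omega> - J \<omega>)"
        by (intro add_right_mono measure_Un_le) measurable
      finally show ?thesis .
    qed
    show "(\<lambda>n. measure M {\<omega>\<in>space M. \<bar>S n \<omega> - (J \<omega> - I \<omega>)\<bar> > \<zeta>}) \<longlonglongrightarrow> 0"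
      by (rule tendsto_sandwich[OF _ always_eventually[OF allI[OF le]] tendsto_const lim]) simp
  qed measurable
  then show ?thesis by (subst (asm) LIM_zero_iff)
qed

text \<open>The estimate is stated on an event \<open>Q\<close> on which the integrand is bounded, so that it covers
  both bounded integrands and localised ones.\<close>
lemma ito_increment_exp:
  fixes \<delta> :: real and i j :: nat
  assumes \<delta>: "\<delta> > 0" and i: "i < j"
    and I: "is_ito_integral M H Y (real i * \<delta>) I" and J: "is_ito_integral M H Y (real j * \<delta>) J"
    and h: "h \<ge> 0" and Q: "Q \<subseteq> space M"
    and HQ: "\<And>\<omega> t. \<omega> \<in> Q \<Longrightarrow> 0 \<le> t \<Longrightarrow> t \<le> real j * \<delta> \<Longrightarrow> \<bar>H t \<omega>\<bar> \<le> h"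
    and Z: "Z \<in> borel_measurable (G (real i * \<delta>))" and K: "K \<in> borel_measurable (G (real i * \<delta>))"
    and Kg: "\<And>\<omega>. \<omega> \<in> space M \<Longrightarrow> \<bar>K \<omega>\<bar> \<le> g"
  shows "(\<integral>\<^sup>+\<omega>. indicator Q \<omega> * (Z \<omega> * ennreal (exp (K \<omega> * (J \<omega> - I \<omega>)))) \<partial>M)
     \<le> ennreal (exp (g\<^sup>2 * h\<^sup>2 * (real (j - i) * \<delta>) / 2)) * (\<integral>\<^sup>+\<omega>. Z \<omega> \<partial>M)"
proof -
  have [measurable]: "I \<in> borel_measurable M" "J \<in> borel_measurable M"
    using I J by (auto simp: is_ito_integral_def)
  define c where "c n l \<omega> = H (real ((2^n*i+l) div j * j) * (\<delta> / 2^n)) \<omega>" for n l \<omega>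
  let ?D = "\<lambda>n l \<omega>. Y (real (Suc (2^n*i+l)) * (\<delta> / 2^n)) \<omega> - Y (real (2^n*i+l) * (\<delta> / 2^n)) \<omega>"
  obtain r where r: "strict_mono r" "AE \<omega> in M. (\<lambda>n. \<Sum>l<2^(r n)*(j-i). c (r n) l \<omega> * ?D (r n) l \<omega>) \<longlonglongrightarrow> J \<omega> - I \<omega>"
    using ito_increment_approx[OF \<delta> i I J] unfolding c_def by blast
  define D where "D n \<omega> = (\<Sum>l<2^n*(j-i). clip h (c n l \<omega>) * ?D n l \<omega>)" for n \<omega>
  have c_G: "c n l \<in> borel_measurable (G (real (2^n*i+l) * (\<delta> / 2^n)))" for n l
    unfolding c_def using \<delta> by (intro H_grid_measurable) auto
  have sg: "subgaussian (real (2^n*i) * (\<delta> / 2^n)) (real (2^n*(j-i)) * (\<delta> / 2^n)) h (D n)"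
    and D[measurable]: "D n \<in> borel_measurable M" for n
    unfolding D_def using \<delta> h by (intro grid_sum measurable_compose[OF c_G borel_measurable_clip] abs_clip_le; simp)+
  have "subgaussian (real i * \<delta>) (real (j-i) * \<delta>) h (D n)" for n
    using sg[of n] by simp
  moreover have "AE \<omega> in M. \<omega> \<in> Q \<longrightarrow> (\<lambda>n. D (r n) \<omega>) \<longlonglongrightarrow> J \<omega> - I \<omega>"
    using r(2)
  proof eventually_elim
    case (elim \<omega>)
    show ?case
    proof
      assume q: "\<omega> \<in> Q"
      \<comment> \<open>All evaluation times are at most \<open>j * \<delta>\<close>, the range on
        which \<open>H\<close> is bounded by \<open>h\<close> for outcomes in \<open>Q\<close>;
        hence clipping leaves the limit unchanged there.\<close>
      have "clip h (c n l \<omega>) = c n l \<omega>" if l: "l < 2^n*(j-i)" for n l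
      proof -
        have "(2^n*i+l) div j * j \<le> 2^n*j"
        proof -
          have "(2::nat)^n*i + 2^n*(j-i) = 2^n*j" using i by (simp add: algebra_simps)
          then have "2^n*i+l \<le> 2^n*j" using l by linarith
          then show ?thesis using div_times_less_eq_dividend le_trans by blast
        qed
        then have "real ((2^n*i+l) div j * j) \<le> real (2^n * j)"
          by (rule of_nat_mono)
        then have "real ((2^n*i+l) div j * j) \<le> 2^n * real j" by simp
        then have "real ((2^n*i+l) div j * j) * (\<delta> / 2^n) \<le> (2^n * real j) * (\<delta> / 2^n)"
          using \<delta> by (intro mult_right_mono) auto
        then have "\<bar>c n l \<omega>\<bar> \<le> h" unfolding c_def using \<delta> by (intro HQ q) auto
        then show ?thesis by (rule clip_eq)
      qed
      then have "D n \<omega> = (\<Sum>l<2^n*(j-i). c n l \<omega> * ?D n l \<omega>)" for n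
        unfolding D_def by (intro sum.cong) auto
      then show "(\<lambda>n. D (r n) \<omega>) \<longlonglongrightarrow> J \<omega> - I \<omega>" using elim by simp
    qed
  qed
  ultimately show ?thesis
    by (intro subgaussian_limit[where D="\<lambda>n. D (r n)", OF _ _ _ _ Z K Kg]) auto
qed

end

section \<open>Dyadic increments of continuous functions\<close>

lemma integral_sum_grid:
  fixes f :: "real \<Rightarrow> real"
  assumes d: "d \<ge> 0" and f: "continuous_on {0..real N * d} f"
  shows "integral {0..real N * d} f = (\<Sum>k<N. integral {real k * d..real (Suc k) * d} f)"
  using f
proof (induction N)
  case (Suc N)
  have le: "0 \<le> real N * d" "real N * d \<le> real (Suc N) * d" using d by (auto intro: mult_right_mono)
  have sub: "continuous_on {0..real N * d} f"
    using Suc.prems by (rule continuous_on_subset) (use le in auto)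
  have "integral {0..real N * d} f + integral {real N * d..real (Suc N) * d} f = integral {0..real (Suc N) * d} f"
    using le Suc.prems by (intro Henstock_Kurzweil_Integration.integral_combine integrable_continuous_real) auto
  then show ?case using Suc.IH[OF sub] by simp
qed simp

text \<open>Freezing \<phi> at the left end of a cell of length \<open>d\<close> costs at most
  \<open>\<eta> * K * d\<close> by uniform continuity. With \<beta> constantly 1 this is an ordinary
  Riemann sum; with general \<beta> it matches the drift term of the discrete Taylor
  estimate.\<close>

lemma stieltjes_sum_tendsto:
  fixes \<phi> \<beta> :: "real \<Rightarrow> real"
  assumes T: "T \<ge> 0" and \<phi>: "continuous_on {0..T} \<phi>" and \<beta>: "continuous_on {0..T} \<beta>"
  shows "(\<lambda>n. \<Sum>k<2^n. \<phi> (real k * (T / 2^n)) * integral {real k * (T / 2^n)..real (Suc k) * (T / 2^n)} \<beta>)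
     \<longlonglongrightarrow> integral {0..T} (\<lambda>t. \<phi> t * \<beta> t)"
proof (rule LIMSEQ_I)
  fix e :: real assume e: "e > 0"
  have "bounded (\<beta> ` {0..T})" by (intro compact_imp_bounded compact_continuous_image \<beta>) simp
  then obtain K where K: "K > 0" "\<And>t. t \<in> {0..T} \<Longrightarrow> \<bar>\<beta> t\<bar> \<le> K"
    unfolding bounded_pos by auto
  \<comment> \<open>Keeps the total error \<open>\<eta> * K * T\<close> below \<open>e\<close>; the
    added 1 covers \<open>T = 0\<close>.\<close>
  define \<eta> where "\<eta> = e / (2 * K * (T + 1))"
  have \<eta>: "\<eta> > 0" using e K T by (simp add: \<eta>_def)
  have "uniformly_continuous_on {0..T} \<phi>" by (intro compact_uniformly_continuous \<phi>) simp
  then obtain \<rho> where \<rho>: "\<rho> > 0" "\<And>s t. s \<in> {0..T} \<Longrightarrow> t \<in> {0..T} \<Longrightarrow> \<bar>s - t\<bar> < \<rho> \<Longrightarrow> \<bar>\<phi> s - \<phi> t\<bar> < \<eta>"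
    using \<eta> unfolding uniformly_continuous_on_def dist_real_def by (metis abs_minus_commute)
  have "(\<lambda>n. T / 2^n) \<longlonglongrightarrow> 0" by (rule LIMSEQ_divide_realpow_zero) auto
  then have "\<forall>\<^sub>F n in sequentially. T / 2^n < \<rho>" using \<rho>(1) by (intro order_tendstoD) auto
  then obtain N where N: "\<And>n. n \<ge> N \<Longrightarrow> T / 2^n < \<rho>" by (auto simp: eventually_sequentially)
  have "norm ((\<Sum>k<2^n. \<phi> (real k * (T / 2^n)) * integral {real k * (T / 2^n)..real (Suc k) * (T / 2^n)} \<beta>)
     - integral {0..T} (\<lambda>t. \<phi> t * \<beta> t)) < e" if n: "n \<ge> N" for n
  proof -
    define d where "d = T / 2^n"
    have d: "d \<ge> 0" "d < \<rho>" using T N[OF n] by (auto simp: d_def)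
    have Td: "T = real (2^n) * d" by (simp add: d_def)
    have cell: "{real k * d..real (Suc k) * d} \<subseteq> {0..T}" if "k < 2^n" for k
    proof -
      have "real (Suc k) * d \<le> real (2^n) * d" using that d by (intro mult_right_mono of_nat_mono) auto
      then show ?thesis using Td d by auto
    qed
    have c\<phi>: "continuous_on {real k * d..real (Suc k) * d} \<phi>" and c\<beta>: "continuous_on {real k * d..real (Suc k) * d} \<beta>"
      if "k < 2^n" for k using cell[OF that] \<phi> \<beta> by (auto intro: continuous_on_subset)
    have one: "\<bar>\<phi> (real k * d) * integral {real k * d..real (Suc k) * d} \<beta>
        - integral {real k * d..real (Suc k) * d} (\<lambda>t. \<phi> t * \<beta> t)\<bar> \<le> \<eta> * K * d" if k: "k < 2^n" for k
    proof -
      have "\<phi> (real k * d) * integral {real k * d..real (Suc k) * d} \<beta>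
          - integral {real k * d..real (Suc k) * d} (\<lambda>t. \<phi> t * \<beta> t)
         = integral {real k * d..real (Suc k) * d} (\<lambda>t. \<phi> (real k * d) * \<beta> t - \<phi> t * \<beta> t)"
        using c\<phi>[OF k] c\<beta>[OF k]
        by (subst Henstock_Kurzweil_Integration.integral_diff)
          (auto intro!: integrable_continuous_real continuous_intros)
      also have "norm \<dots> \<le> (\<eta> * K) * (real (Suc k) * d - real k * d)"
      proof (rule integral_bound)
        show "real k * d \<le> real (Suc k) * d" using d by (auto intro: mult_right_mono)
        show "continuous_on {real k * d..real (Suc k) * d} (\<lambda>t. \<phi> (real k * d) * \<beta> t - \<phi> t * \<beta> t)"
          using c\<phi>[OF k] c\<beta>[OF k] by (auto intro!: continuous_intros)
        fix t assume t: "t \<in> {real k * d..real (Suc k) * d}"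
        then have tT: "t \<in> {0..T}" "real k * d \<in> {0..T}" using cell[OF k] by auto
        have "\<bar>real k * d - t\<bar> < \<rho>" using t d by (auto simp: algebra_simps)
        then have "\<bar>\<phi> (real k * d) - \<phi> t\<bar> * \<bar>\<beta> t\<bar> \<le> \<eta> * K"
          using \<rho>(2)[of "real k * d" t] K(2)[of t] tT \<eta> K(1) by (intro mult_mono) auto
        then show "norm (\<phi> (real k * d) * \<beta> t - \<phi> t * \<beta> t) \<le> \<eta> * K"
          by (simp add: abs_mult[symmetric] left_diff_distrib)
      qed
      finally show ?thesis by (simp add: algebra_simps)
    qed
    have "integral {0..T} (\<lambda>t. \<phi> t * \<beta> t) = (\<Sum>k<2^n. integral {real k * d..real (Suc k) * d} (\<lambda>t. \<phi> t * \<beta> t))"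
      unfolding Td using Td \<phi> \<beta> d by (intro integral_sum_grid) (auto intro!: continuous_intros)
    then have "\<bar>(\<Sum>k<2^n. \<phi> (real k * d) * integral {real k * d..real (Suc k) * d} \<beta>)
       - integral {0..T} (\<lambda>t. \<phi> t * \<beta> t)\<bar> \<le> (\<Sum>k<2^n::nat. \<eta> * K * d)"
      unfolding sum_subtractf[symmetric]
      by (simp only: sum_subtractf[symmetric]) (intro order_trans[OF sum_abs] sum_mono one, simp)
    also have "\<dots> = \<eta> * K * T" by (simp add: d_def)
    also have "\<dots> = e * (T / (2 * (T + 1)))" using K by (simp add: \<eta>_def)
    also have "\<dots> < e * 1" using e T by (intro mult_strict_left_mono) auto
    also have "\<dots> = e" by simp
    finally show ?thesis by (simp add: d_def)
  qed
  then show "\<exists>N. \<forall>n\<ge>N. norm ((\<Sum>k<2^n. \<phi> (real k * (T / 2^n)) * integral {real k * (T / 2^n)..real (Suc k) * (T / 2^n)} \<beta>)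
     - integral {0..T} (\<lambda>t. \<phi> t * \<beta> t)) < e" by blast
qed

section \<open>Chaining over dyadic points\<close>

lemma sum_geometric_three_quarters: "(\<Sum>i<k. (3/4::real)^(m + Suc i)) \<le> 3 * (3/4)^m"
proof -
  have "(\<Sum>i<k. (3/4::real)^(m + Suc i)) = 3 * (3/4)^m - 3 * (3/4)^(m+k)"
  proof (induction k)
    case (Suc k)
    have "(3/4::real)^(m + Suc k) = 3/4 * (3/4)^(m+k)" by simp
    moreover have "(\<Sum>i<Suc k. (3/4::real)^(m + Suc i)) = (\<Sum>i<k. (3/4::real)^(m + Suc i)) + (3/4::real)^(m + Suc k)" by simp
    ultimately show ?case using Suc by linarith
  qed simp
  then show ?thesis by simp
qed

text \<open>The floor is the index of the dyadic point just below a time; passing to the next scale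
  appends one binary digit.\<close>

lemma nat_floor_double:
  fixes x :: real assumes "x \<ge> 0"
  shows "nat \<lfloor>2 * x\<rfloor> = 2 * nat \<lfloor>x\<rfloor> \<or> nat \<lfloor>2 * x\<rfloor> = Suc (2 * nat \<lfloor>x\<rfloor>)"
proof -
  have "\<lfloor>2 * x\<rfloor> = 2 * \<lfloor>x\<rfloor> \<or> \<lfloor>2 * x\<rfloor> = 2 * \<lfloor>x\<rfloor> + 1" by linarith
  moreover have "\<lfloor>x\<rfloor> \<ge> 0" using assms by simp
  ultimately show ?thesis by linarith
qed

text \<open>A Hoelder condition of exponent \<open>log 2 (4/3)\<close>, about 0.415 and thus below
  the 1/2 of Brownian paths, tested on dyadic cells. The grid belongs to \<open>[0, T]\<close> while
  \<tau> selects the cells that end by then, so that the condition can be used up to a hitting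
  time.\<close>

definition dyadic_increments :: "real \<Rightarrow> real \<Rightarrow> real \<Rightarrow> (real \<Rightarrow> real) \<Rightarrow> bool" where
  "dyadic_increments T \<tau> c f \<longleftrightarrow> (\<forall>m i. real (Suc i) * (T / 2^m) \<le> \<tau> \<longrightarrow>
      \<bar>f (real (Suc i) * (T / 2^m)) - f (real i * (T / 2^m))\<bar> \<le> c * (3/4)^m)"

text \<open>Kolmogorov's chaining: a time is the limit of the dyadic points below it, and each
  refinement moves by at most one cell. Approximating from below keeps all points inside
  \<open>[0, \<tau>]\<close>.\<close>

lemma dyadic_increments_imp_modulus:
  assumes T: "T > 0" and f: "continuous_on {0..\<tau>} f" and inc: "dyadic_increments T \<tau> c f" and c: "c \<ge> 0"
    and st: "0 \<le> s" "s \<le> t" "t \<le> \<tau>" "t - s \<le> T / 2^m"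
  shows "\<bar>f t - f s\<bar> \<le> 7 * c * (3/4)^m"
proof -
  define K where "K t m = nat \<lfloor>t * 2^m / T\<rfloor>" for t and m :: nat
  define p where "p t m = real (K t m) * (T / 2^m)" for t and m :: nat
  have p: "p t m \<le> t" "t < p t m + T / 2^m" "0 \<le> p t m" if "0 \<le> t" for t m
  proof -
    have x: "0 \<le> t * 2^m / T" using that T by simp
    have "real (K t m) \<le> t * 2^m / T" "t * 2^m / T < real (K t m) + 1"
      using x unfolding K_def by linarith+
    then show "p t m \<le> t" "t < p t m + T / 2^m" "0 \<le> p t m"
      using T by (auto simp: p_def field_simps)
  qed
  have step: "\<bar>f (p t (Suc m)) - f (p t m)\<bar> \<le> c * (3/4)^Suc m" if t: "0 \<le> t" "t \<le> \<tau>" for t m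
  proof -
    have "K t (Suc m) = 2 * K t m \<or> K t (Suc m) = Suc (2 * K t m)"
      using nat_floor_double[of "t * 2^m / T"] t T by (simp add: K_def mult_ac)
    then show ?thesis
    proof
      assume "K t (Suc m) = 2 * K t m"
      then have "p t (Suc m) = p t m" by (simp add: p_def)
      then show ?thesis using c by simp
    next
      assume S: "K t (Suc m) = Suc (2 * K t m)"
      have "p t (Suc m) = real (Suc (2 * K t m)) * (T / 2^Suc m)" using S by (simp add: p_def)
      moreover have "p t m = real (2 * K t m) * (T / 2^Suc m)" by (simp add: p_def)
      moreover have "p t (Suc m) \<le> \<tau>" using p(1)[of t "Suc m"] t by linarith
      ultimately show ?thesis using inc unfolding dyadic_increments_def by metis
    qed
  qed
  have many: "\<bar>f (p t (m + k)) - f (p t m)\<bar> \<le> c * (\<Sum>i<k. (3/4)^(m + Suc i))" if "0 \<le> t" "t \<le> \<tau>" for t m k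
  proof (induction k)
    case (Suc k)
    have "c * (\<Sum>i<Suc k. (3/4)^(m + Suc i)) = c * (\<Sum>i<k. (3/4)^(m + Suc i)) + c * (3/4)^Suc (m + k)"
      by (simp only: sum.lessThan_Suc ring_distribs add_Suc_right)
    then show ?case using Suc step[OF that, of "m + k"] unfolding add_Suc_right by linarith
  qed simp
  have lim: "\<bar>f t - f (p t m)\<bar> \<le> 3 * c * (3/4)^m" if t: "0 \<le> t" "t \<le> \<tau>" for t m
  proof -
    have "(\<lambda>k. p t (m + k)) \<longlonglongrightarrow> t"
    proof (rule tendsto_sandwich)
      have "(\<lambda>k. T / 2^(m + k)) \<longlonglongrightarrow> 0"
        using LIMSEQ_ignore_initial_segment[OF LIMSEQ_divide_realpow_zero[of 2 T], of m] by (simp add: add.commute)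
      then show "(\<lambda>k. t - T / 2^(m + k)) \<longlonglongrightarrow> t"
        using tendsto_diff[OF tendsto_const[of t]] by fastforce
      show "\<forall>\<^sub>F k in sequentially. t - T / 2^(m + k) \<le> p t (m + k)"
        using p(2)[OF t(1)] by (intro always_eventually allI) (simp add: less_imp_le algebra_simps)
      show "\<forall>\<^sub>F k in sequentially. p t (m + k) \<le> t"
        using p(1)[OF t(1)] by (intro always_eventually allI) simp
    qed simp
    moreover have "p t (m + k) \<in> {0..\<tau>}" for k using p[OF t(1), of "m + k"] t by auto
    ultimately have "(\<lambda>k. f (p t (m + k))) \<longlonglongrightarrow> f t"
      using t by (intro continuous_on_tendsto_compose[OF f]) auto
    then have "(\<lambda>k. \<bar>f (p t (m + k)) - f (p t m)\<bar>) \<longlonglongrightarrow> \<bar>f t - f (p t m)\<bar>"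
      by (intro tendsto_intros)
    moreover have "\<bar>f (p t (m + k)) - f (p t m)\<bar> \<le> 3 * c * (3/4)^m" for k
      using many[OF t, of m k] mult_left_mono[OF sum_geometric_three_quarters[of m k] c] by simp
    ultimately show ?thesis by (intro LIMSEQ_le_const2) auto
  qed
  have "\<bar>f (p t m) - f (p s m)\<bar> \<le> c * (3/4)^m"
  proof -
    have "t * 2^m / T - s * 2^m / T \<le> 1" "s * 2^m / T \<le> t * 2^m / T" "0 \<le> s * 2^m / T"
      using st T by (auto simp: field_simps)
    then have "nat \<lfloor>t * 2^m / T\<rfloor> = nat \<lfloor>s * 2^m / T\<rfloor> \<or> nat \<lfloor>t * 2^m / T\<rfloor> = Suc (nat \<lfloor>s * 2^m / T\<rfloor>)"
      by linarith
    then have "K t m = K s m \<or> K t m = Suc (K s m)" by (simp add: K_def)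
    then show ?thesis
    proof
      assume "K t m = K s m"
      then show ?thesis using c by (simp add: p_def)
    next
      assume "K t m = Suc (K s m)"
      then have "p t m = real (Suc (K s m)) * (T / 2^m)" by (simp add: p_def)
      moreover have "p t m \<le> \<tau>" using p(1)[of t m] st by linarith
      ultimately show ?thesis using inc unfolding dyadic_increments_def p_def by metis
    qed
  qed
  \<comment> \<open>Chaining from \<open>t\<close> and from \<open>s\<close> costs
    \<open>3 * c * (3/4)^m\<close> each, and the step between their two points of scale
    \<open>m\<close> one more \<open>c * (3/4)^m\<close>; this makes 7.\<close>
  then show ?thesis using lim[of t m] lim[of s m] st by linarith
qed

text \<open>A path that has to grow by a factor 4 needs at least the time \<open>T / 2 ^ m0\<close>, as its modulus of
  continuity is proportional to the bound reached so far; so it stays below the last level.\<close>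
lemma scaled_increments_imp_dyadic_increments:
  fixes x :: "real \<Rightarrow> real" and m0 :: nat
  assumes T: "T > 0" and x: "continuous_on {0..T} x" and D: "D \<ge> 0" and m0: "7 * D * (3/4)^m0 < 3/4"
  defines "R \<equiv> \<lambda>k::nat. 4^k * (1 + \<bar>x 0\<bar>)"
  assumes inc: "\<And>k m i. k \<le> 2^m0 \<Longrightarrow> i < 2^m \<Longrightarrow> (\<And>t. 0 \<le> t \<Longrightarrow> t \<le> real (Suc i) * (T / 2^m) \<Longrightarrow> \<bar>x t\<bar> \<le> R k) \<Longrightarrow>
     \<bar>x (real (Suc i) * (T / 2^m)) - x (real i * (T / 2^m))\<bar> \<le> D * R k * (3/4)^m"
  shows "dyadic_increments T T (D * R (2^m0)) x"
proof -
  have Rpos: "R k > 0" for k by (simp add: R_def add_pos_nonneg)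
  have idx: "i < 2^m" if "real (Suc i) * (T / 2^m) \<le> T" for i m
  proof -
    have "real (Suc i) * (T / 2^m) * (2^m / T) \<le> T * (2^m / T)" using that T by (intro mult_right_mono) auto
    then have "real (Suc i) \<le> 2^m" using T by simp
    then have "real (Suc i) \<le> real (2^m)" by simp
    then show ?thesis by (simp only: of_nat_le_iff Suc_le_eq)
  qed
  have dy: "dyadic_increments T \<tau> (D * R k) x"
    if k: "k \<le> 2^m0" and \<tau>: "\<tau> \<le> T" and b: "\<And>t. 0 \<le> t \<Longrightarrow> t \<le> \<tau> \<Longrightarrow> \<bar>x t\<bar> \<le> R k" for \<tau> k
    unfolding dyadic_increments_def using \<tau> by (intro allI impI inc k idx b) auto
  have "\<forall>t. 0 \<le> t \<longrightarrow> t \<le> T \<longrightarrow> t \<le> real k * (T / 2^m0) \<longrightarrow> \<bar>x t\<bar> < R k" if "k \<le> 2^m0" for k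
    using that
  proof (induction k)
    case 0
    then show ?case using T by (auto simp: R_def)
  next
    case (Suc k)
    let ?h = "T / 2^m0"
    show ?case
    proof (rule ccontr)
      assume "\<not> ?thesis"
      then obtain t where t: "0 \<le> t" "t \<le> T" "t \<le> real (Suc k) * ?h" "\<bar>x t\<bar> \<ge> R (Suc k)" by (auto simp: not_less)
      \<comment> \<open>The minimum \<tau> of this compact set is the first time at which the path
        reaches level \<open>R (Suc k)\<close>.\<close>
      define U where "U = {s \<in> {0..t}. R (Suc k) \<le> \<bar>x s\<bar>}"
      have xt: "continuous_on {0..t} x" using x by (rule continuous_on_subset) (use t in auto)
      have "closed U" unfolding U_def
        using continuous_closed_preimage[of "{0..t}" "\<lambda>s. \<bar>x s\<bar>" "{R (Suc k)..}"] xt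
        by (auto intro!: continuous_intros simp: vimage_def Int_def)
      moreover have "bounded U" unfolding U_def by (rule bounded_subset[OF bounded_closed_interval[of 0 t]]) auto
      ultimately have "compact U" by (simp add: compact_eq_bounded_closed)
      moreover have "U \<noteq> {}" using t by (auto simp: U_def)
      ultimately have "\<exists>\<tau>\<in>U. \<forall>s\<in>U. \<tau> \<le> s" by (rule compact_attains_inf)
      then obtain \<tau> where \<tau>: "\<tau> \<in> U" "\<forall>s\<in>U. \<tau> \<le> s" ..
      have lt: "\<bar>x s\<bar> < R (Suc k)" if "0 \<le> s" "s < \<tau>" for s
      proof (rule ccontr)
        assume "\<not> ?thesis"
        then have "s \<in> U" using that \<tau>(1) by (simp add: U_def)
        then show False using \<tau>(2) that by auto
      qed
      have \<tau>': "0 \<le> \<tau>" "\<tau> \<le> t" "R (Suc k) \<le> \<bar>x \<tau>\<bar>" using \<tau>(1) by (auto simp: U_def)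
      have x\<tau>: "continuous_on {0..\<tau>} x" using x by (rule continuous_on_subset) (use t \<tau>' in auto)
      have "R k < R (Suc k)" using Rpos[of k] by (simp add: R_def)
      have kh: "real k * ?h < \<tau>"
      proof (rule ccontr)
        assume "\<not> ?thesis"
        then have "\<bar>x \<tau>\<bar> < R k" using Suc.IH Suc.prems \<tau>' t by auto
        then show False using \<open>R k < R (Suc k)\<close> \<tau>' by linarith
      qed
      have kh0: "0 \<le> real k * ?h" using T by simp
      \<comment> \<open>The modulus estimate needs the closed interval; at \<tau> itself the bound
        comes from the left limit.\<close>
      have le: "\<bar>x s\<bar> \<le> R (Suc k)" if s: "0 \<le> s" "s \<le> \<tau>" for s
      proof (cases "s < \<tau>")
        case True then show ?thesis using lt s by (auto intro: less_imp_le)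
      next
        case False
        then have st: "s = \<tau>" using s by simp
        have "continuous_on {real k * ?h..\<tau>} (\<lambda>s. \<bar>x s\<bar>)"
          using x\<tau> kh0 by (intro continuous_intros) (auto intro: continuous_on_subset)
        then have "((\<lambda>s. \<bar>x s\<bar>) \<longlongrightarrow> \<bar>x \<tau>\<bar>) (at_left \<tau>)"
          using kh by (rule continuous_on_Icc_at_leftD)
        moreover have "\<forall>\<^sub>F s in at_left \<tau>. \<bar>x s\<bar> \<le> R (Suc k)"
          using eventually_at_left_real[OF kh] by eventually_elim (use lt kh0 in \<open>auto intro!: less_imp_le\<close>)
        ultimately show ?thesis unfolding st
          by (intro tendsto_upperbound) (auto simp: trivial_limit_at_left_real)
      qed
      have "\<tau> - real k * ?h \<le> ?h" using \<tau>'(2) t(3) by (simp add: ring_distribs add_divide_distrib)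
      then have "\<bar>x \<tau> - x (real k * ?h)\<bar> \<le> 7 * (D * R (Suc k)) * (3/4)^m0"
        using kh kh0 \<tau>' t Suc.prems D Rpos[of "Suc k"] le
        by (intro dyadic_increments_imp_modulus[OF T x\<tau>] dy) auto
      also have "\<dots> = (7 * D * (3/4)^m0) * R (Suc k)" by simp
      also have "\<dots> < 3/4 * R (Suc k)" using m0 Rpos[of "Suc k"] by (rule mult_strict_right_mono)
      finally have 1: "\<bar>x \<tau> - x (real k * ?h)\<bar> < 3/4 * R (Suc k)" .
      \<comment> \<open>Less than a quarter of the new level at the start and less than three
        quarters gained: the level cannot have been reached.\<close>
      have "\<bar>x (real k * ?h)\<bar> < R k" using Suc.IH Suc.prems kh0 kh \<tau>' t by auto
      moreover have "R (Suc k) = 4 * R k" by (simp add: R_def)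
      ultimately show False using 1 \<tau>'(3) by linarith
    qed
  qed
  from this[of "2^m0"] have b: "\<And>t. 0 \<le> t \<Longrightarrow> t \<le> T \<Longrightarrow> \<bar>x t\<bar> \<le> R (2^m0)" by (auto intro: less_imp_le)
  then show "dyadic_increments T T (D * R (2^m0)) x"
    using b by (intro dy) auto
qed

text \<open>Taylor bound for a function with second derivative at most 1, obtained from the
  inequality of arithmetic and geometric means,
  \<open>sqrt u \<le> (u + f\<^sup>2) / (2 * f)\<close> with
  \<open>f = sqrt (1 + x\<^sup>2)\<close>, and an exact expansion.\<close>

lemma sqrt_one_plus_square_le:
  fixes x y :: real
  shows "sqrt (1 + y\<^sup>2) \<le> sqrt (1 + x\<^sup>2) + x / sqrt (1 + x\<^sup>2) * (y - x) + (y - x)\<^sup>2 / 2"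
proof -
  define f where "f = sqrt (1 + x\<^sup>2)"
  have f: "f \<ge> 1" "f\<^sup>2 = 1 + x\<^sup>2" by (simp_all add: f_def)
  have "sqrt (1 + y\<^sup>2) \<le> (1 + y\<^sup>2 + f\<^sup>2) / (2 * f)"
  proof (rule real_le_lsqrt)
    have "0 \<le> (1 + y\<^sup>2 - f\<^sup>2)\<^sup>2" by simp
    then have "(1 + y\<^sup>2) * (2 * f)\<^sup>2 \<le> (1 + y\<^sup>2 + f\<^sup>2)\<^sup>2" by (simp add: power2_eq_square algebra_simps)
    then show "1 + y\<^sup>2 \<le> ((1 + y\<^sup>2 + f\<^sup>2) / (2 * f))\<^sup>2"
      using f(1) by (simp add: power_divide pos_le_divide_eq)
  qed (use f in auto)
  also have "\<dots> = f + x / f * (y - x) + (y - x)\<^sup>2 / (2 * f)"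
    using f by (simp add: field_simps power2_eq_square)
  also have "\<dots> \<le> f + x / f * (y - x) + (y - x)\<^sup>2 / 2"
    using f(1) by (intro add_left_mono divide_left_mono) auto
  finally show ?thesis by (simp add: f_def)
qed

text \<open>Trades the square for linear exponents of both signs, which the sub-Gaussian property
  controls. Truncation at 1 allows \<open>exp y \<le> 1 + 2 * y\<close>, and
  \<open>1 + z\<^sup>2 / 2 \<le> cosh z\<close> with \<open>z = 2 * sqrt \<mu> * x\<close> dominates
  this.\<close>

lemma exp_min_le_cosh:
  fixes x \<mu> :: real
  assumes "\<mu> \<ge> 0"
  shows "exp (min (\<mu> * x\<^sup>2) 1) \<le> (exp (2 * sqrt \<mu> * x) + exp (- (2 * sqrt \<mu> * x))) / 2"
proof -
  define y where "y = min (\<mu> * x\<^sup>2) 1"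
  have y: "0 \<le> y" "y \<le> 1" "y \<le> \<mu> * x\<^sup>2" using assms by (auto simp: y_def)
  have "exp y \<le> 1 + y + y\<^sup>2" using y by (intro exp_bound) auto
  also have "\<dots> \<le> 1 + 2 * y" using y by (simp add: power2_eq_square mult_left_le)
  also have "\<dots> \<le> 1 + (2 * sqrt \<mu> * x)\<^sup>2 / 2" using y assms by (simp add: power_mult_distrib)
  also have "\<dots> \<le> cosh (2 * sqrt \<mu> * x)"
  proof -
    have sq: "1 + z\<^sup>2 / 2 \<le> cosh z" for z :: real
    proof -
      \<comment> \<open>Powers 0 to 2 of the series of \<open>cosh\<close>; all terms are
        nonnegative.\<close>
      let ?a = "\<lambda>n. if even n then z ^ n /\<^sub>R fact n else 0"
      have "sum ?a {..<3} \<le> suminf ?a"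
        using cosh_converges[of z] by (intro sum_le_suminf) (auto simp: sums_iff zero_le_even_power)
      then show ?thesis
        using cosh_converges[of z] by (simp add: sums_iff numeral_3_eq_3 lessThan_Suc power2_eq_square)
    qed
    show ?thesis by (rule sq)
  qed
  finally show ?thesis by (simp add: y_def cosh_field_def)
qed

section \<open>The fast component\<close>

context filtration_space
begin

lemma subgaussian_cong_AE:
  assumes "subgaussian s q h D" and "AE \<omega> in M. D' \<omega> = D \<omega>"
  shows "subgaussian s q h D'"
  unfolding subgaussian_def
proof (intro allI impI)
  fix Z :: "'w \<Rightarrow> ennreal" and H :: "'w \<Rightarrow> real" and g :: real
  assume Z: "Z \<in> borel_measurable (G s)" and H: "H \<in> borel_measurable (G s)"
      and Hg: "\<forall>\<omega>\<in>space M. \<bar>H \<omega>\<bar> \<le> g"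
  have "(\<integral>\<^sup>+\<omega>. Z \<omega> * ennreal (exp (H \<omega> * D' \<omega>)) \<partial>M) = (\<integral>\<^sup>+\<omega>. Z \<omega> * ennreal (exp (H \<omega> * D \<omega>)) \<partial>M)"
    using assms(2) by (intro nn_integral_cong_AE) auto
  also have "\<dots> \<le> ennreal (exp (g\<^sup>2 * h\<^sup>2 * q / 2)) * (\<integral>\<^sup>+\<omega>. Z \<omega> \<partial>M)"
    using Hg by (intro subgaussianD[OF assms(1) Z H]) auto
  finally show "(\<integral>\<^sup>+\<omega>. Z \<omega> * ennreal (exp (H \<omega> * D' \<omega>)) \<partial>M) \<le> ennreal (exp (g\<^sup>2 * h\<^sup>2 * q / 2)) * (\<integral>\<^sup>+\<omega>. Z \<omega> \<partial>M)" .
qed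

lemma subgaussian_scale:
  assumes "subgaussian s q h D"
  shows "subgaussian s q (h * \<bar>a\<bar>) (\<lambda>\<omega>. a * D \<omega>)"
  unfolding subgaussian_def
proof (intro allI impI)
  fix Z :: "'w \<Rightarrow> ennreal" and H :: "'w \<Rightarrow> real" and g :: real
  assume Z: "Z \<in> borel_measurable (G s)" and H[measurable]: "H \<in> borel_measurable (G s)"
      and Hg: "\<forall>\<omega>\<in>space M. \<bar>H \<omega>\<bar> \<le> g"
  have "(\<integral>\<^sup>+\<omega>. Z \<omega> * ennreal (exp ((H \<omega> * a) * D \<omega>)) \<partial>M) \<le> ennreal (exp ((g * \<bar>a\<bar>)\<^sup>2 * h\<^sup>2 * q / 2)) * (\<integral>\<^sup>+\<omega>. Z \<omega> \<partial>M)"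
    using Hg by (intro subgaussianD[OF assms Z]) (auto simp: abs_mult intro: mult_right_mono)
  then show "(\<integral>\<^sup>+\<omega>. Z \<omega> * ennreal (exp (H \<omega> * (a * D \<omega>))) \<partial>M) \<le> ennreal (exp (g\<^sup>2 * (h * \<bar>a\<bar>)\<^sup>2 * q / 2)) * (\<integral>\<^sup>+\<omega>. Z \<omega> \<partial>M)"
    by (simp add: mult_ac power_mult_distrib)
qed

text \<open>The exponent is linear in the variance \<open>q\<close>, so along a grid of
  \<open>[0, T]\<close> the exponents sum to a quantity that does not depend on the mesh.\<close>

lemma subgaussian_exp_min_square:
  assumes sg: "subgaussian s q h D" and D[measurable]: "D \<in> borel_measurable M" and \<mu>: "\<mu> \<ge> 0"
    and Z: "Z \<in> borel_measurable (G s)"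
  shows "(\<integral>\<^sup>+\<omega>. Z \<omega> * ennreal (exp (min (\<mu> * (D \<omega>)\<^sup>2) 1)) \<partial>M) \<le> ennreal (exp (2 * \<mu> * h\<^sup>2 * q)) * (\<integral>\<^sup>+\<omega>. Z \<omega> \<partial>M)"
proof -
  let ?c = "2 * sqrt \<mu>" and ?I = "\<integral>\<^sup>+\<omega>. Z \<omega> \<partial>M"
  note [measurable] = measurable_G[OF Z]
  have b: "(\<integral>\<^sup>+\<omega>. Z \<omega> * ennreal (exp (l * D \<omega>)) \<partial>M) \<le> ennreal (exp (2 * \<mu> * h\<^sup>2 * q)) * ?I" if "\<bar>l\<bar> = ?c" for l
  proof -
    have "(\<integral>\<^sup>+\<omega>. Z \<omega> * ennreal (exp (l * D \<omega>)) \<partial>M) \<le> ennreal (exp (?c\<^sup>2 * h\<^sup>2 * q / 2)) * ?I"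
      using that by (intro subgaussianD[OF sg Z]) auto
    also have "?c\<^sup>2 * h\<^sup>2 * q / 2 = 2 * \<mu> * h\<^sup>2 * q" using \<mu> by (simp add: power_mult_distrib)
    finally show ?thesis .
  qed
  have "(\<integral>\<^sup>+\<omega>. Z \<omega> * ennreal (exp (min (\<mu> * (D \<omega>)\<^sup>2) 1)) \<partial>M)
     \<le> (\<integral>\<^sup>+\<omega>. ennreal (1/2) * (Z \<omega> * ennreal (exp (?c * D \<omega>))) + ennreal (1/2) * (Z \<omega> * ennreal (exp (- ?c * D \<omega>))) \<partial>M)"
  proof (intro nn_integral_mono)
    fix \<omega>
    have "ennreal (exp (min (\<mu> * (D \<omega>)\<^sup>2) 1)) \<le> ennreal (1/2 * exp (?c * D \<omega>) + 1/2 * exp (- ?c * D \<omega>))"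
      using exp_min_le_cosh[OF \<mu>, of "D \<omega>"] by (intro ennreal_leI) simp
    also have "\<dots> = ennreal (1/2) * ennreal (exp (?c * D \<omega>)) + ennreal (1/2) * ennreal (exp (- ?c * D \<omega>))"
      using ennreal_plus[of "1/2 * exp (?c * D \<omega>)" "1/2 * exp (- ?c * D \<omega>)"]
        ennreal_mult[of "1/2" "exp (?c * D \<omega>)"] ennreal_mult[of "1/2" "exp (- ?c * D \<omega>)"] by simp
    finally have "Z \<omega> * ennreal (exp (min (\<mu> * (D \<omega>)\<^sup>2) 1)) \<le>
        Z \<omega> * (ennreal (1/2) * ennreal (exp (?c * D \<omega>)) + ennreal (1/2) * ennreal (exp (- ?c * D \<omega>)))"
      by (rule mult_left_mono) simp
    then show "Z \<omega> * ennreal (exp (min (\<mu> * (D \<omega>)\<^sup>2) 1)) \<le>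
       ennreal (1/2) * (Z \<omega> * ennreal (exp (?c * D \<omega>))) + ennreal (1/2) * (Z \<omega> * ennreal (exp (- ?c * D \<omega>)))"
      by (simp add: distrib_left mult.left_commute)
  qed
  also have "\<dots> = ennreal (1/2) * (\<integral>\<^sup>+\<omega>. Z \<omega> * ennreal (exp (?c * D \<omega>)) \<partial>M) + ennreal (1/2) * (\<integral>\<^sup>+\<omega>. Z \<omega> * ennreal (exp (- ?c * D \<omega>)) \<partial>M)"
    by (subst nn_integral_add) (auto simp: nn_integral_cmult)
  also have "\<dots> \<le> ennreal (1/2) * (ennreal (exp (2 * \<mu> * h\<^sup>2 * q)) * ?I) + ennreal (1/2) * (ennreal (exp (2 * \<mu> * h\<^sup>2 * q)) * ?I)"
    using \<mu> by (intro add_mono mult_left_mono b) auto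
  also have "\<dots> = (ennreal (1/2) + ennreal (1/2)) * (ennreal (exp (2 * \<mu> * h\<^sup>2 * q)) * ?I)"
    by (simp only: distrib_right)
  also have "ennreal (1/2) + ennreal (1/2) = 1"
    by (subst ennreal_plus[symmetric]) auto
  finally show ?thesis by simp
qed

text \<open>Each factor is integrated against a weight known at its start time; the earlier factors
  form that weight.\<close>

lemma exp_sum_le:
  fixes \<tau> :: "nat \<Rightarrow> real" and U :: "nat \<Rightarrow> 'w \<Rightarrow> real"
  assumes \<tau>: "\<And>l m. l \<le> m \<Longrightarrow> \<tau> l \<le> \<tau> m"
    and U: "\<And>l. l < n \<Longrightarrow> U l \<in> borel_measurable (G (\<tau> (Suc l)))"
    and step: "\<And>l Z. l < n \<Longrightarrow> Z \<in> borel_measurable (G (\<tau> l)) \<Longrightarrow>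
       (\<integral>\<^sup>+\<omega>. Z \<omega> * ennreal (exp (U l \<omega>)) \<partial>M) \<le> ennreal (exp \<kappa>) * (\<integral>\<^sup>+\<omega>. Z \<omega> \<partial>M)"
  shows "(\<integral>\<^sup>+\<omega>. ennreal (exp (\<Sum>l<n. U l \<omega>)) \<partial>M) \<le> ennreal (exp (real n * \<kappa>))"
  using U step
proof (induction n)
  case 0
  then show ?case by (simp add: emeasure_space_1)
next
  case (Suc n)
  have "U l \<in> borel_measurable (G (\<tau> n))" if "l < n" for l
    using measurable_G_mono[OF Suc.prems(1)[of l], of "\<tau> n"] \<tau>[of "Suc l" n] that by auto
  then have "(\<lambda>\<omega>. \<Sum>l<n. U l \<omega>) \<in> borel_measurable (G (\<tau> n))"
    by (intro borel_measurable_sum) auto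
  then have Z: "(\<lambda>\<omega>. ennreal (exp (\<Sum>l<n. U l \<omega>))) \<in> borel_measurable (G (\<tau> n))"
    by measurable
  have "(\<integral>\<^sup>+\<omega>. ennreal (exp (\<Sum>l<Suc n. U l \<omega>)) \<partial>M) = (\<integral>\<^sup>+\<omega>. ennreal (exp (\<Sum>l<n. U l \<omega>)) * ennreal (exp (U n \<omega>)) \<partial>M)"
    by (simp add: exp_add ennreal_mult)
  also have "\<dots> \<le> ennreal (exp \<kappa>) * (\<integral>\<^sup>+\<omega>. ennreal (exp (\<Sum>l<n. U l \<omega>)) \<partial>M)"
    by (rule Suc.prems(2)[OF _ Z]) simp
  also have "\<dots> \<le> ennreal (exp \<kappa>) * ennreal (exp (real n * \<kappa>))"
    using Suc.prems by (intro mult_left_mono Suc.IH) auto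
  also have "\<dots> = ennreal (exp (real (Suc n) * \<kappa>))"
    by (simp add: ennreal_mult[symmetric] exp_add[symmetric] algebra_simps)
  finally show ?case .
qed

lemma exponential_markov:
  assumes D[measurable]: "D \<in> borel_measurable M" and le: "(\<integral>\<^sup>+\<omega>. ennreal (exp (D \<omega>)) \<partial>M) \<le> ennreal (exp \<kappa>)"
  shows "measure M {\<omega>\<in>space M. D \<omega> > a} \<le> exp (\<kappa> - a)"
proof -
  have "emeasure M {\<omega>\<in>space M. D \<omega> > a} = (\<integral>\<^sup>+\<omega>. indicator {\<omega>\<in>space M. D \<omega> > a} \<omega> \<partial>M)"
    by simp
  also have "\<dots> \<le> (\<integral>\<^sup>+\<omega>. ennreal (exp (- a)) * ennreal (exp (D \<omega>)) \<partial>M)"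
  proof (intro nn_integral_mono)
    fix \<omega>
    have "1 \<le> exp (- a) * exp (D \<omega>)" if "D \<omega> > a"
      using that by (simp only: exp_add[symmetric] one_le_exp_iff)
    then show "indicator {\<omega>\<in>space M. D \<omega> > a} \<omega> \<le> ennreal (exp (- a)) * ennreal (exp (D \<omega>))"
      by (auto simp: ennreal_mult[symmetric] indicator_def)
  qed
  also have "\<dots> = ennreal (exp (- a)) * (\<integral>\<^sup>+\<omega>. ennreal (exp (D \<omega>)) \<partial>M)"
    by (rule nn_integral_cmult) auto
  also have "\<dots> \<le> ennreal (exp (- a)) * ennreal (exp \<kappa>)"
    by (intro mult_left_mono le) auto
  also have "\<dots> = ennreal (exp (\<kappa> - a))"
    by (simp add: ennreal_mult[symmetric] exp_add[symmetric])
  finally show ?thesis by (simp add: emeasure_eq_measure)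
qed

text \<open>Left-point sums use only times up to \<open>t\<close>, hence are
  \<open>F t\<close>-measurable, and they converge for every path.\<close>

lemma integral_path_measurable:
  fixes u :: "real \<Rightarrow> 'w \<Rightarrow> real"
  assumes u: "\<And>t. 0 \<le> t \<Longrightarrow> u t \<in> borel_measurable (G t)"
    and c: "\<And>\<omega>. \<omega> \<in> space M \<Longrightarrow> continuous_on {0..} (\<lambda>t. u t \<omega>)" and t: "t \<ge> 0"
  shows "(\<lambda>\<omega>. integral {0..t} (\<lambda>s. u s \<omega>)) \<in> borel_measurable (G t)"
proof (rule borel_measurable_LIMSEQ_real)
  let ?S = "\<lambda>n \<omega>. \<Sum>k<2^n. u (real k * (t / 2^n)) \<omega> * integral {real k * (t / 2^n)..real (Suc k) * (t / 2^n)} (\<lambda>_. 1)"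
  show "(\<lambda>n. ?S n \<omega>) \<longlonglongrightarrow> integral {0..t} (\<lambda>s. u s \<omega>)" if "\<omega> \<in> space (G t)" for \<omega>
  proof -
    have "continuous_on {0..t} (\<lambda>s. u s \<omega>)"
      using that by (intro continuous_on_subset[OF c]) auto
    from stieltjes_sum_tendsto[OF t this, of "\<lambda>_. 1"] show ?thesis
      by (simp only: mult_1_right continuous_on_const)
  qed
  show "?S n \<in> borel_measurable (G t)" for n
  proof (intro borel_measurable_sum borel_measurable_times measurable_G_mono[OF u])
    fix k :: nat assume "k \<in> {..<2^n}"
    then have "real k \<le> real (2^n)" by (intro of_nat_mono) auto
    then have "real k * (t / 2^n) \<le> real (2^n) * (t / 2^n)" using t by (intro mult_right_mono) auto
    then show "real k * (t / 2^n) \<le> t" by simp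
    show "0 \<le> real k * (t / 2^n)" using t by simp
  qed auto
qed

text \<open>Applied to \<open>f(z) = sqrt (1 + z\<^sup>2)\<close>, whose second derivative is bounded by 1, the discrete
  Taylor estimate replaces Ito's formula: the sum of squared increments is controlled by an
  exponential moment and the remainders vanish with the mesh.\<close>
lemma lyapunov_integral_tail:
  fixes \<xi> :: "real \<Rightarrow> 'w \<Rightarrow> real" and b :: "real \<Rightarrow> real"
  assumes T: "T > 0" and \<epsilon>: "0 < \<epsilon>" "\<epsilon> \<le> 1" and b: "continuous_on UNIV b"
    and \<xi>: "\<And>t. 0 \<le> t \<Longrightarrow> \<xi> t \<in> borel_measurable (G t)"
    and \<xi>c: "\<And>\<omega>. \<omega> \<in> space M \<Longrightarrow> continuous_on {0..} (\<lambda>t. \<xi> t \<omega>)"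
    and \<xi>0: "AE \<omega> in M. \<xi> 0 \<omega> = z0"
    and C: "C > 0"
    and sg: "\<And>n k. subgaussian (real k * (T / 2^n)) (T / 2^n) (sqrt (C / \<epsilon>))
      (\<lambda>\<omega>. \<xi> (real (Suc k) * (T / 2^n)) \<omega> - \<xi> (real k * (T / 2^n)) \<omega>
         - (integral {0..real (Suc k) * (T / 2^n)} (\<lambda>s. b (\<xi> s \<omega>) / \<epsilon>) - integral {0..real k * (T / 2^n)} (\<lambda>s. b (\<xi> s \<omega>) / \<epsilon>)))"
    and a1: "a1 \<ge> 0" and \<mu>: "\<mu> > 0"
  defines "\<psi> \<equiv> \<lambda>z. - (z / sqrt (1 + z\<^sup>2)) * b z"
  shows "{\<omega>\<in>space M. integral {0..T} (\<lambda>t. \<psi> (\<xi> t \<omega>)) > sqrt (1 + z0\<^sup>2) + a1 + a2 + 1} \<in> sets M" (is "?B \<in> _")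
    and "measure M {\<omega>\<in>space M. integral {0..T} (\<lambda>t. \<psi> (\<xi> t \<omega>)) > sqrt (1 + z0\<^sup>2) + a1 + a2 + 1}
      \<le> exp (- a1\<^sup>2 / (2 * \<epsilon> * C * T)) + exp (2 * \<mu> * C * T / \<epsilon> - \<mu> * a2 / \<epsilon>)"
proof -
  define g where "g z = z / sqrt (1 + z\<^sup>2)" for z :: real
  have s1: "sqrt (1 + z\<^sup>2) > 0" for z :: real by (simp add: add_pos_nonneg)
  then have s0: "sqrt (1 + z\<^sup>2) \<noteq> 0" for z :: real by (metis less_irrefl)
  have g_cont: "continuous_on UNIV g" unfolding g_def using s0 by (intro continuous_intros) auto
  have g1: "\<bar>g z\<bar> \<le> 1" for z
  proof -
    have "\<bar>z\<bar> \<le> sqrt (1 + z\<^sup>2)" by (rule real_le_rsqrt) simp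
    then show ?thesis using s1[of z] by (simp add: g_def abs_divide)
  qed
  have \<psi>_eq: "\<psi> z = - (g z * b z)" for z by (simp add: \<psi>_def g_def)
  have \<psi>_cont: "continuous_on UNIV \<psi>" unfolding \<psi>_eq[abs_def] by (intro continuous_intros g_cont b)
  have path: "continuous_on {0..t} (\<lambda>s. f (\<xi> s \<omega>))" if "\<omega> \<in> space M" "continuous_on UNIV f" for f :: "real \<Rightarrow> real" and \<omega> t
    using \<xi>c[OF that(1)] by (intro continuous_on_compose2[OF that(2)]) (auto elim: continuous_on_subset)
  have path': "continuous_on {0..} (\<lambda>s. f (\<xi> s \<omega>))" if "\<omega> \<in> space M" "continuous_on UNIV f" for f :: "real \<Rightarrow> real" and \<omega>
    using \<xi>c[OF that(1)] by (intro continuous_on_compose2[OF that(2)]) auto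
  have comp: "(\<lambda>\<omega>. f (\<xi> t \<omega>)) \<in> borel_measurable (G t)" if "0 \<le> t" "continuous_on UNIV f" for f :: "real \<Rightarrow> real" and t
    using measurable_compose[OF \<xi>[OF that(1)] borel_measurable_continuous_onI[OF that(2)]] .
  have b\<epsilon>: "continuous_on UNIV (\<lambda>z. b z / \<epsilon>)" using \<epsilon> by (intro continuous_intros b) auto
  define \<Psi> where "\<Psi> \<omega> = integral {0..T} (\<lambda>t. \<psi> (\<xi> t \<omega>))" for \<omega>
  have \<Psi>[measurable]: "\<Psi> \<in> borel_measurable M"
    unfolding \<Psi>_def using T by (intro measurable_G[OF integral_path_measurable] comp path' \<psi>_cont) auto
  show "?B \<in> sets M" using \<Psi> unfolding \<Psi>_def by measurable
  define t where "t n k = real k * (T / 2^n)" for n k :: nat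
  have t: "0 \<le> t n k" "l \<le> k \<Longrightarrow> t n l \<le> t n k" "t n 0 = 0" "t n (2^n) = T" for n k l :: nat
    using T by (auto simp: t_def divide_right_mono mult_right_mono)
  have tS: "t n (Suc k) - t n k = T / 2^n" for n k by (simp add: t_def algebra_simps add_divide_distrib)
  \<comment> \<open>The martingale part of the fast component with its starting value; by
    \<open>sg\<close> its grid increments are sub-Gaussian with variance rate
    \<open>C / \<epsilon>\<close>.\<close>
  define N where "N s \<omega> = \<xi> s \<omega> - integral {0..s} (\<lambda>s. b (\<xi> s \<omega>) / \<epsilon>)" for s \<omega>
  have N_G: "N s \<in> borel_measurable (G s)" if "0 \<le> s" for s
    unfolding N_def using that by (intro borel_measurable_diff \<xi> integral_path_measurable comp path' b\<epsilon>) auto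
  define D where "D n k \<omega> = N (t n (Suc k)) \<omega> - N (t n k) \<omega>" for n k \<omega>
  have D_G: "D n k \<in> borel_measurable (G (t n (Suc k)))" for n k
    unfolding D_def using t by (intro borel_measurable_diff measurable_G_mono[OF N_G]) auto
  have D[measurable]: "D n k \<in> borel_measurable M" for n k using D_G by (rule measurable_G)
  have Dsg: "subgaussian (t n k) (T / 2^n) (sqrt (C / \<epsilon>)) (D n k)" for n k
  proof -
    have "D n k = (\<lambda>\<omega>. \<xi> (real (Suc k) * (T / 2^n)) \<omega> - \<xi> (real k * (T / 2^n)) \<omega>
         - (integral {0..real (Suc k) * (T / 2^n)} (\<lambda>s. b (\<xi> s \<omega>) / \<epsilon>) - integral {0..real k * (T / 2^n)} (\<lambda>s. b (\<xi> s \<omega>) / \<epsilon>)))"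
      unfolding D_def N_def t_def by (rule ext) simp
    then show ?thesis using sg[of k n] by (simp only: t_def)
  qed
  \<comment> \<open>Discrete stochastic integral of \<open>f'(\<xi>)\<close> against
    \<open>N\<close>. As \<open>f'\<close> is at most 1 in absolute value, the sub-Gaussian variance
    is \<open>C * T / \<epsilon>\<close> for every mesh.\<close>
  define P where "P n \<omega> = (\<Sum>k<2^n. g (\<xi> (t n k) \<omega>) * D n k \<omega>)" for n \<omega>
  have Psg: "subgaussian (t n 0) (\<Sum>k<2^n::nat. T / 2^n) (1 * sqrt (C / \<epsilon>)) (P n)" for n
    unfolding P_def using t T
    by (intro subgaussian_sum[where \<tau>="t n"] Dsg D_G comp g_cont g1) auto
  have [measurable]: "(\<lambda>\<omega>. g (\<xi> (t n k) \<omega>)) \<in> borel_measurable M" for n k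
    by (intro measurable_G[OF comp] t g_cont)
  have P[measurable]: "P n \<in> borel_measurable M" for n unfolding P_def by measurable
  have Ptail: "measure M {\<omega>\<in>space M. P n \<omega> > a1 / \<epsilon>} \<le> exp (- a1\<^sup>2 / (2 * \<epsilon> * C * T))" for n
  proof -
    have "measure M {\<omega>\<in>space M. P n \<omega> > a1 / \<epsilon>} \<le> exp (- (a1 / \<epsilon>)\<^sup>2 / (2 * (C / \<epsilon> * T)))"
      using a1 \<epsilon> C T by (intro subgaussian_tail[OF Psg]) auto
    also have "- (a1 / \<epsilon>)\<^sup>2 / (2 * (C / \<epsilon> * T)) = - a1\<^sup>2 / (2 * \<epsilon> * C * T)"
      using \<epsilon> C T by (simp add: field_simps power2_eq_square)
    finally show ?thesis .
  qed
  \<comment> \<open>Quadratic variation with each square truncated, so that the exponential moment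
    bound holds for every \<mu>.\<close>
  define S where "S n \<omega> = (\<Sum>k<2^n. min (\<mu> * (D n k \<omega>)\<^sup>2) 1)" for n \<omega>
  have S[measurable]: "S n \<in> borel_measurable M" for n unfolding S_def by measurable
  have Stail: "measure M {\<omega>\<in>space M. S n \<omega> > \<mu> * a2 / \<epsilon>} \<le> exp (2 * \<mu> * C * T / \<epsilon> - \<mu> * a2 / \<epsilon>)" for n
  proof (rule exponential_markov)
    have "(\<integral>\<^sup>+\<omega>. ennreal (exp (S n \<omega>)) \<partial>M) \<le> ennreal (exp (real (2^n) * (2 * \<mu> * (sqrt (C / \<epsilon>))\<^sup>2 * (T / 2^n))))"
      unfolding S_def
    proof (rule exp_sum_le[where \<tau>="t n"])
      show "(\<lambda>\<omega>. min (\<mu> * (D n k \<omega>)\<^sup>2) 1) \<in> borel_measurable (G (t n (Suc k)))" for k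
        using D_G[of n k] by measurable
      show "(\<integral>\<^sup>+\<omega>. Z \<omega> * ennreal (exp (min (\<mu> * (D n k \<omega>)\<^sup>2) 1)) \<partial>M)
         \<le> ennreal (exp (2 * \<mu> * (sqrt (C / \<epsilon>))\<^sup>2 * (T / 2^n))) * (\<integral>\<^sup>+\<omega>. Z \<omega> \<partial>M)"
        if "Z \<in> borel_measurable (G (t n k))" for Z k
        using \<mu> by (intro subgaussian_exp_min_square[OF Dsg D _ that]) auto
    qed (use t in auto)
    also have "real (2^n) * (2 * \<mu> * (sqrt (C / \<epsilon>))\<^sup>2 * (T / 2^n)) = 2 * \<mu> * C * T / \<epsilon>"
      using C \<epsilon> by simp
    finally show "(\<integral>\<^sup>+\<omega>. ennreal (exp (S n \<omega>)) \<partial>M) \<le> ennreal (exp (2 * \<mu> * C * T / \<epsilon>))" .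
  qed simp
  \<comment> \<open>The truncation in \<open>S n\<close> is active only here, and by path continuity
    this event disappears as the mesh shrinks.\<close>
  define E where "E n = {\<omega>\<in>space M. \<exists>k<2^n. \<mu> * (D n k \<omega>)\<^sup>2 > 1}" for n
  have E[measurable]: "E n \<in> sets M" for n unfolding E_def by measurable
  have Elim: "(\<lambda>n. measure M (E n)) \<longlonglongrightarrow> 0"
  proof (rule measure_tendsto_0_eventually[OF E])
    fix \<omega> assume om: "\<omega> \<in> space M"
    have "continuous_on {0..T} (\<lambda>s. N s \<omega>)"
      unfolding N_def using path[OF om b\<epsilon>, of T] path[OF om continuous_on_id, of T]
      by (intro continuous_on_diff indefinite_integral_continuous_1 integrable_continuous_real) auto
    then have "uniformly_continuous_on {0..T} (\<lambda>s. N s \<omega>)"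
      by (intro compact_uniformly_continuous) auto
    moreover have "1 / sqrt \<mu> > 0" using \<mu> by simp
    ultimately obtain \<rho> where \<rho>: "\<rho> > 0" "\<And>s u. s \<in> {0..T} \<Longrightarrow> u \<in> {0..T} \<Longrightarrow> \<bar>s - u\<bar> < \<rho> \<Longrightarrow> \<bar>N s \<omega> - N u \<omega>\<bar> < 1 / sqrt \<mu>"
      unfolding uniformly_continuous_on_def dist_real_def by (metis abs_minus_commute)
    have "(\<lambda>n. T / 2^n) \<longlonglongrightarrow> 0" by (rule LIMSEQ_divide_realpow_zero) auto
    then have "\<forall>\<^sub>F n in sequentially. T / 2^n < \<rho>" using \<rho>(1) by (intro order_tendstoD) auto
    then show "\<forall>\<^sub>F n in sequentially. \<omega> \<notin> E n"
    proof eventually_elim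
      case (elim n)
      have "\<mu> * (D n k \<omega>)\<^sup>2 \<le> 1" if k: "k < 2^n" for k
      proof -
        have "t n (Suc k) \<le> T" "t n k \<le> T" using t(2)[of "Suc k" "2^n" n] t(2)[of k "2^n" n] t(4)[of n] k by auto
        then have "\<bar>D n k \<omega>\<bar> < 1 / sqrt \<mu>"
          unfolding D_def using tS[of n k] elim T by (intro \<rho>(2)) (auto simp: t(1))
        then have "\<bar>D n k \<omega>\<bar>\<^sup>2 \<le> (1 / sqrt \<mu>)\<^sup>2" by (intro power_mono) auto
        then have "(D n k \<omega>)\<^sup>2 \<le> 1 / \<mu>" using \<mu> by (simp add: power_divide)
        then show ?thesis using \<mu> by (simp add: field_simps)
      qed
      then have "\<not> (\<exists>k<2^n. \<mu> * (D n k \<omega>)\<^sup>2 > 1)" by (meson not_le)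
      then show ?case by (simp add: E_def)
    qed
  qed
  define d where "d n k \<omega> = integral {t n k..t n (Suc k)} (\<lambda>s. b (\<xi> s \<omega>))" for n k \<omega>
  have d_eq: "d n k \<omega> = \<epsilon> * (integral {0..t n (Suc k)} (\<lambda>s. b (\<xi> s \<omega>) / \<epsilon>) - integral {0..t n k} (\<lambda>s. b (\<xi> s \<omega>) / \<epsilon>))"
    if om: "\<omega> \<in> space M" for n k \<omega>
  proof -
    have "integral {0..t n k} (\<lambda>s. b (\<xi> s \<omega>)) + d n k \<omega> = integral {0..t n (Suc k)} (\<lambda>s. b (\<xi> s \<omega>))"
      unfolding d_def using t by (intro Henstock_Kurzweil_Integration.integral_combine integrable_continuous_real path om b) auto
    then have "d n k \<omega> = integral {0..t n (Suc k)} (\<lambda>s. b (\<xi> s \<omega>)) - integral {0..t n k} (\<lambda>s. b (\<xi> s \<omega>))"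
      by linarith
    then show ?thesis using \<epsilon> by (simp add: right_diff_distrib)
  qed
  \<comment> \<open>Collects what is purely pathwise: the error of the Riemann sum for
    \<open>- \<Psi> \<omega>\<close> and the squared drift increments. For fixed \<epsilon> it tends
    to 0 on every path.\<close>
  define Rm where "Rm n \<omega> = (\<Sum>k<2^n. g (\<xi> (t n k) \<omega>) * d n k \<omega>) + \<Psi> \<omega> + (\<Sum>k<2^n. (d n k \<omega>)\<^sup>2) / \<epsilon>" for n \<omega>
  have d_M[measurable]: "d n k \<in> borel_measurable M" for n k
  proof -
    have "(\<lambda>\<omega>. \<epsilon> * (integral {0..t n (Suc k)} (\<lambda>s. b (\<xi> s \<omega>) / \<epsilon>) - integral {0..t n k} (\<lambda>s. b (\<xi> s \<omega>) / \<epsilon>))) \<in> borel_measurable M"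
      using t by (intro borel_measurable_times borel_measurable_diff measurable_G[OF integral_path_measurable] comp path' b\<epsilon>) auto
    then show ?thesis by (subst measurable_cong[OF d_eq])
  qed
  have Rm[measurable]: "Rm n \<in> borel_measurable M" for n unfolding Rm_def by measurable
  have Flim: "(\<lambda>n. measure M {\<omega>\<in>space M. Rm n \<omega> > 1}) \<longlonglongrightarrow> 0"
  proof (rule measure_tendsto_0_eventually)
    fix \<omega> assume om: "\<omega> \<in> space M"
    have 1: "(\<lambda>n. \<Sum>k<2^n. g (\<xi> (t n k) \<omega>) * d n k \<omega>) \<longlonglongrightarrow> integral {0..T} (\<lambda>s. g (\<xi> s \<omega>) * b (\<xi> s \<omega>))"
      using stieltjes_sum_tendsto[of T, OF _ path[OF om g_cont, of T] path[OF om b, of T]] T by (simp add: t_def d_def)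
    have "integral {0..T} (\<lambda>s. g (\<xi> s \<omega>) * b (\<xi> s \<omega>)) = - \<Psi> \<omega>"
      by (simp add: \<Psi>_def \<psi>_eq)
    note 1 = 1[unfolded this]
    have "bounded ((\<lambda>s. b (\<xi> s \<omega>)) ` {0..T})" by (intro compact_imp_bounded compact_continuous_image path om b) simp
    then obtain K where K: "K > 0" "\<And>s. s \<in> {0..T} \<Longrightarrow> \<bar>b (\<xi> s \<omega>)\<bar> \<le> K"
      unfolding bounded_pos by auto
    have 2: "(\<Sum>k<2^n. (d n k \<omega>)\<^sup>2) \<le> K\<^sup>2 * T * (T / 2^n)" for n
    proof -
      have "(\<Sum>k<2^n. (d n k \<omega>)\<^sup>2) \<le> (\<Sum>k<2^n::nat. (K * (T / 2^n))\<^sup>2)"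
      proof (rule sum_mono)
        fix k :: nat assume "k \<in> {..<2^n}"
        then have tk: "t n (Suc k) \<le> T" using t(2)[of "Suc k" "2^n" n] t(4)[of n] by auto
        have bd: "norm (b (\<xi> s \<omega>)) \<le> K" if "s \<in> {t n k..t n (Suc k)}" for s
          unfolding real_norm_def by (intro K(2)) (use that t(1)[of n k] tk in auto)
        have "norm (d n k \<omega>) \<le> K * (t n (Suc k) - t n k)"
          unfolding d_def using t(1)[of n k] t(2)[of k "Suc k" n] tk
          by (intro integral_bound bd continuous_on_subset[OF path[OF om b, of T]]) auto
        then have "\<bar>d n k \<omega>\<bar>\<^sup>2 \<le> (K * (T / 2^n))\<^sup>2" using tS[of n k] by (intro power_mono) auto
        then show "(d n k \<omega>)\<^sup>2 \<le> (K * (T / 2^n))\<^sup>2" by simp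
      qed
      also have "\<dots> = K\<^sup>2 * T * (T / 2^n)" by (simp add: power2_eq_square)
      finally show ?thesis .
    qed
    have "(\<lambda>n. K\<^sup>2 * T * (T / 2^n)) \<longlonglongrightarrow> K\<^sup>2 * T * 0"
      by (intro tendsto_intros LIMSEQ_divide_realpow_zero) auto
    then have "(\<lambda>n. \<Sum>k<2^n. (d n k \<omega>)\<^sup>2) \<longlonglongrightarrow> 0"
      by (intro tendsto_sandwich[OF _ always_eventually[OF allI[OF 2]] tendsto_const]) (auto intro!: always_eventually sum_nonneg)
    then have "(\<lambda>n. Rm n \<omega>) \<longlonglongrightarrow> - \<Psi> \<omega> + \<Psi> \<omega> + 0 / \<epsilon>"
      unfolding Rm_def using \<epsilon> 1 by (intro tendsto_intros) auto
    then have "(\<lambda>n. Rm n \<omega>) \<longlonglongrightarrow> 0" by simp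
    then have "\<forall>\<^sub>F n in sequentially. Rm n \<omega> < 1" by (rule order_tendstoD) simp
    then show "\<forall>\<^sub>F n in sequentially. \<omega> \<notin> {\<omega>\<in>space M. Rm n \<omega> > 1}"
      by eventually_elim auto
  qed measurable
  \<comment> \<open>Deterministic part: outside four exceptional events at one mesh size, the Taylor
    estimates are summed over the grid and multiplied by \<epsilon>. The final 1 of the threshold is
    the allowance for \<open>Rm n\<close>.\<close>
  have main: "\<Psi> \<omega> \<le> sqrt (1 + z0\<^sup>2) + a1 + a2 + 1"
    if om: "\<omega> \<in> space M" and 0: "\<xi> 0 \<omega> = z0" and p: "P n \<omega> \<le> a1 / \<epsilon>" and s: "S n \<omega> \<le> \<mu> * a2 / \<epsilon>"
      and e: "\<omega> \<notin> E n" and r: "Rm n \<omega> \<le> 1" for \<omega> n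
  proof -
    let ?x = "\<lambda>k. \<xi> (t n k) \<omega>" and ?f = "\<lambda>z::real. sqrt (1 + z\<^sup>2)"
    have x_diff: "?x (Suc k) - ?x k = D n k \<omega> + d n k \<omega> / \<epsilon>" for k
      using d_eq[OF om, of n k] \<epsilon> by (simp add: D_def N_def)
    have step: "?f (?x (Suc k)) - ?f (?x k) \<le> g (?x k) * D n k \<omega> + g (?x k) * d n k \<omega> / \<epsilon> + (D n k \<omega>)\<^sup>2 + (d n k \<omega> / \<epsilon>)\<^sup>2" for k
    proof -
      have "?f (?x (Suc k)) \<le> ?f (?x k) + g (?x k) * (?x (Suc k) - ?x k) + (?x (Suc k) - ?x k)\<^sup>2 / 2"
        unfolding g_def by (rule sqrt_one_plus_square_le)
      moreover have "(?x (Suc k) - ?x k)\<^sup>2 / 2 \<le> (D n k \<omega>)\<^sup>2 + (d n k \<omega> / \<epsilon>)\<^sup>2"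
        unfolding x_diff using sum_squares_bound[of "D n k \<omega>" "d n k \<omega> / \<epsilon>"] by (simp add: power2_sum)
      moreover have "g (?x k) * (?x (Suc k) - ?x k) = g (?x k) * D n k \<omega> + g (?x k) * d n k \<omega> / \<epsilon>"
        unfolding x_diff by (simp add: ring_distribs)
      ultimately show ?thesis by linarith
    qed
    have "?f (?x (2^n)) - ?f (?x 0) = (\<Sum>k<2^n. ?f (?x (Suc k)) - ?f (?x k))"
      by (rule sum_lessThan_telescope[symmetric])
    also have "\<dots> \<le> (\<Sum>k<2^n. g (?x k) * D n k \<omega> + g (?x k) * d n k \<omega> / \<epsilon> + (D n k \<omega>)\<^sup>2 + (d n k \<omega> / \<epsilon>)\<^sup>2)"
      by (intro sum_mono step)
    also have "\<dots> = P n \<omega> + (\<Sum>k<2^n. g (?x k) * d n k \<omega>) / \<epsilon> + (\<Sum>k<2^n. (D n k \<omega>)\<^sup>2) + (\<Sum>k<2^n. (d n k \<omega>)\<^sup>2) / \<epsilon>\<^sup>2"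
      by (simp add: sum.distrib P_def sum_divide_distrib power_divide)
    finally have fin: "?f (?x (2^n)) - ?f (?x 0) \<le> P n \<omega> + (\<Sum>k<2^n. g (?x k) * d n k \<omega>) / \<epsilon> + (\<Sum>k<2^n. (D n k \<omega>)\<^sup>2) + (\<Sum>k<2^n. (d n k \<omega>)\<^sup>2) / \<epsilon>\<^sup>2" .
    have "?f (?x 0) = ?f z0" by (simp add: 0 t(3))
    \<comment> \<open>The value of \<open>f\<close> at the final time is positive and is
      dropped.\<close>
    with fin s1[of "?x (2^n)"] have "0 \<le> ?f z0 + P n \<omega> + (\<Sum>k<2^n. g (?x k) * d n k \<omega>) / \<epsilon> + (\<Sum>k<2^n. (D n k \<omega>)\<^sup>2) + (\<Sum>k<2^n. (d n k \<omega>)\<^sup>2) / \<epsilon>\<^sup>2"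
      by linarith
    then have "0 \<le> \<epsilon> * (?f z0 + P n \<omega> + (\<Sum>k<2^n. g (?x k) * d n k \<omega>) / \<epsilon> + (\<Sum>k<2^n. (D n k \<omega>)\<^sup>2) + (\<Sum>k<2^n. (d n k \<omega>)\<^sup>2) / \<epsilon>\<^sup>2)"
      using \<epsilon> by simp
    also have "\<dots> = \<epsilon> * ?f z0 + \<epsilon> * P n \<omega> + (\<Sum>k<2^n. g (?x k) * d n k \<omega>) + \<epsilon> * (\<Sum>k<2^n. (D n k \<omega>)\<^sup>2) + (\<Sum>k<2^n. (d n k \<omega>)\<^sup>2) / \<epsilon>"
      using \<epsilon> by (simp add: ring_distribs power2_eq_square)
    also have "\<dots> = \<epsilon> * ?f z0 + \<epsilon> * P n \<omega> + \<epsilon> * (\<Sum>k<2^n. (D n k \<omega>)\<^sup>2) + (Rm n \<omega> - \<Psi> \<omega>)"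
      by (simp add: Rm_def)
    finally have "\<Psi> \<omega> \<le> \<epsilon> * ?f z0 + \<epsilon> * P n \<omega> + \<epsilon> * (\<Sum>k<2^n. (D n k \<omega>)\<^sup>2) + Rm n \<omega>" by simp
    moreover have "\<epsilon> * ?f z0 \<le> ?f z0" using \<epsilon> s1[of z0] by (intro mult_left_le_one_le) auto
    moreover have "\<epsilon> * P n \<omega> \<le> a1" using p \<epsilon> by (simp add: field_simps)
    moreover have "\<epsilon> * (\<Sum>k<2^n. (D n k \<omega>)\<^sup>2) \<le> a2"
    proof -
      have "\<mu> * (D n k \<omega>)\<^sup>2 \<le> 1" if "k < 2^n" for k
        using e om that by (auto simp: E_def not_less dest!: spec[of _ k])
      then have "S n \<omega> = \<mu> * (\<Sum>k<2^n. (D n k \<omega>)\<^sup>2)"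
        unfolding S_def sum_distrib_left by (intro sum.cong) (auto simp: min_def)
      then have "\<mu> * (\<Sum>k<2^n. (D n k \<omega>)\<^sup>2) \<le> \<mu> * (a2 / \<epsilon>)" using s by simp
      then have "(\<Sum>k<2^n. (D n k \<omega>)\<^sup>2) \<le> a2 / \<epsilon>" using \<mu> by (simp only: mult_le_cancel_left_pos)
      then show ?thesis using \<epsilon> by (simp add: field_simps)
    qed
    ultimately show ?thesis using r by linarith
  qed
  have bound: "measure M {\<omega>\<in>space M. \<Psi> \<omega> > sqrt (1 + z0\<^sup>2) + a1 + a2 + 1}
     \<le> exp (- a1\<^sup>2 / (2 * \<epsilon> * C * T)) + exp (2 * \<mu> * C * T / \<epsilon> - \<mu> * a2 / \<epsilon>) + measure M (E n) + measure M {\<omega>\<in>space M. Rm n \<omega> > 1}" for n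
  proof -
    let ?P = "{\<omega>\<in>space M. P n \<omega> > a1 / \<epsilon>}" and ?S = "{\<omega>\<in>space M. S n \<omega> > \<mu> * a2 / \<epsilon>}" and ?R = "{\<omega>\<in>space M. Rm n \<omega> > 1}"
    have "AE \<omega> in M. \<omega> \<in> {\<omega>\<in>space M. \<Psi> \<omega> > sqrt (1 + z0\<^sup>2) + a1 + a2 + 1} \<longrightarrow> \<omega> \<in> ?P \<union> ?S \<union> E n \<union> ?R"
      using \<xi>0
    proof eventually_elim
      case (elim \<omega>)
      show ?case using main[OF _ elim, of n] by (fastforce simp: not_less[symmetric])
    qed
    then have "measure M {\<omega>\<in>space M. \<Psi> \<omega> > sqrt (1 + z0\<^sup>2) + a1 + a2 + 1} \<le> measure M (?P \<union> ?S \<union> E n \<union> ?R)"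
      by (intro finite_measure_mono_AE) auto
    also have "\<dots> \<le> measure M (?P \<union> ?S \<union> E n) + measure M ?R" by (intro measure_Un_le) auto
    also have "\<dots> \<le> measure M (?P \<union> ?S) + measure M (E n) + measure M ?R" by (intro add_right_mono measure_Un_le) auto
    also have "\<dots> \<le> measure M ?P + measure M ?S + measure M (E n) + measure M ?R" by (intro add_right_mono measure_Un_le) auto
    also have "\<dots> \<le> exp (- a1\<^sup>2 / (2 * \<epsilon> * C * T)) + exp (2 * \<mu> * C * T / \<epsilon> - \<mu> * a2 / \<epsilon>) + measure M (E n) + measure M ?R"
      by (intro add_right_mono add_mono Ptail Stail)
    finally show ?thesis .
  qed
  \<comment> \<open>The left side of \<open>bound\<close> is free of \<open>n\<close>: refining the
    mesh removes the two pathwise events, and the two exponential terms remain.\<close>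
  have "(\<lambda>n. exp (- a1\<^sup>2 / (2 * \<epsilon> * C * T)) + exp (2 * \<mu> * C * T / \<epsilon> - \<mu> * a2 / \<epsilon>) + measure M (E n) + measure M {\<omega>\<in>space M. Rm n \<omega> > 1})
     \<longlonglongrightarrow> exp (- a1\<^sup>2 / (2 * \<epsilon> * C * T)) + exp (2 * \<mu> * C * T / \<epsilon> - \<mu> * a2 / \<epsilon>) + 0 + 0"
    by (intro tendsto_add tendsto_const Elim Flim)
  from LIMSEQ_le_const[OF this] bound
  show "measure M {\<omega>\<in>space M. integral {0..T} (\<lambda>t. \<psi> (\<xi> t \<omega>)) > sqrt (1 + z0\<^sup>2) + a1 + a2 + 1}
      \<le> exp (- a1\<^sup>2 / (2 * \<epsilon> * C * T)) + exp (2 * \<mu> * C * T / \<epsilon> - \<mu> * a2 / \<epsilon>)"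
    unfolding \<Psi>_def by fastforce
qed

end

section \<open>The slow component\<close>

text \<open>All Riemann sums over the empty interval vanish. With the equation at time 0 this yields
  the initial values, which the definition of a solution encodes in this way.\<close>

lemma (in prob_space) ito_integral_0:
  assumes "is_ito_integral M H W 0 I"
  shows "AE \<omega> in M. I \<omega> = 0"
proof -
  have [measurable]: "I \<in> borel_measurable M" using assms by (simp add: is_ito_integral_def)
  have "measure M {\<omega>\<in>space M. \<bar>I \<omega>\<bar> > \<delta>} = 0" if "\<delta> > 0" for \<delta>
    using assms that by (simp add: is_ito_integral_def ito_sum_def LIMSEQ_const_iff)
  then have "AE \<omega> in M. \<omega> \<notin> {\<omega>\<in>space M. \<bar>I \<omega>\<bar> > \<delta>}" if "\<delta> > 0" for \<delta>
    using that by (subst prob_eq_0[symmetric]) auto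
  then have "AE \<omega> in M. \<forall>n::nat. \<omega> \<notin> {\<omega>\<in>space M. \<bar>I \<omega>\<bar> > 1 / real (Suc n)}"
    unfolding AE_all_countable by simp
  then show ?thesis
  proof (rule AE_mp, intro AE_I2 impI)
    fix \<omega> assume om: "\<omega> \<in> space M" and n: "\<forall>n::nat. \<omega> \<notin> {\<omega>\<in>space M. \<bar>I \<omega>\<bar> > 1 / real (Suc n)}"
    show "I \<omega> = 0"
    proof (rule ccontr)
      assume "I \<omega> \<noteq> 0"
      then obtain n where "inverse (real (Suc n)) < \<bar>I \<omega>\<bar>" using reals_Archimedean[of "\<bar>I \<omega>\<bar>"] by auto
      then show False using n om by (auto simp: inverse_eq_divide)
    qed
  qed
qed

text \<open>Expresses a bound along a whole path through countably many times, so that the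
  corresponding event is measurable.\<close>

lemma bounded_on_rationals_imp_bounded:
  fixes f :: "real \<Rightarrow> real"
  assumes f: "continuous_on {0..v} f" and v: "v > 0" and t: "0 \<le> t" "t \<le> v"
    and q: "\<And>q::rat. 0 \<le> real_of_rat q \<Longrightarrow> real_of_rat q \<le> v \<Longrightarrow> \<bar>f (real_of_rat q)\<bar> \<le> R"
  shows "\<bar>f t\<bar> \<le> R"
proof (rule ccontr)
  assume "\<not> ?thesis"
  then have e: "\<bar>f t\<bar> - R > 0" by simp
  from f have "\<forall>e>0. \<exists>d>0. \<forall>s\<in>{0..v}. dist s t < d \<longrightarrow> dist (f s) (f t) < e"
    using t by (auto simp: continuous_on_iff)
  then obtain d where d: "d > 0" "\<And>s. s \<in> {0..v} \<Longrightarrow> \<bar>s - t\<bar> < d \<Longrightarrow> \<bar>f s - f t\<bar> < \<bar>f t\<bar> - R"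
    using e unfolding dist_real_def by blast
  have "max 0 (t - d) < min v (t + d)" using v t d(1) by auto
  then obtain q where "max 0 (t - d) < real_of_rat q" "real_of_rat q < min v (t + d)"
    using of_rat_dense by blast
  then have "\<bar>f (real_of_rat q) - f t\<bar> < \<bar>f t\<bar> - R" "\<bar>f (real_of_rat q)\<bar> \<le> R"
    by (auto intro!: d(2) q)
  then show False by linarith
qed

text \<open>Rectangles with one side \<open>UNIV\<close> in the joint law of the increments give the
  independence of a single Gaussian increment from \<open>F s\<close>.\<close>

lemma brownian_of_wiener_pair:
  assumes M: "filtration_space M F" and w: "indep_wiener_pair M F W V"
  shows "brownian M F W" and "brownian M F V"
proof -
  interpret filtration_space M F by (rule M)
  have ad: "adapted_proc M F W" "adapted_proc M F V"
    and inc: "\<And>s t E S. 0 \<le> s \<Longrightarrow> s < t \<Longrightarrow> E \<in> F s \<Longrightarrow> S \<in> sets (borel :: (real \<times> real) measure) \<Longrightarrow>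
       measure M (E \<inter> {\<omega>\<in>space M. (W t \<omega> - W s \<omega>, V t \<omega> - V s \<omega>) \<in> S}) = measure M E * measure (gauss2 (t - s)) S"
    using w unfolding indep_wiener_pair_def by blast+
  have sg: "subgaussian s (t - s) 1 (\<lambda>\<omega>. W t \<omega> - W s \<omega>) \<and> subgaussian s (t - s) 1 (\<lambda>\<omega>. V t \<omega> - V s \<omega>)"
    if st: "0 \<le> s" "s < t" for s t
  proof -
    let ?N = "density lborel (normal_density 0 (sqrt (t - s)))"
    interpret N: prob_space ?N using st by (intro prob_space_normal_density) simp
    have [measurable]: "W t \<in> borel_measurable M" "W s \<in> borel_measurable M" "V t \<in> borel_measurable M" "V s \<in> borel_measurable M"
      using st by (auto intro!: measurable_G[OF adapted_proc_measurable] ad)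
    have gm: "measure (gauss2 (t - s)) (S1 \<times> S2) = measure ?N S1 * measure ?N S2"
      if "S1 \<in> sets borel" "S2 \<in> sets borel" for S1 S2
    proof -
      have "emeasure (gauss2 (t - s)) (S1 \<times> S2) = emeasure ?N S1 * emeasure ?N S2"
        unfolding gauss2_def using that by (intro N.emeasure_pair_measure_Times) auto
      then show ?thesis by (simp add: measure_def enn2real_mult)
    qed
    have U: "measure ?N UNIV = 1" using N.prob_space by simp
    have sb: "S1 \<times> S2 \<in> sets (borel :: (real \<times> real) measure)" if "S1 \<in> sets borel" "S2 \<in> sets borel" for S1 S2 :: "real set"
      using that unfolding borel_prod[symmetric] by auto
    have "measure M (E \<inter> {\<omega>\<in>space M. W t \<omega> - W s \<omega> \<in> S}) = measure M E * measure ?N S"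
      if "E \<in> F s" "S \<in> sets borel" for E S
      using inc[OF st that(1) sb[OF that(2), of UNIV]] gm[OF that(2), of UNIV] U by simp
    moreover have "measure M (E \<inter> {\<omega>\<in>space M. V t \<omega> - V s \<omega> \<in> S}) = measure M E * measure ?N S"
      if "E \<in> F s" "S \<in> sets borel" for E S
      using inc[OF st that(1) sb[OF _ that(2), of UNIV]] gm[OF _ that(2), of UNIV] U by simp
    ultimately show ?thesis
      using st by (auto intro!: gaussian_increment_subgaussian)
  qed
  show "brownian M F W" "brownian M F V"
    using sg ad by unfold_locales auto
qed

context filtration_space
begin

text \<open>The thresholds scale with the level \<open>R k\<close> exactly like the bound
  \<open>2 * C * R k\<close> on the integrand, so \<open>R k\<close> cancels and the failure
  probability is the same at each level. Since \<open>((3/4)^m)\<^sup>2 * 2^m = (9/8)^m\<close>, an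
  increment of scale \<open>m\<close> fails with probability at most
  \<open>2 * exp (- (\<kappa> / \<epsilon>) * (9/8)^m)\<close>. The condition
  \<open>\<kappa> \<ge> 16\<close> makes the totals over the \<open>2^m\<close> increments of each
  scale decay geometrically in \<open>m\<close>.\<close>

lemma slow_increments_tail:
  fixes X \<xi> :: "real \<Rightarrow> 'w \<Rightarrow> real" and A B :: "real \<Rightarrow> real \<Rightarrow> real" and m0 :: nat
  assumes W: "brownian M F W"
    and T: "T > 0" and \<epsilon>: "0 < \<epsilon>" "\<epsilon> \<le> 1"
    and X: "\<And>t. 0 \<le> t \<Longrightarrow> X t \<in> borel_measurable (G t)" and Xc: "\<And>\<omega>. \<omega> \<in> space M \<Longrightarrow> continuous_on {0..} (\<lambda>t. X t \<omega>)"
    and \<xi>: "\<And>t. 0 \<le> t \<Longrightarrow> \<xi> t \<in> borel_measurable (G t)" and \<xi>c: "\<And>\<omega>. \<omega> \<in> space M \<Longrightarrow> continuous_on {0..} (\<lambda>t. \<xi> t \<omega>)"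
    and Ac: "continuous_on UNIV (\<lambda>(x, z). A x z)" and Bc: "continuous_on UNIV (\<lambda>(x, z). B x z)"
    and C: "C > 0" and AC: "\<And>x z. \<bar>A x z\<bar> \<le> C * (1 + \<bar>x\<bar>)" and BC: "\<And>x z. \<bar>B x z\<bar> \<le> C * (1 + \<bar>x\<bar>)"
    and eq: "\<And>t. 0 \<le> t \<Longrightarrow> \<exists>I. is_ito_integral M (\<lambda>s \<omega>. B (X s \<omega>) (\<xi> s \<omega>)) W t I \<and>
        (AE \<omega> in M. X t \<omega> = x0 + integral {0..t} (\<lambda>s. A (X s \<omega>) (\<xi> s \<omega>)) + sqrt \<epsilon> * I \<omega>)"
    and c: "c > 0" and \<kappa>: "\<kappa> = c\<^sup>2 / (8 * C\<^sup>2 * T)" "\<kappa> \<ge> 16"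
    and m0: "7 * (2 * C * T + c) * (3/4)^m0 < 3/4"
  shows "\<exists>E\<in>sets M. measure M E \<le> real (Suc (2^m0)) * (4 * exp (- \<kappa> / \<epsilon>)) \<and>
     (\<forall>\<omega>\<in>space M - E. X 0 \<omega> = x0 \<and>
        dyadic_increments T T ((2 * C * T + c) * (4^(2^m0) * (1 + \<bar>x0\<bar>))) (\<lambda>t. X t \<omega>))"
proof -
  define H where "H t \<omega> = B (X t \<omega>) (\<xi> t \<omega>)" for t \<omega>
  define Y where "Y t \<omega> = A (X t \<omega>) (\<xi> t \<omega>)" for t \<omega>
  have meas: "(\<lambda>\<omega>. f (X t \<omega>) (\<xi> t \<omega>)) \<in> borel_measurable (G t)"
    if "0 \<le> t" "continuous_on UNIV (\<lambda>(x, z). f x z)" for f :: "real \<Rightarrow> real \<Rightarrow> real" and t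
    by (rule borel_measurable_continuous_Pair[OF X[OF that(1)] \<xi>[OF that(1)]])
      (use that(2) in \<open>simp only: case_prod_unfold\<close>)
  have cont: "continuous_on {0..} (\<lambda>t. f (X t \<omega>) (\<xi> t \<omega>))"
    if "\<omega> \<in> space M" "continuous_on UNIV (\<lambda>(x, z). f x z)" for f :: "real \<Rightarrow> real \<Rightarrow> real" and \<omega>
    using continuous_on_compose2[OF that(2) continuous_on_Pair[OF Xc[OF that(1)] \<xi>c[OF that(1)]]] by simp
  have H: "\<And>t. 0 \<le> t \<Longrightarrow> H t \<in> borel_measurable (G t)" "\<And>\<omega>. \<omega> \<in> space M \<Longrightarrow> continuous_on {0..} (\<lambda>t. H t \<omega>)"
    unfolding H_def[abs_def] by (rule meas[OF _ Bc], assumption) (rule cont[OF _ Bc], assumption)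
  have Y: "\<And>t. 0 \<le> t \<Longrightarrow> Y t \<in> borel_measurable (G t)" "\<And>\<omega>. \<omega> \<in> space M \<Longrightarrow> continuous_on {0..} (\<lambda>t. Y t \<omega>)"
    unfolding Y_def[abs_def] by (rule meas[OF _ Ac], assumption) (rule cont[OF _ Ac], assumption)
  interpret W: brownian M F W by (rule W)
  interpret I: ito_integrand M F W H
    using H by unfold_locales
  define N where "N t \<omega> = X t \<omega> - integral {0..t} (\<lambda>s. Y s \<omega>)" for t \<omega>
  have N: "0 \<le> t \<Longrightarrow> N t \<in> borel_measurable M" for t
    unfolding N_def by (intro borel_measurable_diff measurable_G[OF X] measurable_G[OF integral_path_measurable] Y)
  have "\<exists>I. \<forall>t\<ge>0. is_ito_integral M H W t (I t) \<and> (AE \<omega> in M. N t \<omega> = x0 + sqrt \<epsilon> * I t \<omega>)"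
  proof -
    have "\<exists>I. is_ito_integral M H W t I \<and> (AE \<omega> in M. N t \<omega> = x0 + sqrt \<epsilon> * I \<omega>)" if t: "0 \<le> t" for t
    proof -
      obtain I where "is_ito_integral M (\<lambda>s \<omega>. B (X s \<omega>) (\<xi> s \<omega>)) W t I"
         "AE \<omega> in M. X t \<omega> = x0 + integral {0..t} (\<lambda>s. A (X s \<omega>) (\<xi> s \<omega>)) + sqrt \<epsilon> * I \<omega>"
        using eq[OF t] by blast
      then show ?thesis by (intro exI[of _ I]) (auto simp: H_def[abs_def] N_def Y_def)
    qed
    then show ?thesis by metis
  qed
  then obtain I where I: "\<And>t. 0 \<le> t \<Longrightarrow> is_ito_integral M H W t (I t)"
    and NI: "\<And>t. 0 \<le> t \<Longrightarrow> AE \<omega> in M. N t \<omega> = x0 + sqrt \<epsilon> * I t \<omega>" by blast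
  define R where "R k = 4^k * (1 + \<bar>x0\<bar>)" for k :: nat
  have R1: "R k \<ge> 1" for k
    unfolding R_def using mult_mono[of 1 "4^k" 1 "1 + \<bar>x0\<bar>"] by simp
  \<comment> \<open>Rational times keep the event measurable. On it the integrand is at most
    \<open>2 * C * R k\<close> up to time \<open>v\<close>.\<close>
  define Q where "Q k v = {\<omega>\<in>space M. \<forall>q::rat. 0 \<le> real_of_rat q \<and> real_of_rat q \<le> v \<longrightarrow> \<bar>X (real_of_rat q) \<omega>\<bar> \<le> R k}" for k v
  have Q[measurable]: "Q k v \<in> sets M" for k v
  proof -
    have "{\<omega>\<in>space M. 0 \<le> real_of_rat q \<and> real_of_rat q \<le> v \<longrightarrow> \<bar>X (real_of_rat q) \<omega>\<bar> \<le> R k} \<in> sets M" for q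
    proof (cases "0 \<le> real_of_rat q")
      case True
      have [measurable]: "X (real_of_rat q) \<in> borel_measurable M" using measurable_G[OF X[OF True]] .
      show ?thesis by measurable
    qed simp
    then show ?thesis unfolding Q_def by (rule sets.sets_Collect_countable_All)
  qed
  have QX: "\<bar>X t \<omega>\<bar> \<le> R k" if "\<omega> \<in> Q k v" "v > 0" "0 \<le> t" "t \<le> v" for t k v \<omega>
  proof -
    have om: "\<omega> \<in> space M" using that(1) by (simp add: Q_def)
    have "continuous_on {0..v} (\<lambda>t. X t \<omega>)" by (rule continuous_on_subset[OF Xc[OF om]]) simp
    then show ?thesis
      by (rule bounded_on_rationals_imp_bounded) (use that in \<open>auto simp: Q_def\<close>)
  qed
  have growth: "C * (1 + \<bar>x\<bar>) \<le> 2 * C * R k" if "\<bar>x\<bar> \<le> R k" for x k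
  proof -
    have "C * (1 + \<bar>x\<bar>) \<le> C * (2 * R k)" using that R1[of k] C by (intro mult_left_mono) auto
    then show ?thesis by simp
  qed
  define p where "p m i = real i * (T / 2^m)" for m i :: nat
  have p: "0 \<le> p m i" "p m i \<le> p m (Suc i)" "p m (Suc i) > 0" "p m (Suc i) - p m i = T / 2^m" for m i
    using T by (auto simp: p_def algebra_simps add_divide_distrib divide_right_mono add_pos_nonneg)
  \<comment> \<open>An increment counts as failing only for paths that are still within the level at
    its right end.\<close>
  define Ev where "Ev k m i = {\<omega>\<in>Q k (p m (Suc i)). \<bar>N (p m (Suc i)) \<omega> - N (p m i) \<omega>\<bar> > c * R k * (3/4)^m}" for k m i
  have [measurable]: "N (p m i) \<in> borel_measurable M" for m i using N p by simp
  have Ev[measurable]: "Ev k m i \<in> sets M" for k m i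
  proof -
    have "Ev k m i = Q k (p m (Suc i)) \<inter> {\<omega>\<in>space M. \<bar>N (p m (Suc i)) \<omega> - N (p m i) \<omega>\<bar> > c * R k * (3/4)^m}"
      by (auto simp: Ev_def Q_def)
    then show ?thesis by simp
  qed
  have EvP: "measure M (Ev k m i) \<le> 2 * exp (- (\<kappa> / \<epsilon>) * (9/8)^m)" for k m i
  proof -
    let ?v = "\<epsilon> * (2 * C * R k)\<^sup>2 * (T / 2^m)" and ?D = "\<lambda>\<omega>. N (p m (Suc i)) \<omega> - N (p m i) \<omega>"
    have vpos: "?v > 0" using \<epsilon> C R1[of k] T by (auto intro!: mult_pos_pos)
    have "measure M {\<omega>\<in>Q k (p m (Suc i)). \<bar>?D \<omega>\<bar> > c * R k * (3/4)^m} \<le> 2 * exp (- (c * R k * (3/4)^m)\<^sup>2 / (2 * ?v))"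
    proof (rule exponential_tail_abs[OF Q _ _ _ vpos])
      show "(\<integral>\<^sup>+\<omega>. indicator (Q k (p m (Suc i))) \<omega> * ennreal (exp (l * ?D \<omega>)) \<partial>M) \<le> ennreal (exp (l\<^sup>2 * ?v / 2))" for l
      proof -
        have ae: "AE \<omega> in M. ?D \<omega> = sqrt \<epsilon> * (I (p m (Suc i)) \<omega> - I (p m i) \<omega>)"
          using NI[OF p(1)[of m "Suc i"]] NI[OF p(1)[of m i]] by eventually_elim (simp add: right_diff_distrib)
        have "(\<integral>\<^sup>+\<omega>. indicator (Q k (p m (Suc i))) \<omega> * ennreal (exp (l * ?D \<omega>)) \<partial>M)
           = (\<integral>\<^sup>+\<omega>. indicator (Q k (p m (Suc i))) \<omega> * (1 * ennreal (exp ((l * sqrt \<epsilon>) * (I (p m (Suc i)) \<omega> - I (p m i) \<omega>)))) \<partial>M)"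
          using ae by (intro nn_integral_cong_AE, eventually_elim) (simp add: mult.assoc)
        also have "\<dots> \<le> ennreal (exp ((\<bar>l\<bar> * sqrt \<epsilon>)\<^sup>2 * (2 * C * R k)\<^sup>2 * (real (Suc i - i) * (T / 2^m)) / 2)) * (\<integral>\<^sup>+\<omega>. 1 \<partial>M)"
        proof (rule I.ito_increment_exp)
          show "is_ito_integral M H W (real i * (T / 2^m)) (I (p m i))"
            "is_ito_integral M H W (real (Suc i) * (T / 2^m)) (I (p m (Suc i)))"
            using I[OF p(1)[of m i]] I[OF p(1)[of m "Suc i"]] unfolding p_def by - assumption+
          show "\<bar>H t \<omega>\<bar> \<le> 2 * C * R k" if "\<omega> \<in> Q k (p m (Suc i))" "0 \<le> t" "t \<le> real (Suc i) * (T / 2^m)" for \<omega> t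
            using BC[of "X t \<omega>" "\<xi> t \<omega>"] growth[OF QX[OF that(1) p(3) that(2)]] that(3) unfolding H_def p_def by linarith
          show "\<bar>l * sqrt \<epsilon>\<bar> \<le> \<bar>l\<bar> * sqrt \<epsilon>" using \<epsilon> by (simp add: abs_mult)
          show "0 \<le> 2 * C * R k" using C R1[of k] by auto
        qed (use T in \<open>auto simp: Q_def\<close>)
        also have "\<dots> = ennreal (exp (l\<^sup>2 * ?v / 2))"
          using \<epsilon> by (simp add: emeasure_space_1 power_mult_distrib mult_ac)
        finally show ?thesis .
      qed
      show "0 \<le> c * R k * (3/4)^m" using c R1[of k] by auto
    qed measurable
    also have "- (c * R k * (3/4)^m)\<^sup>2 / (2 * ?v) = - (\<kappa> / \<epsilon>) * (9/8)^m"
    proof -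
      have pw: "((3/4)^m)\<^sup>2 * 2^m = (9/8::real)^m"
        by (simp add: power2_eq_square power_mult_distrib[symmetric])
      have "(c * R k * (3/4)^m)\<^sup>2 / (2 * ?v) = (c\<^sup>2 / (8 * C\<^sup>2 * T)) / \<epsilon> * (((3/4)^m)\<^sup>2 * 2^m)"
        using \<epsilon> C R1[of k] T by (simp add: power_mult_distrib)
      then show ?thesis unfolding pw \<kappa>(1)[symmetric] by simp
    qed
    finally show ?thesis by (simp add: Ev_def)
  qed
  define U where "U k m = (\<Union>i<2^m. Ev k m i)" for k m
  have U[measurable]: "U k m \<in> sets M" for k m unfolding U_def by measurable
  have UP: "measure M (U k m) \<le> 2 * exp (- \<kappa> / \<epsilon>) * (1/2)^m" for k m
  proof -
    have k16: "\<kappa> / \<epsilon> \<ge> 16"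
    proof -
      have "\<kappa> * 1 \<le> \<kappa> * (1 / \<epsilon>)" using \<kappa>(2) \<epsilon> by (intro mult_left_mono) auto
      then show ?thesis using \<kappa>(2) by simp
    qed
    have "measure M (U k m) \<le> (\<Sum>i<2^m. measure M (Ev k m i))"
      unfolding U_def by (intro measure_UNION_le) auto
    also have "\<dots> \<le> (\<Sum>i<2^m::nat. 2 * exp (- (\<kappa> / \<epsilon>) * (9/8)^m))" by (intro sum_mono EvP)
    also have "\<dots> = 2^m * (2 * exp (- (\<kappa> / \<epsilon>) * (9/8)^m))" by simp
    also have "\<dots> \<le> 2^m * (2 * exp (- \<kappa> / \<epsilon> + real m * (- (\<kappa> / \<epsilon>) / 8)))"
    proof -
      \<comment> \<open>Bernoulli's inequality makes the exponent linear in \<open>m\<close>; the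
        factor \<open>2^m\<close> is absorbed by \<open>exp (- (\<kappa> / \<epsilon>) / 8) \<le>
        exp (- 2) \<le> 1/4\<close>, leaving the ratio 1/2.\<close>
      have "1 + real m * (1/8) \<le> (1 + 1/8)^m" by (rule Bernoulli_inequality) simp
      then have "(\<kappa> / \<epsilon>) * (1 + real m / 8) \<le> (\<kappa> / \<epsilon>) * (9/8)^m" using k16 by (intro mult_left_mono) auto
      then show ?thesis by (simp add: algebra_simps)
    qed
    also have "\<dots> = 2 * exp (- \<kappa> / \<epsilon>) * (2 * exp (- (\<kappa> / \<epsilon>) / 8))^m"
      by (simp only: exp_add exp_of_nat_mult power_mult_distrib mult_ac)
    also have "\<dots> \<le> 2 * exp (- \<kappa> / \<epsilon>) * (1/2)^m"
    proof -
      have "exp (- (\<kappa> / \<epsilon>) / 8) \<le> exp (- 2::real)" using k16 by simp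
      also have "\<dots> \<le> 1/4" using exp_lower_Taylor_quadratic[of 2] by (simp add: exp_minus field_simps)
      finally show ?thesis by (intro mult_left_mono power_mono) auto
    qed
    finally show ?thesis .
  qed
  \<comment> \<open>The null event of a wrong starting point is removed as well, since the compact
    set of paths fixes the value at 0.\<close>
  define E0 where "E0 = {\<omega>\<in>space M. X 0 \<omega> \<noteq> x0}"
  have [measurable]: "X 0 \<in> borel_measurable M" using measurable_G[OF X[of 0]] by simp
  have E0[measurable]: "E0 \<in> sets M" unfolding E0_def by measurable
  have "AE \<omega> in M. X 0 \<omega> = x0"
    using NI[of 0, simplified] ito_integral_0[OF I[of 0, simplified]]
    by eventually_elim (simp add: N_def)
  then have E0P: "measure M E0 = 0"
    by (subst prob_eq_0) (auto simp: E0_def elim: AE_mp)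
  define E where "E = E0 \<union> (\<Union>k\<le>2^m0. \<Union>m. U k m)"
  have "E \<in> sets M" unfolding E_def by measurable
  moreover have "measure M E \<le> real (Suc (2^m0)) * (4 * exp (- \<kappa> / \<epsilon>))"
  proof -
    have sm: "(\<lambda>m. 2 * exp (- \<kappa> / \<epsilon>) * (1/2)^m) sums (2 * exp (- \<kappa> / \<epsilon>) * (1 / (1 - 1/2)))"
      by (intro sums_mult geometric_sums) simp
    have 1: "measure M (\<Union>m. U k m) \<le> 4 * exp (- \<kappa> / \<epsilon>)" for k
    proof -
      have sU: "summable (\<lambda>m. measure M (U k m))"
        by (rule summable_comparison_test'[OF sums_summable[OF sm], of 0]) (use UP in auto)
      have "measure M (\<Union>m. U k m) \<le> (\<Sum>m. measure M (U k m))"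
        by (intro finite_measure_subadditive_countably sU) auto
      also have "\<dots> \<le> (\<Sum>m. 2 * exp (- \<kappa> / \<epsilon>) * (1/2)^m)"
        by (intro suminf_le UP sU sums_summable[OF sm])
      also have "\<dots> = 4 * exp (- \<kappa> / \<epsilon>)" using sums_unique[OF sm] by simp
      finally show ?thesis .
    qed
    have "measure M E \<le> measure M E0 + measure M (\<Union>k\<le>2^m0. \<Union>m. U k m)"
      unfolding E_def by (intro measure_Un_le) auto
    also have "\<dots> \<le> 0 + (\<Sum>k\<le>2^m0. measure M (\<Union>m. U k m))"
      unfolding E0P by (intro add_left_mono measure_UNION_le) auto
    also have "\<dots> \<le> 0 + (\<Sum>k\<le>2^m0::nat. 4 * exp (- \<kappa> / \<epsilon>))" by (intro add_left_mono sum_mono 1)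
    also have "\<dots> = real (Suc (2^m0)) * (4 * exp (- \<kappa> / \<epsilon>))" by simp
    finally show ?thesis .
  qed
  moreover have "X 0 \<omega> = x0 \<and> dyadic_increments T T ((2 * C * T + c) * (4^(2^m0) * (1 + \<bar>x0\<bar>))) (\<lambda>t. X t \<omega>)"
    if om: "\<omega> \<in> space M - E" for \<omega>
  proof
    have omM: "\<omega> \<in> space M" using om by simp
    show 0: "X 0 \<omega> = x0" using om by (auto simp: E_def E0_def)
    have "dyadic_increments T T ((2 * C * T + c) * (4^(2^m0) * (1 + \<bar>X 0 \<omega>\<bar>))) (\<lambda>t. X t \<omega>)"
    proof (rule scaled_increments_imp_dyadic_increments[OF T _ _ m0])
      show "continuous_on {0..T} (\<lambda>t. X t \<omega>)" by (rule continuous_on_subset[OF Xc[OF omM]]) simp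
      show "0 \<le> 2 * C * T + c" using C T c by simp
      fix k m i :: nat
      assume k: "k \<le> 2^m0" and i: "i < 2^m"
        and b: "\<And>t. 0 \<le> t \<Longrightarrow> t \<le> real (Suc i) * (T / 2^m) \<Longrightarrow> \<bar>X t \<omega>\<bar> \<le> 4^k * (1 + \<bar>X 0 \<omega>\<bar>)"
      have b': "\<bar>X t \<omega>\<bar> \<le> R k" if "0 \<le> t" "t \<le> p m (Suc i)" for t
        using b[of t] that by (simp add: R_def p_def 0)
      have "\<omega> \<in> Q k (p m (Suc i))" using b' omM by (auto simp: Q_def)
      moreover have "\<omega> \<notin> Ev k m i" using om k i by (auto simp: E_def U_def)
      ultimately have n: "\<bar>N (p m (Suc i)) \<omega> - N (p m i) \<omega>\<bar> \<le> c * R k * (3/4)^m" by (simp add: Ev_def not_less)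
      have Yc: "continuous_on {a..p m (Suc i)} (\<lambda>s. Y s \<omega>)" if "0 \<le> a" for a
        by (rule continuous_on_subset[OF Y(2)[OF omM]]) (use that in auto)
      have "integral {0..p m i} (\<lambda>s. Y s \<omega>) + integral {p m i..p m (Suc i)} (\<lambda>s. Y s \<omega>) = integral {0..p m (Suc i)} (\<lambda>s. Y s \<omega>)"
        using p[of m i] by (intro Henstock_Kurzweil_Integration.integral_combine integrable_continuous_real Yc) auto
      then have d: "X (p m (Suc i)) \<omega> - X (p m i) \<omega> = (N (p m (Suc i)) \<omega> - N (p m i) \<omega>) + integral {p m i..p m (Suc i)} (\<lambda>s. Y s \<omega>)"
        by (simp add: N_def)
      have bd: "norm (Y s \<omega>) \<le> 2 * C * R k" if "s \<in> {p m i..p m (Suc i)}" for s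
        using AC[of "X s \<omega>" "\<xi> s \<omega>"] growth[OF b'[of s]] that p(1)[of m i] unfolding Y_def real_norm_def by force
      have "norm (integral {p m i..p m (Suc i)} (\<lambda>s. Y s \<omega>)) \<le> 2 * C * R k * (p m (Suc i) - p m i)"
        using p[of m i] by (intro integral_bound bd Yc) auto
      \<comment> \<open>The drift contributes only order \<open>(1/2)^m\<close>, which
        \<open>(3/4)^m\<close> dominates.\<close>
      also have "\<dots> = 2 * C * T * R k * (1/2)^m" by (simp add: p(4) power_divide)
      also have "\<dots> \<le> 2 * C * T * R k * (3/4)^m"
        using C T R1[of k] by (intro mult_left_mono power_mono) auto
      finally have "\<bar>integral {p m i..p m (Suc i)} (\<lambda>s. Y s \<omega>)\<bar> \<le> 2 * C * T * R k * (3/4)^m" by simp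
      then have "\<bar>X (p m (Suc i)) \<omega> - X (p m i) \<omega>\<bar> \<le> c * R k * (3/4)^m + 2 * C * T * R k * (3/4)^m"
        unfolding d using n by linarith
      also have "\<dots> = (2 * C * T + c) * R k * (3/4)^m" by (simp add: algebra_simps)
      finally show "\<bar>X (real (Suc i) * (T / 2^m)) \<omega> - X (real i * (T / 2^m)) \<omega>\<bar> \<le> (2 * C * T + c) * (4^k * (1 + \<bar>X 0 \<omega>\<bar>)) * (3/4)^m"
        by (simp only: p_def R_def 0)
    qed
    then show "dyadic_increments T T ((2 * C * T + c) * (4^(2^m0) * (1 + \<bar>x0\<bar>))) (\<lambda>t. X t \<omega>)"
      by (simp only: 0)
  qed
  ultimately show ?thesis by blast
qed

text \<open>Since \<sigma> is bounded by \<open>sqrt C\<close>, the whole space may serve as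
  \<open>Q\<close>, and the integral against \<open>V\<close> is sub-Gaussian without localisation;
  the factor \<open>1 / sqrt \<epsilon>\<close> raises the variance rate to
  \<open>C / \<epsilon>\<close>.\<close>

lemma fast_occupation_tail:
  fixes \<xi> :: "real \<Rightarrow> 'w \<Rightarrow> real" and b \<sigma> :: "real \<Rightarrow> real"
  assumes V: "brownian M F V" and T: "T > 0" and \<epsilon>: "0 < \<epsilon>" "\<epsilon> \<le> 1" and b: "continuous_on UNIV b"
    and \<xi>: "\<And>t. 0 \<le> t \<Longrightarrow> \<xi> t \<in> borel_measurable (G t)"
    and \<xi>c: "\<And>\<omega>. \<omega> \<in> space M \<Longrightarrow> continuous_on {0..} (\<lambda>t. \<xi> t \<omega>)"
    and \<sigma>: "continuous_on UNIV \<sigma>" and C: "C > 0" "\<And>z. (\<sigma> z)\<^sup>2 \<le> C"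
    and eq: "\<And>t. 0 \<le> t \<Longrightarrow> \<exists>J. is_ito_integral M (\<lambda>s \<omega>. \<sigma> (\<xi> s \<omega>)) V t J \<and>
        (AE \<omega> in M. \<xi> t \<omega> = z0 + integral {0..t} (\<lambda>s. b (\<xi> s \<omega>) / \<epsilon>) + J \<omega> / sqrt \<epsilon>)"
    and a1: "a1 \<ge> 0" and \<mu>: "\<mu> > 0"
  defines "\<psi> \<equiv> \<lambda>z. - (z / sqrt (1 + z\<^sup>2)) * b z"
  shows "{\<omega>\<in>space M. integral {0..T} (\<lambda>t. \<psi> (\<xi> t \<omega>)) > sqrt (1 + z0\<^sup>2) + a1 + a2 + 1} \<in> sets M" (is "?B \<in> _")
    and "measure M {\<omega>\<in>space M. integral {0..T} (\<lambda>t. \<psi> (\<xi> t \<omega>)) > sqrt (1 + z0\<^sup>2) + a1 + a2 + 1}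
      \<le> exp (- a1\<^sup>2 / (2 * \<epsilon> * C * T)) + exp (2 * \<mu> * C * T / \<epsilon> - \<mu> * a2 / \<epsilon>)"
proof -
  define H where "H t \<omega> = \<sigma> (\<xi> t \<omega>)" for t \<omega>
  have H: "\<And>t. 0 \<le> t \<Longrightarrow> H t \<in> borel_measurable (G t)" "\<And>\<omega>. \<omega> \<in> space M \<Longrightarrow> continuous_on {0..} (\<lambda>t. H t \<omega>)"
    using measurable_compose[OF \<xi> borel_measurable_continuous_onI[OF \<sigma>]]
    by (auto simp: H_def[abs_def] intro!: continuous_on_compose2[OF \<sigma> \<xi>c])
  interpret V: brownian M F V by (rule V)
  interpret I: ito_integrand M F V H
    using H by unfold_locales
  define N where "N t \<omega> = \<xi> t \<omega> - integral {0..t} (\<lambda>s. b (\<xi> s \<omega>) / \<epsilon>)" for t \<omega>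
  have "\<exists>J. \<forall>t\<ge>0. is_ito_integral M H V t (J t) \<and> (AE \<omega> in M. N t \<omega> = z0 + J t \<omega> / sqrt \<epsilon>)"
  proof -
    have "\<exists>J. is_ito_integral M H V t J \<and> (AE \<omega> in M. N t \<omega> = z0 + J \<omega> / sqrt \<epsilon>)" if t: "0 \<le> t" for t
    proof -
      obtain J where "is_ito_integral M (\<lambda>s \<omega>. \<sigma> (\<xi> s \<omega>)) V t J"
         "AE \<omega> in M. \<xi> t \<omega> = z0 + integral {0..t} (\<lambda>s. b (\<xi> s \<omega>) / \<epsilon>) + J \<omega> / sqrt \<epsilon>"
        using eq[OF t] by blast
      then show ?thesis by (intro exI[of _ J]) (auto simp: H_def[abs_def] N_def simp del: integral_divide)
    qed
    then show ?thesis by metis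
  qed
  then obtain J where J: "\<And>t. 0 \<le> t \<Longrightarrow> is_ito_integral M H V t (J t)"
    and NJ: "\<And>t. 0 \<le> t \<Longrightarrow> AE \<omega> in M. N t \<omega> = z0 + J t \<omega> / sqrt \<epsilon>" by blast
  have \<xi>0: "AE \<omega> in M. \<xi> 0 \<omega> = z0"
    using NJ[of 0, simplified] ito_integral_0[OF J[of 0, simplified]]
    by eventually_elim (simp add: N_def)
  have sg: "subgaussian (real k * (T / 2^n)) (T / 2^n) (sqrt (C / \<epsilon>))
      (\<lambda>\<omega>. \<xi> (real (Suc k) * (T / 2^n)) \<omega> - \<xi> (real k * (T / 2^n)) \<omega>
         - (integral {0..real (Suc k) * (T / 2^n)} (\<lambda>s. b (\<xi> s \<omega>) / \<epsilon>) - integral {0..real k * (T / 2^n)} (\<lambda>s. b (\<xi> s \<omega>) / \<epsilon>)))" for n k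
  proof -
    let ?d = "T / 2^n"
    have t0: "0 \<le> real j * ?d" for j :: nat using T by simp
    let ?D = "\<lambda>\<omega>. J (real (Suc k) * ?d) \<omega> - J (real k * ?d) \<omega>"
    have "subgaussian (real k * ?d) ?d (sqrt C) ?D"
      unfolding subgaussian_def
    proof (intro allI impI)
      fix Z :: "'w \<Rightarrow> ennreal" and K :: "'w \<Rightarrow> real" and g :: real
      assume Z: "Z \<in> borel_measurable (G (real k * ?d))" and K: "K \<in> borel_measurable (G (real k * ?d))"
        and Kg: "\<forall>\<omega>\<in>space M. \<bar>K \<omega>\<bar> \<le> g"
      have "(\<integral>\<^sup>+\<omega>. Z \<omega> * ennreal (exp (K \<omega> * ?D \<omega>)) \<partial>M) = (\<integral>\<^sup>+\<omega>. indicator (space M) \<omega> * (Z \<omega> * ennreal (exp (K \<omega> * ?D \<omega>))) \<partial>M)"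
        by (intro nn_integral_cong) simp
      also have "\<dots> \<le> ennreal (exp (g\<^sup>2 * (sqrt C)\<^sup>2 * (real (Suc k - k) * ?d) / 2)) * (\<integral>\<^sup>+\<omega>. Z \<omega> \<partial>M)"
      proof (rule I.ito_increment_exp[OF _ _ J[OF t0] J[OF t0] _ _ _ Z K])
        show "\<bar>H t \<omega>\<bar> \<le> sqrt C" for t \<omega>
          unfolding H_def using C(2)[of "\<xi> t \<omega>"] by (intro real_le_rsqrt) simp
      qed (use T Kg C in auto)
      finally show "(\<integral>\<^sup>+\<omega>. Z \<omega> * ennreal (exp (K \<omega> * ?D \<omega>)) \<partial>M) \<le> ennreal (exp (g\<^sup>2 * (sqrt C)\<^sup>2 * ?d / 2)) * (\<integral>\<^sup>+\<omega>. Z \<omega> \<partial>M)"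
        by simp
    qed
    from subgaussian_scale[OF this, of "1 / sqrt \<epsilon>"]
    have sg': "subgaussian (real k * ?d) ?d (sqrt (C / \<epsilon>)) (\<lambda>\<omega>. 1 / sqrt \<epsilon> * ?D \<omega>)"
      using \<epsilon> by (simp add: real_sqrt_divide)
    show ?thesis
    proof (rule subgaussian_cong_AE[OF sg'])
      show "AE \<omega> in M. \<xi> (real (Suc k) * ?d) \<omega> - \<xi> (real k * ?d) \<omega>
         - (integral {0..real (Suc k) * ?d} (\<lambda>s. b (\<xi> s \<omega>) / \<epsilon>) - integral {0..real k * ?d} (\<lambda>s. b (\<xi> s \<omega>) / \<epsilon>)) = 1 / sqrt \<epsilon> * ?D \<omega>"
        using NJ[OF t0[of "Suc k"]] NJ[OF t0[of k]]
      proof eventually_elim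
        case (elim \<omega>)
        have "1 / sqrt \<epsilon> * ?D \<omega> = J (real (Suc k) * ?d) \<omega> / sqrt \<epsilon> - J (real k * ?d) \<omega> / sqrt \<epsilon>"
          by (simp add: diff_divide_distrib)
        then show ?case using elim unfolding N_def by linarith
      qed
    qed
  qed
  show "?B \<in> sets M" 
    "measure M ?B \<le> exp (- a1\<^sup>2 / (2 * \<epsilon> * C * T)) + exp (2 * \<mu> * C * T / \<epsilon> - \<mu> * a2 / \<epsilon>)"
    unfolding \<psi>_def
    by (intro lyapunov_integral_tail[OF T \<epsilon> b \<xi> \<xi>c \<xi>0 C(1) sg a1 \<mu>]; assumption)+
qed

end

section \<open>The metric on paths and measures\<close>

text \<open>Bolzano-Weierstrass for each index, combined by Cantor's diagonal sequence.\<close>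

lemma convergent_subsequence_countable:
  fixes f :: "nat \<Rightarrow> 'i::countable \<Rightarrow> real"
  assumes bound: "\<And>n x. \<bar>f n x\<bar> \<le> B"
  shows "\<exists>k. strict_mono (k :: nat \<Rightarrow> nat) \<and> (\<forall>x. convergent (\<lambda>n. f (k n) x))"
proof -
  interpret subseqs "\<lambda>m s. convergent (\<lambda>n. f (s n) (from_nat m))"
  proof
    fix m and s :: "nat \<Rightarrow> nat" assume "strict_mono s"
    have "bounded (range (\<lambda>n. f (s n) (from_nat m)))"
      unfolding bounded_iff using bound by auto
    from bounded_imp_convergent_subsequence[OF this]
    show "\<exists>r. strict_mono r \<and> convergent (\<lambda>n. f ((s \<circ> r) n) (from_nat m))"
      by (auto simp: o_def convergent_def)
  qed
  have "convergent (\<lambda>n. f (diagseq n) x)" for x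
  proof -
    \<comment> \<open>From position \<open>Suc (to_nat x)\<close> on, the diagonal sequence runs
      inside the subsequence selected for \<open>x\<close>; the initial terms do not affect
      convergence.\<close>
    have "convergent (\<lambda>n. f ((diagseq \<circ> (+) (Suc (to_nat x))) n) (from_nat (to_nat x)))"
    proof (rule diagseq_holds)
      fix r s :: "nat \<Rightarrow> nat" and m
      assume "strict_mono r" "convergent (\<lambda>n. f (s n) (from_nat m))"
      then show "convergent (\<lambda>n. f ((s \<circ> r) n) (from_nat m))"
        using convergent_subseq_convergent[of "\<lambda>n. f (s n) (from_nat m)" r] by (simp add: o_def)
    qed
    then have "convergent (\<lambda>n. f (diagseq (n + Suc (to_nat x))) x)"
      by (simp add: o_def add.commute)
    then show ?thesis by (subst (asm) convergent_ignore_initial_segment)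
  qed
  then show ?thesis using subseq_diagseq by blast
qed

section \<open>The Levy-Prokhorov metric\<close>

definition lp_close :: "real \<Rightarrow> (real \<times> real) measure \<Rightarrow> (real \<times> real) measure \<Rightarrow> bool" where
  "lp_close \<delta> \<mu> \<nu> \<longleftrightarrow> \<delta> > 0 \<and> (\<forall>S. closed S \<longrightarrow>
      measure \<mu> S \<le> measure \<nu> {x. infdist x S < \<delta>} + \<delta> \<and>
      measure \<nu> S \<le> measure \<mu> {x. infdist x S < \<delta>} + \<delta>)"

lemma levy_prokhorov_eq: "levy_prokhorov \<mu> \<nu> = Inf {\<delta>. lp_close \<delta> \<mu> \<nu>}"
  by (simp add: levy_prokhorov_def lp_close_def)

lemma lp_close_commute: "lp_close \<delta> \<mu> \<nu> \<longleftrightarrow> lp_close \<delta> \<nu> \<mu>"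
  by (auto simp: lp_close_def)

lemma levy_prokhorov_commute: "levy_prokhorov \<mu> \<nu> = levy_prokhorov \<nu> \<mu>"
  unfolding levy_prokhorov_eq by (subst lp_close_commute) simp

lemma levy_prokhorov_le: "lp_close \<delta> \<mu> \<nu> \<Longrightarrow> levy_prokhorov \<mu> \<nu> \<le> \<delta>"
  unfolding levy_prokhorov_eq
  by (intro cInf_lower bdd_belowI[of _ 0]) (auto simp: lp_close_def)

lemma open_infdist_less: "open {x::'a::metric_space. infdist x S < \<delta>}"
  by (intro open_Collect_less continuous_intros)

lemma closed_infdist_le: "closed {x::'a::metric_space. infdist x S \<le> \<delta>}"
  by (intro closed_Collect_le continuous_intros)

lemma infdist_less_borel: "sets \<nu> = sets borel \<Longrightarrow> {x. infdist x S < \<delta>} \<in> sets \<nu>"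
  using open_infdist_less[of S \<delta>] by simp

text \<open>A number above both total masses works, so for finite measures the infimum is over a
  nonempty set.\<close>

lemma ex_lp_close:
  assumes "finite_measure \<mu>" "finite_measure \<nu>"
  shows "\<exists>\<delta>. lp_close \<delta> \<mu> \<nu>"
proof
  let ?d = "max (measure \<mu> (space \<mu>)) (measure \<nu> (space \<nu>)) + 1"
  have "0 \<le> measure \<mu> (space \<mu>)" by simp
  then have "?d > 0" by linarith
  moreover have "measure \<mu> S \<le> measure \<nu> U + ?d" "measure \<nu> S \<le> measure \<mu> U + ?d" for S U
    using finite_measure.bounded_measure[OF assms(1), of S] finite_measure.bounded_measure[OF assms(2), of S]
      measure_nonneg[of \<mu> U] measure_nonneg[of \<nu> U] by linarith+
  ultimately show "lp_close ?d \<mu> \<nu>" by (simp add: lp_close_def)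
qed

lemma levy_prokhorov_less_D:
  assumes "finite_measure \<mu>" "finite_measure \<nu>" "levy_prokhorov \<mu> \<nu> < e"
  shows "\<exists>\<delta><e. lp_close \<delta> \<mu> \<nu>"
  using cInf_lessD[of "{\<delta>. lp_close \<delta> \<mu> \<nu>}" e] assms ex_lp_close[OF assms(1,2)]
  by (auto simp: levy_prokhorov_eq)

lemma levy_prokhorov_nonneg:
  assumes "finite_measure \<mu>" "finite_measure \<nu>"
  shows "0 \<le> levy_prokhorov \<mu> \<nu>"
  unfolding levy_prokhorov_eq using ex_lp_close[OF assms]
  by (intro cInf_greatest) (auto simp: lp_close_def)

text \<open>The middle set must be closed for the second comparison, so the open neighbourhood of
  radius \<open>a\<close> is enlarged to \<open>{x. infdist x S \<le> a}\<close>; points closer than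
  \<open>b\<close> to it are closer than \<open>a + b\<close> to \<open>S\<close>.\<close>

lemma lp_close_triangle:
  assumes \<mu>: "finite_measure \<mu>" "sets \<mu> = sets borel" and \<nu>: "finite_measure \<nu>" "sets \<nu> = sets borel"
    and \<rho>: "finite_measure \<rho>" "sets \<rho> = sets borel"
    and a: "lp_close a \<mu> \<nu>" and b: "lp_close b \<nu> \<rho>"
  shows "lp_close (a + b) \<mu> \<rho>"
proof -
  have ab: "a > 0" "b > 0" using a b by (auto simp: lp_close_def)
  have key: "measure \<mu> S \<le> measure \<rho> {x. infdist x S < a + b} + (a + b)"
    if fin: "finite_measure \<nu>" "finite_measure \<rho>" and sets: "sets \<nu> = sets borel" "sets \<rho> = sets borel"
      and S: "closed S"
      and le: "\<And>S. closed S \<Longrightarrow> measure \<mu> S \<le> measure \<nu> {x. infdist x S < a} + a"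
        "\<And>S. closed S \<Longrightarrow> measure \<nu> S \<le> measure \<rho> {x. infdist x S < b} + b"
      and ab: "a > 0" "b > 0"
    for \<mu> \<nu> \<rho> :: "(real \<times> real) measure" and S a b
  \<comment> \<open>The nearest-point argument below needs a nonempty set, and
    \<open>infdist\<close> to the empty set is 0 by convention.\<close>
  proof (cases "S = {}")
    case False
    let ?C = "{x. infdist x S \<le> a}"
    have Cb: "?C \<in> sets \<nu>" using closed_infdist_le[of S a] sets by simp
    obtain x0 where "x0 \<in> S" using False by blast
    then have "x0 \<in> ?C" using ab by simp
    then have "?C \<noteq> {}" by blast
    have "measure \<mu> S \<le> measure \<nu> {x. infdist x S < a} + a" using le(1) S .
    also have "measure \<nu> {x. infdist x S < a} \<le> measure \<nu> ?C"
      using Cb by (intro finite_measure.finite_measure_mono[OF fin(1)]) auto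
    also have "measure \<nu> ?C \<le> measure \<rho> {x. infdist x ?C < b} + b" by (intro le closed_infdist_le)
    also have "measure \<rho> {x. infdist x ?C < b} \<le> measure \<rho> {x. infdist x S < a + b}"
    proof (intro finite_measure.finite_measure_mono[OF fin(2)] infdist_less_borel sets subsetI CollectI)
      fix x assume "x \<in> {x. infdist x ?C < b}"
      moreover obtain y where "y \<in> ?C" "infdist x ?C = dist x y"
        using infdist_attains_inf[OF closed_infdist_le \<open>?C \<noteq> {}\<close>] by blast
      ultimately show "infdist x S < a + b" using infdist_triangle[of x S y] by auto
    qed
    finally show ?thesis by simp
  qed (use ab in auto)
  have "measure \<mu> S \<le> measure \<rho> {x. infdist x S < a + b} + (a + b)" if "closed S" for S
    using a b ab by (intro key[OF \<nu>(1) \<rho>(1) \<nu>(2) \<rho>(2) that]) (auto simp: lp_close_def)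
  moreover have "measure \<rho> S \<le> measure \<mu> {x. infdist x S < b + a} + (b + a)" if "closed S" for S
    using a b ab by (intro key[OF \<nu>(1) \<mu>(1) \<nu>(2) \<mu>(2) that]) (auto simp: lp_close_def)
  ultimately show ?thesis using ab by (simp add: lp_close_def add.commute)
qed

lemma levy_prokhorov_triangle:
  assumes \<mu>: "finite_measure \<mu>" "sets \<mu> = sets borel" and \<nu>: "finite_measure \<nu>" "sets \<nu> = sets borel"
    and \<rho>: "finite_measure \<rho>" "sets \<rho> = sets borel"
  shows "levy_prokhorov \<mu> \<rho> \<le> levy_prokhorov \<mu> \<nu> + levy_prokhorov \<nu> \<rho>"
proof (rule field_le_epsilon)
  fix e :: real assume e: "e > 0"
  obtain a where a: "a < levy_prokhorov \<mu> \<nu> + e / 2" "lp_close a \<mu> \<nu>"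
    using levy_prokhorov_less_D[OF \<mu>(1) \<nu>(1), of "levy_prokhorov \<mu> \<nu> + e / 2"] e by auto
  obtain b where b: "b < levy_prokhorov \<nu> \<rho> + e / 2" "lp_close b \<nu> \<rho>"
    using levy_prokhorov_less_D[OF \<nu>(1) \<rho>(1), of "levy_prokhorov \<nu> \<rho> + e / 2"] e by auto
  have "levy_prokhorov \<mu> \<rho> \<le> a + b"
    by (intro levy_prokhorov_le lp_close_triangle[OF \<mu> \<nu> \<rho> a(2) b(2)])
  then show "levy_prokhorov \<mu> \<rho> \<le> levy_prokhorov \<mu> \<nu> + levy_prokhorov \<nu> \<rho> + e" using a b by linarith
qed

lemma lp_close_refl:
  assumes "finite_measure \<mu>" "sets \<mu> = sets borel" "\<delta> > 0"
  shows "lp_close \<delta> \<mu> \<mu>"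
proof -
  have "measure \<mu> S \<le> measure \<mu> {x. infdist x S < \<delta>}" for S
    using assms(3) by (intro finite_measure.finite_measure_mono[OF assms(1)] infdist_less_borel assms(2)) auto
  then show ?thesis using assms(3) by (auto simp: lp_close_def intro: add_increasing2)
qed

text \<open>A closed set is the intersection of its neighbourhoods of radius
  \<open>1 / (n + 1)\<close>, so distance 0 gives equal values on closed sets, and these form a
  generator stable under intersection.\<close>

lemma levy_prokhorov_eq_0_D:
  assumes \<mu>: "finite_measure \<mu>" "sets \<mu> = sets borel" and \<nu>: "finite_measure \<nu>" "sets \<nu> = sets borel"
    and 0: "levy_prokhorov \<mu> \<nu> = 0"
  shows "\<mu> = \<nu>"
proof -
  have le: "measure \<mu> S \<le> measure \<nu> S"
    if fin: "finite_measure \<mu>" "finite_measure \<nu>" and sets: "sets \<nu> = sets borel"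
      and 0: "levy_prokhorov \<mu> \<nu> = 0" and S: "closed S" for \<mu> \<nu> and S :: "(real \<times> real) set"
  proof (cases "S = {}")
    case False
    let ?N = "\<lambda>n. {x. infdist x S < inverse (real (Suc n))}"
    have "decseq ?N"
      unfolding decseq_def by (auto intro: less_le_trans le_imp_inverse_le)
    then have "(\<lambda>n. measure \<nu> (?N n)) \<longlonglongrightarrow> measure \<nu> (\<Inter>n. ?N n)"
      using infdist_less_borel[OF sets] by (intro finite_measure.finite_Lim_measure_decseq[OF fin(2)]) auto
    moreover have "(\<Inter>n. ?N n) = S"
    proof (intro subset_antisym subsetI)
      fix x assume x: "x \<in> (\<Inter>n. ?N n)"
      have "infdist x S = 0"
      proof (rule ccontr)
        assume "infdist x S \<noteq> 0"
        then have "0 < infdist x S" using infdist_nonneg[of x S] by linarith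
        then obtain n where "inverse (real (Suc n)) < infdist x S" using reals_Archimedean by blast
        moreover have "infdist x S < inverse (real (Suc n))" using x by blast
        ultimately show False by linarith
      qed
      then show "x \<in> S" using in_closed_iff_infdist_zero[OF S False] by simp
    qed auto
    ultimately have "(\<lambda>n. measure \<nu> (?N n)) \<longlonglongrightarrow> measure \<nu> S" by simp
    from tendsto_add[OF this LIMSEQ_inverse_real_of_nat]
    have lim: "(\<lambda>n. measure \<nu> (?N n) + inverse (real (Suc n))) \<longlonglongrightarrow> measure \<nu> S" by simp
    have "measure \<mu> S \<le> measure \<nu> (?N n) + inverse (real (Suc n))" for n
    proof -
      obtain d where d: "d < inverse (real (Suc n))" "lp_close d \<mu> \<nu>"
        using levy_prokhorov_less_D[OF fin, of "inverse (real (Suc n))"] 0 by auto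
      have "measure \<mu> S \<le> measure \<nu> {x. infdist x S < d} + d" using d(2) S by (auto simp: lp_close_def)
      also have "measure \<nu> {x. infdist x S < d} \<le> measure \<nu> (?N n)"
        using d(1) by (intro finite_measure.finite_measure_mono[OF fin(2)] infdist_less_borel sets) auto
      finally show ?thesis using d(1) by linarith
    qed
    then show ?thesis by (intro LIMSEQ_le_const[OF lim]) auto
  qed auto
  have eq: "measure \<mu> S = measure \<nu> S" if "closed S" for S
    using le[OF \<mu>(1) \<nu>(1) \<nu>(2) 0 that] le[OF \<nu>(1) \<mu>(1) \<mu>(2) 0[unfolded levy_prokhorov_commute[of \<mu>]] that] by simp
  have sb: "sets borel = sigma_sets UNIV (Collect (closed :: (real \<times> real) set \<Rightarrow> bool))"
    by (simp add: borel_eq_closed)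
  show ?thesis
  proof (rule measure_eqI_generator_eq[where \<Omega>=UNIV and E="Collect closed" and A="\<lambda>_. UNIV"])
    show "Int_stable (Collect (closed :: (real \<times> real) set \<Rightarrow> bool))" by (auto simp: Int_stable_def)
    show "emeasure \<mu> S = emeasure \<nu> S" if "S \<in> Collect closed" for S
      using eq that \<mu>(1) \<nu>(1) by (simp add: finite_measure.emeasure_eq_measure)
    show "emeasure \<mu> UNIV \<noteq> \<infinity>" using \<mu>(1) by (simp add: finite_measure.emeasure_eq_measure)
  qed (use \<mu> \<nu> sb in auto)
qed

text \<open>The kernels have mass 1, so the time marginal of every element is Lebesgue measure on
  \<open>[0, T]\<close>. The uniform regularity in time used for compactness stems from
  this.\<close>

lemma MT_emeasure:
  assumes "\<nu> \<in> MT T" "S \<in> sets borel"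
  shows "emeasure \<nu> (S \<times> UNIV) = emeasure lborel (S \<inter> {0..T})"
proof -
  obtain K :: "real \<Rightarrow> real measure" where K: "\<And>t. prob_space (K t)" "\<And>t. sets (K t) = sets borel"
    and \<nu>: "\<And>S. S \<in> sets (borel :: (real \<times> real) measure) \<Longrightarrow>
       emeasure \<nu> S = (\<integral>\<^sup>+ t. indicator {0..T} t * emeasure (K t) (Pair t -` S) \<partial>lborel)"
    using assms(1) unfolding MT_def by blast
  have 1: "emeasure (K t) UNIV = 1" for t
    using prob_space.emeasure_space_1[OF K(1)[of t]] sets_eq_imp_space_eq[OF K(2)[of t]] by simp
  have S: "S \<times> UNIV \<in> sets (borel :: (real \<times> real) measure)"
    using assms(2) unfolding borel_prod[symmetric] by auto
  have "emeasure \<nu> (S \<times> UNIV) = (\<integral>\<^sup>+ t. indicator (S \<inter> {0..T}) t \<partial>lborel)"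
    unfolding \<nu>[OF S]
  proof (intro nn_integral_cong)
    fix t
    have "Pair t -` (S \<times> (UNIV :: real set)) = (if t \<in> S then UNIV else {})" by auto
    then show "indicator {0..T} t * emeasure (K t) (Pair t -` (S \<times> UNIV)) = indicator (S \<inter> {0..T}) t"
      by (simp add: 1 indicator_def)
  qed
  then show ?thesis using assms(2) by simp
qed

lemma MT_finite_measure:
  assumes "\<nu> \<in> MT T" shows "finite_measure \<nu>" "sets \<nu> = sets borel"
proof -
  show s: "sets \<nu> = sets borel" using assms by (simp add: MT_def)
  have "emeasure \<nu> (UNIV \<times> UNIV) = emeasure lborel {0..T}" using MT_emeasure[OF assms, of UNIV] by simp
  then show "finite_measure \<nu>"
    using sets_eq_imp_space_eq[OF s] by (intro finite_measureI) (auto simp: emeasure_lborel_Icc_eq)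
qed

section \<open>The uniform metric and the product metric\<close>

lemma rT_bdd:
  assumes "f \<in> CT T" "g \<in> CT T"
  shows "bdd_above ((\<lambda>t. \<bar>f t - g t\<bar>) ` {0..T})"
  using assms unfolding CT_def
  by (intro bounded_imp_bdd_above compact_imp_bounded compact_continuous_image continuous_intros) auto

lemma rT_upper:
  assumes "f \<in> CT T" "g \<in> CT T" "t \<in> {0..T}"
  shows "\<bar>f t - g t\<bar> \<le> rT T f g"
  unfolding rT_def by (rule cSUP_upper[OF assms(3) rT_bdd[OF assms(1,2)]])

lemma rT_least:
  assumes "T \<ge> 0" "\<And>t. t \<in> {0..T} \<Longrightarrow> \<bar>f t - g t\<bar> \<le> c"
  shows "rT T f g \<le> c"
  unfolding rT_def using assms by (intro cSUP_least) auto

lemma rT_commute: "rT T f g = rT T g f"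
  by (simp add: rT_def abs_minus_commute)

lemma rT_nonneg: "T \<ge> 0 \<Longrightarrow> f \<in> CT T \<Longrightarrow> g \<in> CT T \<Longrightarrow> 0 \<le> rT T f g"
  using rT_upper[of f T g 0] by fastforce

text \<open>The real supremum is a \<open>LEAST\<close>, hence a \<open>THE\<close>. An unbounded
  set has no upper bound, and for the empty set every number is an upper bound but none is least;
  both times \<open>THE\<close> is applied to the predicate that is nowhere true.\<close>

lemma Sup_real_unbounded:
  fixes X :: "real set"
  assumes "\<not> bdd_above X"
  shows "Sup X = Sup {}"
proof -
  have 1: "(\<forall>x\<in>X. x \<le> z) = False" for z using assms by (auto simp: bdd_above_def)
  have 2: "(\<forall>y. z \<le> y) = False" for z :: real using lt_ex[of z] by (auto simp: not_le)
  show ?thesis by (simp only: Sup_real_def Least_def 1 2 Set.ball_simps simp_thms)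
qed

text \<open>Outside \<open>CT T\<close> and \<open>MT T\<close> the supremum or the infimum may not exist; then they are
  \<open>Sup {}\<close> and \<open>- Sup {}\<close>, whose maximum is still nonnegative.\<close>
lemma prod_dist_nonneg:
  assumes "T \<ge> 0"
  shows "0 \<le> prod_dist T p q"
proof -
  have "0 \<le> rT T (fst p) (fst q) \<or> rT T (fst p) (fst q) = Sup {}"
  proof (cases "bdd_above ((\<lambda>t. \<bar>fst p t - fst q t\<bar>) ` {0..T})")
    case True
    then have "\<bar>fst p 0 - fst q 0\<bar> \<le> rT T (fst p) (fst q)"
      unfolding rT_def using assms by (intro cSUP_upper) auto
    then show ?thesis by linarith
  qed (simp add: rT_def Sup_real_unbounded)
  moreover have "0 \<le> levy_prokhorov (snd p) (snd q) \<or> levy_prokhorov (snd p) (snd q) = - Sup {}"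
  proof (cases "{\<delta>. lp_close \<delta> (snd p) (snd q)} = {}")
    case False
    then show ?thesis unfolding levy_prokhorov_eq
      by (intro disjI1 cInf_greatest) (auto simp: lp_close_def)
  qed (simp add: levy_prokhorov_eq Inf_real_def)
  ultimately show ?thesis unfolding prod_dist_def by linarith
qed

lemma Metric_space_prod_dist:
  assumes T: "T \<ge> 0"
  shows "Metric_space (CT T \<times> MT T) (prod_dist T)"
proof
  note fin = MT_finite_measure
  \<comment> \<open>The locale demands nonnegativity for all arguments, not only on the
    carrier.\<close>
  show "0 \<le> prod_dist T x y" for x y
    by (rule prod_dist_nonneg[OF T])
  show "prod_dist T x y = prod_dist T y x" for x y
    by (simp add: prod_dist_def rT_commute[of T "fst x"] levy_prokhorov_commute[of "snd x"])
  fix x y z assume x: "x \<in> CT T \<times> MT T" and y: "y \<in> CT T \<times> MT T"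
  then have m: "fst x \<in> CT T" "fst y \<in> CT T" "snd x \<in> MT T" "snd y \<in> MT T" by auto
  show "prod_dist T x y = 0 \<longleftrightarrow> x = y"
  proof
    assume "prod_dist T x y = 0"
    then have 0: "max (rT T (fst x) (fst y)) (levy_prokhorov (snd x) (snd y)) = 0"
      using x y by (simp add: prod_dist_def)
    then have r: "rT T (fst x) (fst y) = 0" and l: "levy_prokhorov (snd x) (snd y) = 0"
      using rT_nonneg[OF T m(1,2)] levy_prokhorov_nonneg[OF fin(1)[OF m(3)] fin(1)[OF m(4)]]
      by linarith+
    have "snd x = snd y" using m by (intro levy_prokhorov_eq_0_D fin l)
    \<comment> \<open>Functions in \<open>CT T\<close> take a fixed value outside
      \<open>[0, T]\<close>, so agreement on the interval is equality.\<close>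
    moreover have "fst x = fst y"
    proof (rule extensionalityI[of _ "{0..T}"])
      show "fst x t = fst y t" if "t \<in> {0..T}" for t
        using rT_upper[OF m(1,2) that] r by simp
    qed (use m in \<open>auto simp: CT_def\<close>)
    ultimately show "x = y" by (simp add: prod_eq_iff)
  next
    assume "x = y"
    have "rT T (fst x) (fst x) \<le> 0" by (intro rT_least T) simp
    then have "rT T (fst x) (fst x) = 0" using rT_nonneg[OF T m(1) m(1)] by linarith
    moreover have "levy_prokhorov (snd x) (snd x) \<le> 0"
    proof (rule field_le_epsilon)
      show "levy_prokhorov (snd x) (snd x) \<le> 0 + e" if "e > 0" for e
        using that m by (auto intro!: levy_prokhorov_le lp_close_refl fin)
    qed
    then have "levy_prokhorov (snd x) (snd x) = 0"
      using levy_prokhorov_nonneg[OF fin(1)[OF m(3)] fin(1)[OF m(3)]] by linarith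
    ultimately show "prod_dist T x y = 0" using \<open>x = y\<close> by (simp add: prod_dist_def)
  qed
  assume z: "z \<in> CT T \<times> MT T"
  then have mz: "fst z \<in> CT T" "snd z \<in> MT T" by auto
  have "rT T (fst x) (fst z) \<le> rT T (fst x) (fst y) + rT T (fst y) (fst z)"
  proof (rule rT_least[OF T])
    fix t assume t: "t \<in> {0..T}"
    show "\<bar>fst x t - fst z t\<bar> \<le> rT T (fst x) (fst y) + rT T (fst y) (fst z)"
      using rT_upper[OF m(1,2) t] rT_upper[OF m(2) mz(1) t] by linarith
  qed
  moreover have "levy_prokhorov (snd x) (snd z) \<le> levy_prokhorov (snd x) (snd y) + levy_prokhorov (snd y) (snd z)"
    using m mz by (intro levy_prokhorov_triangle fin)
  ultimately show "prod_dist T x z \<le> prod_dist T x y + prod_dist T y z"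
    using x y z by (auto simp: prod_dist_def)
qed

text \<open>In a metric space compactness is sequential; a subsequence along which the paths
  converge is thinned once more for the measures.\<close>

lemma compactin_CM_topology_Times:
  assumes T: "T \<ge> 0" and K1: "K1 \<subseteq> CT T" and K2: "K2 \<subseteq> MT T"
    and s1: "\<And>f :: nat \<Rightarrow> real \<Rightarrow> real. range f \<subseteq> K1 \<Longrightarrow> \<exists>g\<in>K1. \<exists>r. strict_mono r \<and> (\<lambda>n. rT T (f (r n)) g) \<longlonglongrightarrow> 0"
    and s2: "\<And>\<mu> :: nat \<Rightarrow> (real \<times> real) measure. range \<mu> \<subseteq> K2 \<Longrightarrow>
       \<exists>\<nu>\<in>K2. \<exists>r. strict_mono r \<and> (\<lambda>n. levy_prokhorov (\<mu> (r n)) \<nu>) \<longlonglongrightarrow> 0"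
  shows "compactin (CM_topology T) (K1 \<times> K2)"
proof -
  interpret Metric_space "CT T \<times> MT T" "prod_dist T" by (rule Metric_space_prod_dist[OF T])
  show ?thesis unfolding CM_topology_def compactin_sequentially
  proof (intro conjI allI impI)
    show "K1 \<times> K2 \<subseteq> CT T \<times> MT T" using K1 K2 by auto
    fix s :: "nat \<Rightarrow> (real \<Rightarrow> real) \<times> (real \<times> real) measure" assume s: "range s \<subseteq> K1 \<times> K2"
    then have "range (\<lambda>n. fst (s n)) \<subseteq> K1" by (auto simp: mem_Times_iff)
    from s1[OF this] obtain g r where g: "g \<in> K1" "strict_mono r" "(\<lambda>n. rT T (fst (s (r n))) g) \<longlonglongrightarrow> 0" by blast
    have "range (\<lambda>n. snd (s (r n))) \<subseteq> K2" using s by (fastforce simp: mem_Times_iff image_subset_iff)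
    from s2[OF this] obtain \<nu> q where \<nu>: "\<nu> \<in> K2" "strict_mono q" "(\<lambda>n. levy_prokhorov (snd (s (r (q n)))) \<nu>) \<longlonglongrightarrow> 0" by blast
    have "(\<lambda>n. rT T (fst (s (r (q n)))) g) \<longlonglongrightarrow> 0"
      using LIMSEQ_subseq_LIMSEQ[OF g(3) \<nu>(2)] by (simp add: o_def)
    from tendsto_max[OF this \<nu>(3)]
    have lim: "(\<lambda>n. prod_dist T (s (r (q n))) (g, \<nu>)) \<longlonglongrightarrow> 0" by (simp add: prod_dist_def)
    have "K1 \<times> K2 \<subseteq> CT T \<times> MT T" using K1 K2 by auto
    then have mem: "s n \<in> CT T \<times> MT T" "(g, \<nu>) \<in> CT T \<times> MT T" for n
      using s g(1) \<nu>(1) by blast+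
    have "limitin mtopology (s \<circ> (r \<circ> q)) (g, \<nu>) sequentially"
      unfolding limitin_metric
    proof (intro conjI allI impI mem)
      fix e :: real assume "e > 0"
      then have "\<forall>\<^sub>F n in sequentially. prod_dist T (s (r (q n))) (g, \<nu>) < e" by (intro order_tendstoD(2)[OF lim])
      then show "\<forall>\<^sub>F n in sequentially. (s \<circ> (r \<circ> q)) n \<in> CT T \<times> MT T \<and> prod_dist T ((s \<circ> (r \<circ> q)) n) (g, \<nu>) < e"
        by eventually_elim (use mem in simp)
    qed
    moreover have "strict_mono (r \<circ> q)" using g(2) \<nu>(2) by (rule strict_mono_o)
    ultimately show "\<exists>l r. l \<in> K1 \<times> K2 \<and> strict_mono r \<and> limitin mtopology (s \<circ> r) l sequentially"
      using g(1) \<nu>(1) by blast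
  qed
qed

text \<open>Arzela-Ascoli: a diagonal subsequence converges at all dyadic points, and the common
  modulus reduces uniform closeness to the finitely many points of one scale.\<close>

lemma equicontinuous_uniform_limit_subsequence:
  fixes f :: "nat \<Rightarrow> real \<Rightarrow> real"
  assumes T: "T > 0" and w: "w \<longlonglongrightarrow> (0::real)"
    and mod: "\<And>n m s t. 0 \<le> s \<Longrightarrow> 0 \<le> t \<Longrightarrow> s \<le> T \<Longrightarrow> t \<le> T \<Longrightarrow> \<bar>t - s\<bar> \<le> T / 2^m \<Longrightarrow>
      \<bar>f n t - f n s\<bar> \<le> w m"
    and bnd: "\<And>n t. t \<in> {0..T} \<Longrightarrow> \<bar>f n t\<bar> \<le> b"
  shows "\<exists>r g. strict_mono (r :: nat \<Rightarrow> nat) \<and> uniform_limit {0..T} (\<lambda>n. f (r n)) g sequentially"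
proof -
  \<comment> \<open>The minimum with \<open>T\<close> keeps the point in the interval for every pair
    of indices.\<close>
  define p where "p j = min T (real (snd j) * (T / 2^fst j))" for j :: "nat \<times> nat"
  have p: "p j \<in> {0..T}" for j using T by (simp add: p_def)
  obtain r where r: "strict_mono (r :: nat \<Rightarrow> nat)" and conv: "\<And>j. convergent (\<lambda>n. f (r n) (p j))"
    using convergent_subsequence_countable[of "\<lambda>n j. f n (p j)", OF bnd[OF p]] by blast
  have "uniformly_Cauchy_on {0..T} (\<lambda>n. f (r n))"
  proof (rule uniformly_Cauchy_onI)
    fix e :: real assume e: "e > 0"
    have "\<forall>\<^sub>F m in sequentially. w m < e / 3" using e by (intro order_tendstoD(2)[OF w]) auto
    then obtain m where m: "w m < e / 3" by (auto simp: eventually_sequentially)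
    have "\<exists>N. \<forall>k\<ge>N. \<forall>n\<ge>N. dist (f (r k) (p (m, i))) (f (r n) (p (m, i))) < e / 3" for i
      using e by (intro metric_CauchyD convergent_Cauchy conv) simp
    then obtain N where N: "\<And>i k n. N i \<le> k \<Longrightarrow> N i \<le> n \<Longrightarrow> dist (f (r k) (p (m, i))) (f (r n) (p (m, i))) < e / 3"
      by metis
    show "\<exists>N. \<forall>t\<in>{0..T}. \<forall>k\<ge>N. \<forall>n\<ge>N. dist (f (r k) t) (f (r n) t) < e"
    proof (intro exI[of _ "Max (N ` {..2^m})"] ballI allI impI)
      fix t k n assume t: "t \<in> {0..T}" and k: "Max (N ` {..2^m}) \<le> k" and n: "Max (N ` {..2^m}) \<le> n"
      define i where "i = nat \<lfloor>t * 2^m / T\<rfloor>"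
      have x: "0 \<le> t * 2^m / T" "t * 2^m / T \<le> 2^m" using t T by (auto simp: field_simps)
      have fl: "real i \<le> t * 2^m / T" "t * 2^m / T < real i + 1" using x unfolding i_def by linarith+
      then have "real i \<le> 2^m" using x by linarith
      then have "real i \<le> real (2^m)" by (simp only: of_nat_power of_nat_numeral)
      then have "i \<le> 2^m" by (simp only: of_nat_le_iff)
      then have Ni: "N i \<le> k" "N i \<le> n" using k n Max_ge[of "N ` {..2^m}" "N i"] by auto
      have "real i * (T / 2^m) \<le> t" "t \<le> real i * (T / 2^m) + T / 2^m" using fl T by (auto simp: field_simps)
      then have "\<bar>t - p (m, i)\<bar> \<le> T / 2^m" using t by (auto simp: p_def)
      then have "\<bar>f n t - f n (p (m, i))\<bar> < e / 3" for n
        using mod[of "p (m, i)" t m n] p[of "(m, i)"] t m by auto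
      then have "\<bar>f (r k) t - f (r k) (p (m, i))\<bar> < e / 3" "\<bar>f (r n) t - f (r n) (p (m, i))\<bar> < e / 3" by blast+
      then show "dist (f (r k) t) (f (r n) t) < e"
        using N[OF Ni] unfolding dist_real_def by linarith
    qed
  qed
  then show ?thesis
    using Cauchy_uniformly_convergent r unfolding uniformly_convergent_on_def by blast
qed

lemma dyadic_increments_limit:
  assumes T: "T > 0" and f: "\<And>n. dyadic_increments T T c (f n)"
    and lim: "\<And>t. t \<in> {0..T} \<Longrightarrow> (\<lambda>n. f n t) \<longlonglongrightarrow> h t"
  shows "dyadic_increments T T c h"
  unfolding dyadic_increments_def
proof (intro allI impI)
  fix m i assume i: "real (Suc i) * (T / 2^m) \<le> T"
  have d: "0 \<le> T / 2^m" by (rule divide_nonneg_pos[OF less_imp_le[OF T]]) (rule zero_less_power, rule zero_less_numeral)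
  have t: "real (Suc i) * (T / 2^m) \<in> {0..T}"
    unfolding atLeastAtMost_iff using i mult_nonneg_nonneg[OF of_nat_0_le_iff d] by blast
  have "real i * (T / 2^m) \<le> real (Suc i) * (T / 2^m)"
    by (rule mult_right_mono[OF _ d]) (unfold of_nat_le_iff, rule le_SucI[OF order_refl])
  then have s: "real i * (T / 2^m) \<in> {0..T}"
    unfolding atLeastAtMost_iff using i mult_nonneg_nonneg[OF of_nat_0_le_iff d] order_trans by blast
  have "\<bar>f n (real (Suc i) * (T / 2^m)) - f n (real i * (T / 2^m))\<bar> \<le> c * (3/4)^m" for n
    using f[of n] i unfolding dyadic_increments_def by blast
  then show "\<bar>h (real (Suc i) * (T / 2^m)) - h (real i * (T / 2^m))\<bar> \<le> c * (3/4)^m"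
    by (intro LIMSEQ_le_const2[OF tendsto_rabs[OF tendsto_diff[OF lim[OF t] lim[OF s]]]]) blast
qed

lemma rT_tendsto_0:
  assumes T: "T \<ge> 0" and f: "\<And>n. f n \<in> CT T" and g: "restrict g {0..T} \<in> CT T"
    and ul: "uniform_limit {0..T} f g sequentially"
  shows "(\<lambda>n. rT T (f n) (restrict g {0..T})) \<longlonglongrightarrow> 0"
proof (rule tendstoI)
  fix e :: real assume e: "e > 0"
  then have "\<forall>\<^sub>F n in sequentially. \<forall>t\<in>{0..T}. dist (f n t) (g t) < e / 2"
    by (intro uniform_limitD[OF ul]) simp
  then show "\<forall>\<^sub>F n in sequentially. dist (rT T (f n) (restrict g {0..T})) 0 < e"
  proof eventually_elim
    case (elim n)
    have "rT T (f n) (restrict g {0..T}) \<le> e / 2"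
    proof (rule rT_least[OF T])
      fix t assume t: "t \<in> {0..T}"
      show "\<bar>f n t - restrict g {0..T} t\<bar> \<le> e / 2" using bspec[OF elim t] t by (simp add: dist_real_def)
    qed
    moreover have "0 \<le> rT T (f n) (restrict g {0..T})" by (rule rT_nonneg[OF T f g])
    ultimately show ?case using e by (simp add: dist_real_def)
  qed
qed

text \<open>The chaining modulus supplies equicontinuity and, with the fixed value at 0, a uniform
  bound; the defining conditions are closed under pointwise limits.\<close>

lemma dyadic_increments_sequentially_compact:
  fixes f :: "nat \<Rightarrow> real \<Rightarrow> real" and x0 :: real
  assumes T: "T > 0" and c: "c \<ge> 0"
    and f: "range f \<subseteq> {f\<in>CT T. f 0 = x0 \<and> dyadic_increments T T c f}"
  shows "\<exists>g\<in>{f\<in>CT T. f 0 = x0 \<and> dyadic_increments T T c f}.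
    \<exists>r. strict_mono r \<and> (\<lambda>n. rT T (f (r n)) g) \<longlonglongrightarrow> 0"
proof -
  have fK: "f n \<in> CT T" "f n 0 = x0" "dyadic_increments T T c (f n)" for n
    using f by auto
  have cont: "continuous_on {0..T} (f n)" for n using fK(1)[of n] by (simp add: CT_def)
  have mod: "\<bar>f n t - f n s\<bar> \<le> 7 * c * (3/4)^m"
    if "0 \<le> s" "0 \<le> t" "s \<le> T" "t \<le> T" "\<bar>t - s\<bar> \<le> T / 2^m" for n m s t
    using dyadic_increments_imp_modulus[OF T cont fK(3) c, of s t m n]
      dyadic_increments_imp_modulus[OF T cont fK(3) c, of t s m n] that
    by (cases "s \<le> t") (auto simp: abs_minus_commute)
  have bnd: "\<bar>f n t\<bar> \<le> \<bar>x0\<bar> + 7 * c" if "t \<in> {0..T}" for n t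
    using mod[of 0 t 0 n] that fK(2)[of n] by auto
  have "(\<lambda>m. 7 * c * (3/4::real)^m) \<longlonglongrightarrow> 7 * c * 0" by (intro tendsto_intros LIMSEQ_realpow_zero) auto
  then have w: "(\<lambda>m. 7 * c * (3/4::real)^m) \<longlonglongrightarrow> 0" by simp
  obtain r g where r: "strict_mono (r :: nat \<Rightarrow> nat)" and ul: "uniform_limit {0..T} (\<lambda>n. f (r n)) g sequentially"
    using equicontinuous_uniform_limit_subsequence[of T "\<lambda>m. 7 * c * (3/4)^m" f "\<bar>x0\<bar> + 7 * c", OF T w mod bnd] by blast
  have pt: "(\<lambda>n. f (r n) t) \<longlonglongrightarrow> restrict g {0..T} t" if t: "t \<in> {0..T}" for t
    using tendsto_uniform_limitI[OF ul t] t by simp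
  have "continuous_on {0..T} g"
    by (rule uniform_limit_theorem[OF _ ul]) (simp_all add: cont)
  then have "continuous_on {0..T} (restrict g {0..T})"
    using continuous_on_cong[of "{0..T}" "{0..T}" "restrict g {0..T}" g] by simp
  then have g: "restrict g {0..T} \<in> CT T" by (simp add: CT_def)
  have "restrict g {0..T} 0 = x0"
  proof (rule LIMSEQ_unique)
    show "(\<lambda>n. f (r n) 0) \<longlonglongrightarrow> restrict g {0..T} 0" using pt[of 0] T by simp
    show "(\<lambda>n. f (r n) 0) \<longlonglongrightarrow> x0" by (simp only: fK(2) tendsto_const)
  qed
  moreover have "dyadic_increments T T c (restrict g {0..T})"
    by (rule dyadic_increments_limit[OF T fK(3) pt])
  moreover have "(\<lambda>n. rT T (f (r n)) (restrict g {0..T})) \<longlonglongrightarrow> 0"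
    by (rule rT_tendsto_0[OF _ fK(1) g ul]) (use T in simp)
  ultimately show ?thesis using g r by blast
qed

section \<open>Measures with Lebesgue marginal as kernels\<close>

text \<open>The measures of \<open>F\<close> and \<open>D\<close> add up to the measure of the sum,
  because they do so on half-open intervals. Distribution functions with an increasing difference
  thus give ordered measures.\<close>

lemma interval_measure_add_le:
  fixes F D :: "real \<Rightarrow> real"
  assumes F: "\<And>x y. x \<le> y \<Longrightarrow> F x \<le> F y" "\<And>a. continuous (at_right a) F"
    and D: "\<And>x y. x \<le> y \<Longrightarrow> D x \<le> D y" "\<And>a. continuous (at_right a) D"
    and A: "A \<in> sets borel"
  shows "emeasure (interval_measure F) A \<le> emeasure (interval_measure (\<lambda>x. F x + D x)) A"
proof -
  let ?m = "\<lambda>A. emeasure (interval_measure F) A + emeasure (interval_measure D) A"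
  define N where "N = measure_of UNIV (sets (borel :: real measure)) ?m"
  have sets_N: "sets N = sets borel" by (simp add: N_def sets.sigma_sets_eq[of borel, simplified])
  have em: "emeasure N A = ?m A" if "A \<in> sets borel" for A
    unfolding N_def
  proof (rule emeasure_measure_of_sigma[OF _ _ _ that])
    show "sigma_algebra UNIV (sets (borel :: real measure))" using sets.sigma_algebra_axioms[of borel] by simp
    show "positive (sets borel) ?m" by (simp add: positive_def)
    show "countably_additive (sets borel) ?m"
    proof (rule countably_additiveI)
      fix B :: "nat \<Rightarrow> real set" assume B: "range B \<subseteq> sets borel" "disjoint_family B" "(\<Union>i. B i) \<in> sets borel"
      have "(\<Sum>i. ?m (B i)) = (\<Sum>i. emeasure (interval_measure F) (B i)) + (\<Sum>i. emeasure (interval_measure D) (B i))"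
        by (rule suminf_add[symmetric]) auto
      also have "\<dots> = ?m (\<Union>i. B i)"
        using B by (subst (1 2) suminf_emeasure) auto
      finally show "(\<Sum>i. ?m (B i)) = ?m (\<Union>i. B i)" .
    qed
  qed
  have FD: "x \<le> y \<Longrightarrow> F x + D x \<le> F y + D y" "continuous (at_right a) (\<lambda>x. F x + D x)" for x y a
    using F D by (auto intro: add_mono continuous_intros)
  have "N = interval_measure (\<lambda>x. F x + D x)"
  proof (rule measure_eqI_generator_eq[where \<Omega>=UNIV and E="range (\<lambda>(a, b). {a<..b::real})" and A="\<lambda>i::nat. {- real i<..real i}"])
    show "Int_stable (range (\<lambda>(a, b). {a<..b::real}))"
    proof (rule Int_stableI)
      fix X Y assume "X \<in> range (\<lambda>(a, b). {a<..b::real})" "Y \<in> range (\<lambda>(a, b). {a<..b::real})"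
      then obtain a b c d where "X = {a<..b}" "Y = {c<..d}" by auto
      then have "X \<inter> Y = (\<lambda>(a, b). {a<..b}) (max a c, min b d)" by auto
      then show "X \<inter> Y \<in> range (\<lambda>(a, b). {a<..b})" by blast
    qed
    show "emeasure N X = emeasure (interval_measure (\<lambda>x. F x + D x)) X" if "X \<in> range (\<lambda>(a, b). {a<..b::real})" for X
    proof -
      obtain a b where X: "X = {a<..b}" using \<open>X \<in> _\<close> by auto
      have "emeasure N X = ?m X" by (rule em) (simp add: X)
      also have "\<dots> = emeasure (interval_measure (\<lambda>x. F x + D x)) X"
        unfolding X using F D FD
        by (subst (1 2 3) emeasure_interval_measure_Ioc_eq) (auto simp: ennreal_plus[symmetric] simp del: ennreal_plus)
      finally show ?thesis .
    qed
    show "sets N = sigma_sets UNIV (range (\<lambda>(a, b). {a<..b}))"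
      "sets (interval_measure (\<lambda>x. F x + D x)) = sigma_sets UNIV (range (\<lambda>(a, b). {a<..b}))"
      by (simp_all add: sets_N borel_sigma_sets_Ioc)
    show "(\<Union>i. {- real i<..real i}) = UNIV"
    proof (rule UNIV_eq_I[symmetric])
      fix x :: real
      obtain n :: nat where "\<bar>x\<bar> < real n" using reals_Archimedean2 by blast
      then show "x \<in> (\<Union>i. {- real i<..real i})" by (intro UN_I[of n]) auto
    qed
    show "emeasure N {- real i<..real i} \<noteq> \<infinity>" for i
      using F D by (subst em) (auto simp: emeasure_interval_measure_Ioc_eq)
  qed auto
  then have "emeasure (interval_measure (\<lambda>x. F x + D x)) A = ?m A" using em[OF A] by simp
  then show ?thesis by simp
qed

text \<open>On the part of a bounded interval where \<open>g < f\<close>, both integrals are finite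
  and may be subtracted; the difference is positive there and integrates to 0.\<close>

lemma AE_lborel_le_of_set_integrals:
  fixes f g :: "real \<Rightarrow> ennreal"
  assumes [measurable]: "f \<in> borel_measurable lborel" "g \<in> borel_measurable lborel"
    and le: "\<And>A. A \<in> sets borel \<Longrightarrow> (\<integral>\<^sup>+x. f x * indicator A x \<partial>lborel) \<le> (\<integral>\<^sup>+x. g x * indicator A x \<partial>lborel)"
    and fin: "\<And>k::nat. (\<integral>\<^sup>+x. g x * indicator {- real k..real k} x \<partial>lborel) < \<infinity>"
  shows "AE x in lborel. f x \<le> g x"
proof -
  have "AE x in lborel. x \<in> {- real k..real k} \<longrightarrow> f x \<le> g x" for k :: nat
  proof -
    define A where "A = {x \<in> {- real k..real k}. g x < f x}"
    have [measurable]: "A \<in> sets borel" unfolding A_def by measurable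
    let ?f = "\<lambda>x. f x * indicator A x" and ?g = "\<lambda>x. g x * indicator A x"
    have "integral\<^sup>N lborel ?g \<le> (\<integral>\<^sup>+x. g x * indicator {- real k..real k} x \<partial>lborel)"
      by (intro nn_integral_mono) (auto simp: A_def split: split_indicator)
    then have g: "integral\<^sup>N lborel ?g < \<infinity>" using fin[of k] by (rule le_less_trans)
    have "(\<integral>\<^sup>+x. ?f x - ?g x \<partial>lborel) = integral\<^sup>N lborel ?f - integral\<^sup>N lborel ?g"
      using g by (intro nn_integral_diff) (auto simp: A_def less_imp_le split: split_indicator)
    also have "\<dots> = 0" using le[of A] le_less_trans[OF le[of A] g] by (simp add: diff_eq_0_iff_ennreal)
    finally have "AE x in lborel. ?f x - ?g x = 0" by (subst (asm) nn_integral_0_iff_AE) auto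
    then show ?thesis
    proof eventually_elim
      case (elim x)
      show ?case
      proof (intro impI, rule ccontr)
        assume "x \<in> {- real k..real k}" "\<not> f x \<le> g x"
        then have "x \<in> A" "g x < f x" by (auto simp: A_def not_le)
        then show False using elim by (auto simp: diff_eq_0_iff_ennreal)
      qed
    qed
  qed
  then have "AE x in lborel. \<forall>k::nat. x \<in> {- real k..real k} \<longrightarrow> f x \<le> g x"
    unfolding AE_all_countable by (rule allI)
  then show ?thesis
  proof eventually_elim
    case (elim x)
    obtain n :: nat where "\<bar>x\<bar> < real n" using reals_Archimedean2 by blast
    then have "x \<in> {- real n..real n}" by auto
    then show ?case using elim by blast
  qed
qed

text \<open>The data \<open>a\<close> are the values at rational points of a distribution function; its
  right-continuous version is used as the kernel.\<close>
lemma distribution_function_of_rational_values: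
  fixes a :: "rat \<Rightarrow> real"
  assumes mono: "\<And>q q'. q \<le> q' \<Longrightarrow> a q \<le> a q'" and a01: "\<And>q. 0 \<le> a q" "\<And>q. a q \<le> 1"
    and sup: "\<And>e. e > 0 \<Longrightarrow> \<exists>q. a q > 1 - e" and inf: "\<And>e. e > 0 \<Longrightarrow> \<exists>q. a q < e"
  defines "H \<equiv> \<lambda>x::real. INF q\<in>{q. x < real_of_rat q}. a q"
  shows "\<And>x y. x \<le> y \<Longrightarrow> H x \<le> H y" and "\<And>x. continuous (at_right x) H"
    and "(H \<longlongrightarrow> 0) at_bot" and "(H \<longlongrightarrow> 1) at_top"
    and "\<And>x q. x < real_of_rat q \<Longrightarrow> H x \<le> a q" and "\<And>x q. real_of_rat q \<le> x \<Longrightarrow> a q \<le> H x"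
proof -
  have ne: "{q. x < real_of_rat q} \<noteq> {}" for x
    using of_rat_dense[of x "x + 1"] by auto
  have bdd: "bdd_below (a ` X)" for X using a01 by (auto intro: bdd_belowI[of _ 0])
  show up: "H x \<le> a q" if "x < real_of_rat q" for x q
    unfolding H_def using that by (intro cINF_lower bdd) auto
  have least: "c \<le> H x" if "\<And>q. x < real_of_rat q \<Longrightarrow> c \<le> a q" for c x
    unfolding H_def using that by (intro cINF_greatest ne) auto
  show low: "a q \<le> H x" if "real_of_rat q \<le> x" for x q
  proof (rule least)
    fix q' assume "x < real_of_rat q'"
    then have "real_of_rat q < real_of_rat q'" using that by linarith
    then show "a q \<le> a q'" by (intro mono) (simp add: of_rat_less)
  qed
  show monoH: "H x \<le> H y" if "x \<le> y" for x y
    using that by (intro least up) auto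
  have H0: "0 \<le> H x" for x by (intro least a01)
  have H1: "H x \<le> 1" for x
  proof -
    obtain q where "x < real_of_rat q" using ne[of x] by auto
    then show ?thesis using up[of x q] a01(2)[of q] by linarith
  qed
  show "continuous (at_right x) H" for x
    unfolding continuous_within
  proof (rule order_tendstoI)
    fix c assume c: "c < H x"
    show "\<forall>\<^sub>F y in at_right x. c < H y"
      using eventually_at_right_less[of x]
    proof eventually_elim
      case (elim y)
      then show ?case using monoH[of x y] c by linarith
    qed
  next
    fix c assume c: "H x < c"
    obtain q where q: "x < real_of_rat q" "a q < c"
    proof (rule ccontr)
      assume "\<not> thesis"
      then have "c \<le> H x" using that by (intro least) (meson not_le)
      then show False using c by simp
    qed
    show "\<forall>\<^sub>F y in at_right x. H y < c"
      using eventually_at_right_less eventually_at_right_real[OF q(1)]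
    proof eventually_elim
      case (elim y)
      then show ?case using up[of y q] q(2) by auto
    qed
  qed
  show "(H \<longlongrightarrow> 0) at_bot"
  proof (rule order_tendstoI)
    fix c :: real assume "c < 0"
    then show "\<forall>\<^sub>F x in at_bot. c < H x" using H0 by (intro always_eventually) (auto intro: less_le_trans)
  next
    fix c :: real assume "0 < c"
    then obtain q where q: "a q < c" using inf by blast
    show "\<forall>\<^sub>F x in at_bot. H x < c"
    proof -
      have "\<forall>\<^sub>F x in at_bot. x < real_of_rat q" by (rule eventually_gt_at_bot)
      then show ?thesis by eventually_elim (rule le_less_trans[OF up q])
    qed
  qed
  show "(H \<longlongrightarrow> 1) at_top"
  proof (rule order_tendstoI)
    fix c :: real assume "c > 1"
    then show "\<forall>\<^sub>F x in at_top. H x < c" using H1 by (intro always_eventually) (auto intro: le_less_trans)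
  next
    fix c :: real assume "c < 1"
    then obtain q where q: "a q > c" using sup[of "1 - c"] by auto
    have "\<forall>\<^sub>F x in at_top. real_of_rat q \<le> x" by (rule eventually_ge_at_top)
    then show "\<forall>\<^sub>F x in at_top. c < H x" by eventually_elim (rule less_le_trans[OF q low])
  qed
qed

text \<open>A disintegration by hand. For fixed \<open>q\<close> the function \<open>g t q\<close>
  of \<open>t\<close> generates a measure below Lebesgue measure, and its density at
  \<open>t\<close> must be the mass that the kernel gives to the half-line up to \<open>q\<close>.
  Making the kernel right-continuous may alter the value at \<open>q\<close> itself, so the
  conclusion sandwiches instead of asserting equality.\<close>

lemma lipschitz_distribution_imp_MT:
  fixes g :: "real \<Rightarrow> rat \<Rightarrow> real"
  assumes T: "T > 0" and g0: "\<And>q. g 0 q = 0"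
    and incr: "\<And>s t q. s \<le> t \<Longrightarrow> g s q \<le> g t q" and lip: "\<And>s t q. s \<le> t \<Longrightarrow> g t q - g s q \<le> t - s"
    and mono: "\<And>s t q q'. s \<le> t \<Longrightarrow> q \<le> q' \<Longrightarrow> g t q - g s q \<le> g t q' - g s q'"
    and top: "\<And>e. e > 0 \<Longrightarrow> \<exists>q. g T q > T - e" and bot: "\<And>e. e > 0 \<Longrightarrow> \<exists>q. g T q < e"
  shows "\<exists>\<nu>\<in>MT T. \<forall>t\<in>{0..T}. \<forall>q x. (real_of_rat q \<le> x \<longrightarrow> g t q \<le> measure \<nu> ({..t} \<times> {..x})) \<and>
     (x < real_of_rat q \<longrightarrow> measure \<nu> ({..t} \<times> {..x}) \<le> g t q)"
proof -
  have cont: "continuous (at_right x) (\<lambda>t. g t q)" and contD: "continuous (at_right x) (\<lambda>t. t - g t q)" for x q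
  proof -
    have "continuous_on UNIV (\<lambda>t. g t q)"
    proof (rule continuous_onI)
      fix x e :: real assume "e > 0"
      have "dist (g y q) (g x q) \<le> dist y x" for y
        using lip[of x y q] lip[of y x q] incr[of x y q] incr[of y x q] by (cases "x \<le> y") (auto simp: dist_real_def)
      then show "\<exists>d>0. \<forall>y\<in>UNIV. dist y x < d \<longrightarrow> dist (g y q) (g x q) \<le> e"
        using \<open>e > 0\<close> by (intro exI[of _ e]) (auto intro: order_trans less_imp_le)
    qed
    then have "isCont (\<lambda>t. g t q) x" by (simp add: continuous_on_eq_continuous_at)
    then show "continuous (at_right x) (\<lambda>t. g t q)" by (rule continuous_at_imp_continuous_at_within)
    then show "continuous (at_right x) (\<lambda>t. t - g t q)" by (intro continuous_intros)
  qed
  define m where "m q = interval_measure (\<lambda>t. g t q)" for q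
  have m_sets[simp, measurable_cong]: "sets (m q) = sets borel" for q by (simp add: m_def)
  have m_Ioc: "emeasure (m q) {s<..t} = g t q - g s q" if "s \<le> t" for s t q
    unfolding m_def using that incr cont by (intro emeasure_interval_measure_Ioc) auto
  \<comment> \<open>The remainder \<open>t - g t q\<close> is increasing because of
    \<open>lip\<close>.\<close>
  have m_lborel: "emeasure (m q) A \<le> emeasure lborel A" if "A \<in> sets borel" for A q
  proof -
    have "emeasure (interval_measure (\<lambda>t. g t q)) A \<le> emeasure (interval_measure (\<lambda>t. g t q + (t - g t q))) A"
    proof (rule interval_measure_add_le)
      show "x - g x q \<le> y - g y q" if "x \<le> y" for x y using lip[OF that, of q] by simp
    qed (use incr cont contD that in auto)
    then show ?thesis by (simp add: m_def lborel_eq_real)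
  qed
  have m_mono: "emeasure (m q) A \<le> emeasure (m q') A" if "A \<in> sets borel" "q \<le> q'" for A q q'
  proof -
    have "emeasure (interval_measure (\<lambda>t. g t q)) A \<le> emeasure (interval_measure (\<lambda>t. g t q + (g t q' - g t q))) A"
    proof (rule interval_measure_add_le)
      show "g x q' - g x q \<le> g y q' - g y q" if "x \<le> y" for x y using mono[OF that \<open>q \<le> q'\<close>] by simp
      show "continuous (at_right x) (\<lambda>t. g t q' - g t q)" for x using cont by (intro continuous_intros)
    qed (use incr cont that in auto)
    then show ?thesis by (simp add: m_def)
  qed
  define h where "h q = RN_deriv lborel (m q)" for q
  have h[measurable]: "h q \<in> borel_measurable lborel" for q by (simp add: h_def)
  have dens: "density lborel (h q) = m q" for q
    unfolding h_def
  proof (rule sigma_finite_measure.density_RN_deriv[OF sigma_finite_lborel])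
    show "absolutely_continuous lborel (m q)"
      unfolding absolutely_continuous_def
    proof (rule subsetI)
      fix A :: "real set" assume "A \<in> null_sets lborel"
      then have "A \<in> sets borel" "emeasure lborel A = 0" by (auto simp: null_sets_def)
      then show "A \<in> null_sets (m q)" using m_lborel[of A q] by (simp add: null_sets_def)
    qed
  qed simp
  have int_h: "(\<integral>\<^sup>+x. h q x * indicator A x \<partial>lborel) = emeasure (m q) A" if "A \<in> sets borel" for q A
    using that by (subst dens[symmetric], subst emeasure_density) auto
  have le1: "AE t in lborel. h q t \<le> 1" for q
  proof (rule AE_lborel_le_of_set_integrals)
    show "(\<integral>\<^sup>+x. h q x * indicator A x \<partial>lborel) \<le> (\<integral>\<^sup>+x. 1 * indicator A x \<partial>lborel)" if "A \<in> sets borel" for A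
      using that m_lborel[of A q] by (simp add: int_h)
    show "(\<integral>\<^sup>+x. 1 * indicator {- real k..real k} x \<partial>lborel) < \<infinity>" for k by (simp add: emeasure_lborel_Icc_eq)
  qed auto
  have hmono: "AE t in lborel. h q t \<le> h q' t" if "q \<le> q'" for q q'
  proof (rule AE_lborel_le_of_set_integrals)
    show "(\<integral>\<^sup>+x. h q x * indicator A x \<partial>lborel) \<le> (\<integral>\<^sup>+x. h q' x * indicator A x \<partial>lborel)" if "A \<in> sets borel" for A
      using that m_mono[of A q q'] \<open>q \<le> q'\<close> by (simp add: int_h)
    have "emeasure (m q') {- real k..real k} \<le> emeasure lborel {- real k..real k}" for k by (rule m_lborel) simp
    then show "(\<integral>\<^sup>+x. h q' x * indicator {- real k..real k} x \<partial>lborel) < \<infinity>" for k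
      by (simp add: int_h emeasure_lborel_Icc_eq) (meson ennreal_less_top le_less_trans)
  qed auto
  have int_T: "(\<integral>\<^sup>+x. h q x * indicator {0<..t} x \<partial>lborel) = ennreal (g t q)" if "0 \<le> t" for q t
    using that by (simp add: int_h m_Ioc g0)
  \<comment> \<open>The truncated supremum \<open>S\<close> is at most 1 and its integral over
    \<open>(0, T]\<close> is at least \<open>T - e\<close> for each positive \<open>e\<close>, so it
    is 1 almost everywhere: no mass escapes to plus infinity.\<close>
  have supAE: "AE t in lborel. t \<in> {0<..T} \<longrightarrow> (SUP q. h q t) \<ge> 1"
  proof -
    define S where "S t = min 1 (SUP q. h q t)" for t
    have [measurable]: "S \<in> borel_measurable lborel" unfolding S_def by measurable
    have "ennreal (T - e) \<le> (\<integral>\<^sup>+t. S t * indicator {0<..T} t \<partial>lborel)" if e: "e > 0" for e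
    proof -
      obtain q where q: "g T q > T - e" using top[OF e] by blast
      have "ennreal (T - e) \<le> ennreal (g T q)" using q by (intro ennreal_leI) simp
      also have "\<dots> = (\<integral>\<^sup>+x. h q x * indicator {0<..T} x \<partial>lborel)" using T by (simp add: int_T)
      also have "\<dots> \<le> (\<integral>\<^sup>+t. S t * indicator {0<..T} t \<partial>lborel)"
        using le1[of q] by (intro nn_integral_mono_AE, eventually_elim)
          (auto simp: S_def split: split_indicator intro: SUP_upper)
      finally show ?thesis .
    qed
    then have ge: "ennreal T \<le> (\<integral>\<^sup>+t. S t * indicator {0<..T} t \<partial>lborel)"
    proof -
      assume *: "\<And>e. 0 < e \<Longrightarrow> ennreal (T - e) \<le> (\<integral>\<^sup>+t. S t * indicator {0<..T} t \<partial>lborel)"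
      have "(\<lambda>n. ennreal (T - inverse (real (Suc n)))) \<longlonglongrightarrow> ennreal (T - 0)"
        by (intro tendsto_ennrealI tendsto_diff tendsto_const LIMSEQ_inverse_real_of_nat)
      then show ?thesis by (intro LIMSEQ_le_const2[where a="\<integral>\<^sup>+t. S t * indicator {0<..T} t \<partial>lborel"]) (auto intro!: *)
    qed
    have iT: "(\<integral>\<^sup>+t. indicator {0<..T} t \<partial>lborel) = ennreal T" using T by simp
    have fin: "(\<integral>\<^sup>+t. S t * indicator {0<..T} t \<partial>lborel) \<le> ennreal T"
      unfolding iT[symmetric] by (intro nn_integral_mono) (auto simp: S_def split: split_indicator)
    have "(\<integral>\<^sup>+t. indicator {0<..T} t - S t * indicator {0<..T} t \<partial>lborel) = (\<integral>\<^sup>+t. indicator {0<..T} t \<partial>lborel) - (\<integral>\<^sup>+t. S t * indicator {0<..T} t \<partial>lborel)"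
      using fin by (intro nn_integral_diff) (auto simp: S_def top_unique split: split_indicator)
    also have "\<dots> = 0" unfolding iT using ge by (simp add: diff_eq_0_iff_ennreal)
    finally have "AE t in lborel. indicator {0<..T} t - S t * indicator {0<..T} t = 0"
      by (subst (asm) nn_integral_0_iff_AE) auto
    then show ?thesis
      by eventually_elim (auto simp: S_def diff_eq_0_iff_ennreal split: split_indicator)
  qed
  \<comment> \<open>Correspondingly, no mass escapes to minus infinity.\<close>
  have infAE: "AE t in lborel. t \<in> {0<..T} \<longrightarrow> (INF q. h q t) = 0"
  proof -
    let ?I = "\<integral>\<^sup>+t. (INF q. h q t) * indicator {0<..T} t \<partial>lborel"
    have "?I \<le> ennreal e" if e: "e > 0" for e
    proof -
      obtain q where q: "g T q < e" using bot[OF e] by blast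
      have "?I \<le> (\<integral>\<^sup>+x. h q x * indicator {0<..T} x \<partial>lborel)"
        by (intro nn_integral_mono) (auto split: split_indicator intro: INF_lower)
      also have "\<dots> = ennreal (g T q)" using T by (simp add: int_T)
      also have "\<dots> \<le> ennreal e" using q by (intro ennreal_leI) simp
      finally show ?thesis .
    qed
    then have "?I \<le> 0" using ennreal_le_epsilon[of 0 ?I] by (simp only: add_0)
    then have "?I = 0" by simp
    then have "AE t in lborel. (INF q. h q t) * indicator {0<..T} t = 0"
      by (subst nn_integral_0_iff_AE[symmetric]) auto
    then show ?thesis by eventually_elim (auto split: split_indicator)
  qed
  \<comment> \<open>Since \<open>q\<close> is rational these are countably many conditions: they
    hold together at almost every time in \<open>(0, T]\<close>, and the set of such times is
    measurable.\<close>
  define good where "good t \<longleftrightarrow> (\<forall>q q'. q \<le> q' \<longrightarrow> h q t \<le> h q' t) \<and> (\<forall>q. h q t \<le> 1) \<and> (SUP q. h q t) \<ge> 1 \<and> (INF q. h q t) = 0" for t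
  have good_meas[measurable]: "Measurable.pred lborel good" unfolding good_def by measurable
  have goodAE: "AE t in lborel. t \<in> {0<..T} \<longrightarrow> good t"
  proof -
    have "AE t in lborel. \<forall>q q'. q \<le> q' \<longrightarrow> h q t \<le> h q' t"
      unfolding AE_all_countable by (intro allI AE_impI hmono)
    moreover have "AE t in lborel. \<forall>q. h q t \<le> 1"
      unfolding AE_all_countable by (intro allI le1)
    ultimately show ?thesis using supAE infAE by eventually_elim (auto simp: good_def)
  qed
  \<comment> \<open>At the other times the distribution function of the point mass at 0 is used, so
    that every \<open>K t\<close> is a probability measure.\<close>
  define a where "a t q = (if good t then enn2real (h q t) else if 0 \<le> q then 1 else 0)" for t q
  have ha: "h q t = ennreal (a t q)" if "good t" for t q
  proof -
    have "h q t < top" using that by (auto simp: good_def intro: le_less_trans)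
    then show ?thesis using that by (simp add: a_def)
  qed
  have a01: "0 \<le> a t q" "a t q \<le> 1" for t q
  proof -
    show "0 \<le> a t q" by (simp add: a_def)
    show "a t q \<le> 1"
    proof (cases "good t")
      case True
      then have "ennreal (a t q) \<le> ennreal 1" unfolding ha[OF True, symmetric] by (simp add: good_def)
      then show ?thesis by (simp add: ennreal_le_iff)
    qed (simp add: a_def)
  qed
  have amono: "a t q \<le> a t q'" if "q \<le> q'" for t q q'
  proof (cases "good t")
    case True
    then have "ennreal (a t q) \<le> ennreal (a t q')" unfolding ha[OF True, symmetric] using that by (simp add: good_def)
    then show ?thesis using a01 by (simp add: ennreal_le_iff)
  qed (use that in \<open>auto simp: a_def\<close>)
  have asup: "\<exists>q. a t q > 1 - e" if e: "e > 0" for t e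
  proof (cases "good t")
    case True
    have "ennreal (1 - e) < 1" using e by (simp add: ennreal_less_one_iff)
    also have "1 \<le> (SUP q. h q t)" using True by (simp add: good_def)
    finally obtain q where "ennreal (1 - e) < h q t" unfolding less_SUP_iff by auto
    then have "1 - e < a t q" unfolding ha[OF True] using ennreal_leI[of "a t q" "1 - e"] by (meson not_le)
    then show ?thesis by blast
  next
    case False
    then show ?thesis using e by (intro exI[of _ 0]) (simp add: a_def)
  qed
  have ainf: "\<exists>q. a t q < e" if e: "e > 0" for t e
  proof (cases "good t")
    case True
    have "(INF q. h q t) < ennreal e" using True e by (simp add: good_def)
    then obtain q where "h q t < ennreal e" unfolding INF_less_iff by auto
    then show ?thesis unfolding ha[OF True] using a01 by (auto simp: ennreal_less_iff)
  next
    case False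
    then show ?thesis using e by (intro exI[of _ "-1"]) (simp add: a_def)
  qed
  define H where "H t x = (INF q\<in>{q. x < real_of_rat q}. a t q)" for t x
  have Hm: "x \<le> y \<Longrightarrow> H t x \<le> H t y" for t x y
    unfolding H_def by (rule distribution_function_of_rational_values(1)[where a="a t"]) (erule amono | rule a01 | erule asup | erule ainf | assumption)+
  have Hc: "continuous (at_right x) (H t)" for t x
    unfolding H_def[abs_def] by (rule distribution_function_of_rational_values(2)[where a="a t"]) (erule amono | rule a01 | erule asup | erule ainf | assumption)+
  have Hb: "(H t \<longlongrightarrow> 0) at_bot" "(H t \<longlongrightarrow> 1) at_top" for t
    unfolding H_def[abs_def]
    by (rule distribution_function_of_rational_values(3)[where a="a t"], (erule amono | rule a01 | erule asup | erule ainf | assumption)+)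
      (rule distribution_function_of_rational_values(4)[where a="a t"], (erule amono | rule a01 | erule asup | erule ainf | assumption)+)
  have Hq: "x < real_of_rat q \<Longrightarrow> H t x \<le> a t q" "real_of_rat q \<le> x \<Longrightarrow> a t q \<le> H t x" for t x q
    unfolding H_def
    by (rule distribution_function_of_rational_values(5)[where a="a t"], (erule amono | rule a01 | erule asup | erule ainf | assumption)+)
      (rule distribution_function_of_rational_values(6)[where a="a t"], (erule amono | rule a01 | erule asup | erule ainf | assumption)+)
  have [measurable]: "(\<lambda>t. a t q) \<in> borel_measurable lborel" for q unfolding a_def by measurable
  have H_meas[measurable]: "(\<lambda>t. H t x) \<in> borel_measurable lborel" for x
    unfolding H_def using a01 by (intro borel_measurable_cINF) (auto intro!: bdd_belowI[of _ 0])
  define K where "K t = interval_measure (H t)" for t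
  have K: "prob_space (K t)" "sets (K t) = sets borel" for t
  proof -
    interpret real_distribution "K t" unfolding K_def by (intro real_distribution_interval_measure Hm Hc Hb)
    show "prob_space (K t)" by unfold_locales
    show "sets (K t) = sets borel" by simp
  qed
  have K_Iic: "emeasure (K t) {..x} = ennreal (H t x)" for t x
    unfolding K_def by (intro emeasure_interval_measure_Iic Hm Hc Hb)
  \<comment> \<open>It suffices to test half-lines, whose mass \<open>H t x\<close> is an infimum of
    countably many measurable functions of \<open>t\<close>.\<close>
  have Kmeas: "K \<in> lborel \<rightarrow>\<^sub>M prob_algebra borel"
  proof (rule measurable_prob_algebra_generated)
    show "sets borel = sigma_sets UNIV (range (\<lambda>a. {..a::real}))" by (simp add: borel_eq_atMost)
    show "Int_stable (range (\<lambda>a. {..a::real}))" by (auto simp: Int_stable_def intro!: image_eqI)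
    show "(\<lambda>t. emeasure (K t) A) \<in> borel_measurable lborel" if "A \<in> range (\<lambda>a. {..a::real})" for A
      using that by (auto simp: K_Iic)
  qed (use K in auto)
  have Kslice: "(\<lambda>t. emeasure (K t) (Pair t -` S)) \<in> borel_measurable lborel"
    if S: "S \<in> sets (borel :: (real \<times> real) measure)" for S
  proof (rule emeasure_measurable_subprob_algebra2[OF _ measurable_prob_algebraD[OF Kmeas]])
    have "(SIGMA t:space lborel. Pair t -` S) = S" by auto
    moreover have "sets (lborel \<Otimes>\<^sub>M borel) = sets (borel :: (real \<times> real) measure)"
      unfolding borel_prod[symmetric] by (intro sets_pair_measure_cong) auto
    ultimately show "(SIGMA t:space lborel. Pair t -` S) \<in> sets (lborel \<Otimes>\<^sub>M borel)" using S by simp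
  qed
  let ?n = "\<lambda>S. \<integral>\<^sup>+t. indicator {0..T} t * emeasure (K t) (Pair t -` S) \<partial>lborel"
  define \<nu> where "\<nu> = measure_of UNIV (sets (borel :: (real \<times> real) measure)) ?n"
  have sets_\<nu>: "sets \<nu> = sets borel" by (simp add: \<nu>_def sets.sigma_sets_eq[of borel, simplified])
  have em: "emeasure \<nu> S = ?n S" if "S \<in> sets borel" for S
    unfolding \<nu>_def
  proof (rule emeasure_measure_of_sigma[OF _ _ _ that])
    show "sigma_algebra UNIV (sets (borel :: (real \<times> real) measure))" using sets.sigma_algebra_axioms[of borel] by simp
    show "positive (sets borel) ?n" by (simp add: positive_def)
    show "countably_additive (sets borel) ?n"
    proof (rule countably_additiveI)
      fix B :: "nat \<Rightarrow> (real \<times> real) set" assume B: "range B \<subseteq> sets borel" "disjoint_family B" "(\<Union>i. B i) \<in> sets borel"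
      then have B': "B i \<in> sets borel" for i by auto
      have sl: "Pair t -` B i \<in> sets (K t)" for t i
      proof -
        have "B i \<in> sets ((borel :: real measure) \<Otimes>\<^sub>M (borel :: real measure))" using B'[of i] unfolding borel_prod .
        then show ?thesis unfolding K(2) by (rule sets_Pair1)
      qed
      have "(\<Sum>i. ?n (B i)) = (\<integral>\<^sup>+t. (\<Sum>i. indicator {0..T} t * emeasure (K t) (Pair t -` B i)) \<partial>lborel)"
        using B' by (intro nn_integral_suminf[symmetric] borel_measurable_times_ennreal Kslice) auto
      also have "\<dots> = ?n (\<Union>i. B i)"
      proof (intro nn_integral_cong)
        fix t
        have "disjoint_family (\<lambda>i. Pair t -` B i)" using B(2) unfolding disjoint_family_on_def by blast
        then have "(\<Sum>i. emeasure (K t) (Pair t -` B i)) = emeasure (K t) (\<Union>i. Pair t -` B i)"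
          using sl by (intro suminf_emeasure) auto
        also have "(\<Union>i. Pair t -` B i) = Pair t -` (\<Union>i. B i)" by auto
        finally show "(\<Sum>i. indicator {0..T} t * emeasure (K t) (Pair t -` B i)) = indicator {0..T} t * emeasure (K t) (Pair t -` (\<Union>i. B i))"
          by simp
      qed
      finally show "(\<Sum>i. ?n (B i)) = ?n (\<Union>i. B i)" .
    qed
  qed
  have MT: "\<nu> \<in> MT T"
    unfolding MT_def using K Kslice em sets_\<nu> by (intro CollectI conjI exI[of _ K]) auto
  interpret \<nu>: finite_measure \<nu> by (rule MT_finite_measure(1)[OF MT])
  have rect: "emeasure \<nu> ({..t} \<times> {..x}) = (\<integral>\<^sup>+s. ennreal (H s x) * indicator {0<..t} s \<partial>lborel)" if t: "t \<in> {0..T}" for t x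
  proof -
    have S: "{..t} \<times> {..x} \<in> sets (borel :: (real \<times> real) measure)" unfolding borel_prod[symmetric] by auto
    \<comment> \<open>\<open>int_T\<close> integrates over \<open>{0<..t}\<close> while
      \<open>MT T\<close> uses \<open>{0..T}\<close>; the left end point is a null set.\<close>
    have "AE s in lborel. s \<noteq> (0::real)" by (rule AE_lborel_singleton)
    then have "AE s in lborel. indicator {0..T} s * emeasure (K s) (Pair s -` ({..t} \<times> {..x})) = ennreal (H s x) * indicator {0<..t} s"
    proof eventually_elim
      case (elim s)
      have "Pair s -` ({..t} \<times> {..x}) = (if s \<le> t then {..x} else {})" by auto
      then show ?case using elim t by (auto simp: K_Iic indicator_def)
    qed
    then show ?thesis unfolding em[OF S] by (rule nn_integral_cong_AE)
  qed
  show ?thesis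
  proof (intro bexI[OF _ MT] ballI allI conjI impI)
    fix t q x assume t: "t \<in> {0..T}"
    have gt: "0 \<le> g t q" using incr[of 0 t q] g0[of q] t by simp
    have good_t: "AE s in lborel. s \<in> {0<..t} \<longrightarrow> good s"
      using goodAE by eventually_elim (use t in auto)
    {
      assume q: "real_of_rat q \<le> x"
      have "ennreal (g t q) = (\<integral>\<^sup>+s. h q s * indicator {0<..t} s \<partial>lborel)" using t by (simp add: int_T)
      also have "\<dots> \<le> emeasure \<nu> ({..t} \<times> {..x})" unfolding rect[OF t]
        using good_t by (intro nn_integral_mono_AE, eventually_elim)
          (use Hq(2)[OF q] in \<open>auto simp: ha ennreal_leI split: split_indicator\<close>)
      finally show "g t q \<le> measure \<nu> ({..t} \<times> {..x})" by (simp add: \<nu>.emeasure_eq_measure)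
    next
      assume q: "x < real_of_rat q"
      have "emeasure \<nu> ({..t} \<times> {..x}) \<le> (\<integral>\<^sup>+s. h q s * indicator {0<..t} s \<partial>lborel)" unfolding rect[OF t]
        using good_t by (intro nn_integral_mono_AE, eventually_elim)
          (use Hq(1)[OF q] in \<open>auto simp: ha ennreal_leI split: split_indicator\<close>)
      also have "\<dots> = ennreal (g t q)" using t by (simp add: int_T)
      finally show "measure \<nu> ({..t} \<times> {..x}) \<le> g t q" using gt by (simp add: \<nu>.emeasure_eq_measure)
    }
  qed
qed

section \<open>Compactness of tight sets of measures\<close>

lemma MT_marginal:
  assumes "\<nu> \<in> MT T" "S \<in> sets borel"
  shows "measure \<nu> (S \<times> UNIV) = measure lborel (S \<inter> {0..T})"
  using MT_emeasure[OF assms] by (simp add: measure_def)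

lemma MT_Times_le:
  assumes \<nu>: "\<nu> \<in> MT T" and "S \<in> sets borel"
  shows "measure \<nu> (S \<times> B) \<le> measure lborel (S \<inter> {0..T})"
proof -
  interpret finite_measure \<nu> by (rule MT_finite_measure[OF \<nu>])
  have "S \<times> UNIV \<in> sets (borel :: (real \<times> real) measure)"
    using assms(2) unfolding borel_prod[symmetric] by auto
  then have "measure \<nu> (S \<times> B) \<le> measure \<nu> (S \<times> UNIV)"
    by (intro finite_measure_mono) (auto simp: MT_finite_measure(2)[OF \<nu>])
  then show ?thesis using MT_marginal[OF assms] by simp
qed

lemma MT_outside:
  assumes \<nu>: "\<nu> \<in> MT T" shows "measure \<nu> ((- {0..T}) \<times> UNIV) = 0"
proof -
  have e: "- {0..T} \<inter> {0..T} = {}" by auto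
  show ?thesis using MT_marginal[OF \<nu>, of "- {0..T}"] unfolding e by simp
qed

lemma rect_borel: "S \<in> sets borel \<Longrightarrow> B \<in> sets borel \<Longrightarrow> S \<times> B \<in> sets (borel :: (real \<times> real) measure)"
  unfolding borel_prod[symmetric] by auto

section \<open>Distribution functions of kernel measures\<close>

definition dfun :: "(real \<times> real) measure \<Rightarrow> real \<Rightarrow> real \<Rightarrow> real" where
  "dfun \<nu> t x = measure \<nu> ({..t} \<times> {..x})"

lemma dfun_diff_time:
  assumes \<nu>: "\<nu> \<in> MT T" and st: "s \<le> t"
  shows "dfun \<nu> t x - dfun \<nu> s x = measure \<nu> ({s<..t} \<times> {..x})"
proof -
  interpret finite_measure \<nu> by (rule MT_finite_measure[OF \<nu>])
  have "{..t} \<times> {..x} = {..s} \<times> {..x} \<union> {s<..t} \<times> {..x}" using st by auto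
  moreover have "measure \<nu> ({..s} \<times> {..x} \<union> {s<..t} \<times> {..x}) = measure \<nu> ({..s} \<times> {..x}) + measure \<nu> ({s<..t} \<times> {..x})"
    by (rule finite_measure_Union) (auto simp: MT_finite_measure(2)[OF \<nu>] intro!: rect_borel)
  ultimately show ?thesis by (simp add: dfun_def)
qed

text \<open>A time increment is at most the mass of a strip, which the Lebesgue marginal bounds by
  the length of the time interval.\<close>

lemma dfun_time:
  assumes \<nu>: "\<nu> \<in> MT T" and st: "s \<le> t"
  shows "dfun \<nu> s x \<le> dfun \<nu> t x" "dfun \<nu> t x - dfun \<nu> s x \<le> t - s"
proof -
  show "dfun \<nu> s x \<le> dfun \<nu> t x" using dfun_diff_time[OF assms, of x] measure_nonneg[of \<nu> "{s<..t} \<times> {..x}"] by linarith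
  have "measure lborel ({s<..t} \<inter> {0..T}) \<le> measure lborel {s<..t}"
    using st by (intro measure_mono_fmeasurable) (auto simp: fmeasurable_def emeasure_lborel_Ioc)
  then show "dfun \<nu> t x - dfun \<nu> s x \<le> t - s"
    using MT_Times_le[OF \<nu>, of "{s<..t}" "{..x}"] dfun_diff_time[OF assms, of x] st by simp
qed

text \<open>Cell masses are second differences of \<open>dfun\<close>: their nonnegativity passes to
  limits, and convergence at the corners gives convergence of the mass of a cell.\<close>

lemma dfun_rect:
  assumes \<nu>: "\<nu> \<in> MT T" and st: "s \<le> t" and xy: "x \<le> y"
  shows "measure \<nu> ({s<..t} \<times> {x<..y}) = (dfun \<nu> t y - dfun \<nu> s y) - (dfun \<nu> t x - dfun \<nu> s x)"
proof -
  interpret finite_measure \<nu> by (rule MT_finite_measure[OF \<nu>])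
  have "{s<..t} \<times> {..y} = {s<..t} \<times> {..x} \<union> {s<..t} \<times> {x<..y}" using xy by auto
  moreover have "measure \<nu> ({s<..t} \<times> {..x} \<union> {s<..t} \<times> {x<..y}) = measure \<nu> ({s<..t} \<times> {..x}) + measure \<nu> ({s<..t} \<times> {x<..y})"
    by (rule finite_measure_Union) (auto simp: MT_finite_measure(2)[OF \<nu>] intro!: rect_borel)
  ultimately show ?thesis by (simp add: dfun_diff_time[OF \<nu> st])
qed

lemma dfun_space:
  assumes \<nu>: "\<nu> \<in> MT T" and xy: "x \<le> y"
  shows "dfun \<nu> t x \<le> dfun \<nu> t y"
proof -
  interpret finite_measure \<nu> by (rule MT_finite_measure[OF \<nu>])
  show ?thesis unfolding dfun_def using xy
    by (intro finite_measure_mono) (auto simp: MT_finite_measure(2)[OF \<nu>] intro!: rect_borel)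
qed

lemma dfun_at_0: "\<nu> \<in> MT T \<Longrightarrow> t \<le> 0 \<Longrightarrow> dfun \<nu> t x = 0"
proof -
  assume \<nu>: "\<nu> \<in> MT T" and t: "t \<le> 0"
  have "emeasure lborel ({..t} \<inter> {0..T}) \<le> emeasure lborel {0::real}"
    using t by (intro emeasure_mono) auto
  then have "measure lborel ({..t} \<inter> {0..T}) = 0" by (simp add: measure_def)
  then show "dfun \<nu> t x = 0"
    using MT_Times_le[OF \<nu>, of "{..t}" "{..x}"] measure_nonneg[of \<nu> "{..t} \<times> {..x}"] by (simp add: dfun_def)
qed

lemma dfun_after:
  assumes \<nu>: "\<nu> \<in> MT T" and t: "T \<le> t" shows "dfun \<nu> t x = dfun \<nu> T x"
proof -
  have e: "{T<..t} \<inter> {0..T} = {}" by auto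
  show ?thesis
    using MT_Times_le[OF \<nu>, of "{T<..t}" "{..x}"] dfun_diff_time[OF \<nu> t, of x]
      measure_nonneg[of \<nu> "{T<..t} \<times> {..x}"] unfolding e by simp
qed

lemma tail_borel: "{p :: real \<times> real. \<bar>snd p\<bar> > R} \<in> sets borel"
  by (intro borel_open open_Collect_less continuous_intros)

text \<open>A closed \<open>S\<close> is covered by the cells that meet it and a remainder of mass
  at most \<open>e / 2\<close>. Cells of diameter below \<open>e\<close> that meet \<open>S\<close>
  stay inside its neighbourhood, and exchanging the measures on them costs another
  \<open>e / 2\<close>.\<close>

lemma lp_close_of_cells:
  fixes c :: "'j \<Rightarrow> (real \<times> real) set"
  assumes \<alpha>: "\<alpha> \<in> MT T" and \<beta>: "\<beta> \<in> MT T" and e: "e > 0" and J: "finite J"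
    and c: "\<And>j. j \<in> J \<Longrightarrow> c j \<in> sets borel" "disjoint_family_on c J"
    and diam: "\<And>j x y. j \<in> J \<Longrightarrow> x \<in> c j \<Longrightarrow> y \<in> c j \<Longrightarrow> dist x y < e"
    and out: "measure \<alpha> (- (\<Union>j\<in>J. c j)) \<le> e / 2" and out': "measure \<beta> (- (\<Union>j\<in>J. c j)) \<le> e / 2"
    and sum: "(\<Sum>j\<in>J. \<bar>measure \<alpha> (c j) - measure \<beta> (c j)\<bar>) \<le> e / 2"
  shows "lp_close e \<alpha> \<beta>"
proof -
  have key: "measure \<alpha> S \<le> measure \<beta> {x. infdist x S < e} + e"
    if \<alpha>: "\<alpha> \<in> MT T" and \<beta>: "\<beta> \<in> MT T" and out: "measure \<alpha> (- (\<Union>j\<in>J. c j)) \<le> e / 2"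
      and sum: "(\<Sum>j\<in>J. \<bar>measure \<alpha> (c j) - measure \<beta> (c j)\<bar>) \<le> e / 2" and S: "closed S" for \<alpha> \<beta> S
  proof -
    interpret A: finite_measure \<alpha> by (rule MT_finite_measure[OF \<alpha>])
    interpret B: finite_measure \<beta> by (rule MT_finite_measure[OF \<beta>])
    note sets = MT_finite_measure(2)[OF \<alpha>] MT_finite_measure(2)[OF \<beta>]
    define I where "I = {j\<in>J. c j \<inter> S \<noteq> {}}"
    have I: "finite I" "I \<subseteq> J" using J by (auto simp: I_def)
    have "(\<Union>j\<in>J. c j) \<in> sets borel" using J c(1) by (intro sets.finite_UN) auto
    then have cI: "(\<Union>j\<in>I. c j) \<in> sets borel" "- (\<Union>j\<in>J. c j) \<in> sets borel"
      using I c(1) by (auto intro!: sets.finite_UN simp del: Compl_UN)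
    have "measure \<alpha> S \<le> measure \<alpha> (- (\<Union>j\<in>J. c j) \<union> (\<Union>j\<in>I. c j))"
      using cI by (intro A.finite_measure_mono) (auto simp: sets I_def)
    also have "\<dots> \<le> measure \<alpha> (- (\<Union>j\<in>J. c j)) + measure \<alpha> (\<Union>j\<in>I. c j)"
      using cI by (intro measure_Un_le) (auto simp: sets)
    also have "measure \<alpha> (\<Union>j\<in>I. c j) \<le> (\<Sum>j\<in>I. measure \<alpha> (c j))"
      using I c(1) by (intro measure_UNION_le) (auto simp: sets)
    also have "\<dots> \<le> (\<Sum>j\<in>I. measure \<beta> (c j) + \<bar>measure \<alpha> (c j) - measure \<beta> (c j)\<bar>)"
      by (intro sum_mono) linarith
    also have "\<dots> = (\<Sum>j\<in>I. measure \<beta> (c j)) + (\<Sum>j\<in>I. \<bar>measure \<alpha> (c j) - measure \<beta> (c j)\<bar>)"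
      by (rule sum.distrib)
    also have "(\<Sum>j\<in>I. \<bar>measure \<alpha> (c j) - measure \<beta> (c j)\<bar>) \<le> (\<Sum>j\<in>J. \<bar>measure \<alpha> (c j) - measure \<beta> (c j)\<bar>)"
      by (intro sum_mono2 J I) auto
    also have "(\<Sum>j\<in>I. measure \<beta> (c j)) = measure \<beta> (\<Union>j\<in>I. c j)"
      using I c by (intro B.finite_measure_finite_Union[symmetric]) (auto simp: sets intro: disjoint_family_on_mono)
    also have "measure \<beta> (\<Union>j\<in>I. c j) \<le> measure \<beta> {x. infdist x S < e}"
    proof (intro B.finite_measure_mono infdist_less_borel sets subsetI CollectI)
      fix x assume "x \<in> (\<Union>j\<in>I. c j)"
      then obtain j y where "j \<in> J" "x \<in> c j" "y \<in> c j" "y \<in> S" by (auto simp: I_def)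
      then show "infdist x S < e" using diam[of j x y] infdist_le[of y S x] by linarith
    qed
    finally show ?thesis using out sum by linarith
  qed
  have sum': "(\<Sum>j\<in>J. \<bar>measure \<beta> (c j) - measure \<alpha> (c j)\<bar>) \<le> e / 2"
    using sum by (simp only: abs_minus_commute)
  show ?thesis unfolding lp_close_def
    using e key[OF \<alpha> \<beta> out sum] key[OF \<beta> \<alpha> out' sum'] by blast
qed

text \<open>Tightness reduces the comparison to finitely many small cells, whose masses converge
  once the space coordinates of the corners carry no mass of the limit. In the time coordinate
  \<open>conv\<close> covers every point of \<open>[0, T]\<close>.\<close>

lemma levy_prokhorov_tendsto_0:
  assumes T: "T > 0" and \<mu>: "\<And>n. \<mu> n \<in> MT T" and \<nu>: "\<nu> \<in> MT T"
    and tight: "\<And>e. e > 0 \<Longrightarrow> \<exists>R. \<forall>n. measure (\<mu> n) {p. \<bar>snd p\<bar> > R} \<le> e"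
    and conv: "\<And>t x. t \<in> {0..T} \<Longrightarrow> measure \<nu> (UNIV \<times> {x}) = 0 \<Longrightarrow> (\<lambda>n. dfun (\<mu> n) t x) \<longlonglongrightarrow> dfun \<nu> t x"
  shows "(\<lambda>n. levy_prokhorov (\<mu> n) \<nu>) \<longlonglongrightarrow> 0"
proof -
  interpret N: finite_measure \<nu> by (rule MT_finite_measure[OF \<nu>])
  note sets = MT_finite_measure(2)[OF \<mu>] MT_finite_measure(2)[OF \<nu>]
  have conv': "(\<lambda>n. dfun (\<mu> n) t x) \<longlonglongrightarrow> dfun \<nu> t x" if x: "measure \<nu> (UNIV \<times> {x}) = 0" for t x
  proof -
    consider "t \<le> 0" | "t \<in> {0..T}" | "T \<le> t" by force
    then show ?thesis
    proof cases
      case 1 then show ?thesis by (simp add: dfun_at_0[OF \<mu>] dfun_at_0[OF \<nu>])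
    next
      case 2 then show ?thesis using conv x by blast
    next
      case 3
      have "(\<lambda>n. dfun (\<mu> n) T x) \<longlonglongrightarrow> dfun \<nu> T x" using conv[of T x] x T by simp
      then show ?thesis by (simp only: dfun_after[OF \<mu> 3] dfun_after[OF \<nu> 3])
    qed
  qed
  \<comment> \<open>The atoms of the space marginal of \<open>\<nu>\<close>, countably many because
    that measure is finite.\<close>
  define D where "D = {x. measure \<nu> (UNIV \<times> {x}) \<noteq> 0}"
  have "countable D"
  proof -
    have sm: "snd \<in> measurable \<nu> borel"
      unfolding measurable_cong_sets[OF sets(2) refl]
      by (intro borel_measurable_continuous_onI continuous_intros)
    interpret d: finite_measure "distr \<nu> borel snd" by (rule N.finite_measure_distr[OF sm])
    have "measure (distr \<nu> borel snd) {x} = measure \<nu> (UNIV \<times> {x})" for x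
    proof -
      have "snd -` {x} \<inter> space \<nu> = UNIV \<times> {x}" using sets_eq_imp_space_eq[OF sets(2)] by auto
      then show ?thesis using sm by (simp add: measure_distr)
    qed
    then show ?thesis using d.countable_support by (simp add: D_def)
  qed
  have close: "\<forall>\<^sub>F n in sequentially. lp_close e (\<mu> n) \<nu>" if e: "e > 0" for e
  proof -
    \<comment> \<open>Cells have side \<eta>, so two coordinate differences add up to less than
      \<open>2 * \<eta> = e\<close>.\<close>
    define \<eta> where "\<eta> = e / 2"
    have \<eta>: "\<eta> > 0" using e by (simp add: \<eta>_def)
    \<comment> \<open>Only countably many shifts put some grid coordinate on an atom; \<theta>
      avoids them all.\<close>
    have "countable (\<Union>k::int. (\<lambda>d. d - real_of_int k * \<eta>) ` D)"
      by (intro countable_UN countable_image \<open>countable D\<close>) simp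
    then obtain \<theta> where \<theta>: "\<theta> \<in> {0<..<\<eta>}" "\<theta> \<notin> (\<Union>k::int. (\<lambda>d. d - real_of_int k * \<eta>) ` D)"
      using real_interval_avoid_countable_set[OF \<eta>] by blast
    have good: "measure \<nu> (UNIV \<times> {\<theta> + real_of_int k * \<eta>}) = 0" for k
    proof (rule ccontr)
      assume "\<not> ?thesis"
      then have "\<theta> + real_of_int k * \<eta> \<in> D" by (simp add: D_def)
      then have "\<theta> \<in> (\<lambda>d. d - real_of_int k * \<eta>) ` D" by (intro image_eqI[of _ _ "\<theta> + real_of_int k * \<eta>"]) auto
      then show False using \<theta>(2) by blast
    qed
    obtain R1 where R1: "\<And>n. measure (\<mu> n) {p. \<bar>snd p\<bar> > R1} \<le> e / 2" using tight[of "e/2"] e by auto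
    obtain R2 :: nat where R2: "measure \<nu> {p. \<bar>snd p\<bar> > real R2} \<le> e / 2"
    proof -
      let ?A = "\<lambda>k::nat. {p :: real \<times> real. \<bar>snd p\<bar> > real k}"
      have "(\<lambda>k. measure \<nu> (?A k)) \<longlonglongrightarrow> measure \<nu> (\<Inter>k. ?A k)"
        using tail_borel by (intro N.finite_Lim_measure_decseq) (auto simp: decseq_def sets)
      moreover have "(\<Inter>k. ?A k) = {}"
      proof -
        have "p \<notin> (\<Inter>k. ?A k)" for p
        proof -
          obtain k :: nat where "\<bar>snd p\<bar> < real k" using reals_Archimedean2 by blast
          then have "p \<notin> ?A k" by simp
          then show ?thesis by blast
        qed
        then show ?thesis by blast
      qed
      ultimately have "(\<lambda>k. measure \<nu> (?A k)) \<longlonglongrightarrow> 0" by simp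
      then have "\<forall>\<^sub>F k in sequentially. measure \<nu> (?A k) < e / 2" using e by (intro order_tendstoD) auto
      then obtain k where "measure \<nu> (?A k) < e / 2" by (auto simp: eventually_sequentially)
      then show ?thesis by (intro that[of k]) simp
    qed
    define R where "R = max R1 (real R2)"
    have tail: "measure (\<mu> n) {p. \<bar>snd p\<bar> > R} \<le> e / 2" "measure \<nu> {p. \<bar>snd p\<bar> > R} \<le> e / 2" for n
    proof -
      have "measure (\<mu> n) {p. \<bar>snd p\<bar> > R} \<le> measure (\<mu> n) {p. \<bar>snd p\<bar> > R1}"
        using tail_borel by (intro finite_measure.finite_measure_mono[OF MT_finite_measure(1)[OF \<mu>]]) (auto simp: R_def sets)
      then show "measure (\<mu> n) {p. \<bar>snd p\<bar> > R} \<le> e / 2" using R1[of n] by linarith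
      have "measure \<nu> {p. \<bar>snd p\<bar> > R} \<le> measure \<nu> {p. \<bar>snd p\<bar> > real R2}"
        using tail_borel by (intro N.finite_measure_mono) (auto simp: R_def sets)
      then show "measure \<nu> {p. \<bar>snd p\<bar> > R} \<le> e / 2" using R2 by linarith
    qed
    obtain L :: nat where "R / \<eta> + 2 < real L" using reals_Archimedean2 by blast
    then have L: "R + 2 * \<eta> \<le> real L * \<eta>" using \<eta> by (simp add: field_simps)
    obtain P :: nat where "T / \<eta> < real P" using reals_Archimedean2 by blast
    then have P: "T \<le> real P * \<eta>" using \<eta> by (simp add: field_simps)
    \<comment> \<open>Cells are open on the left, so time 0 lies in a cell with time index -1. The
      surplus \<open>2 * \<eta>\<close> in the choice of \<open>L\<close> pays for the shift
      \<theta> and for rounding.\<close>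
    define J where "J = {-1..int P} \<times> {-int L..int L}"
    define c where "c j = {real_of_int (fst j) * \<eta><..real_of_int (fst j + 1) * \<eta>} \<times>
       {\<theta> + real_of_int (snd j) * \<eta><..\<theta> + real_of_int (snd j + 1) * \<eta>}" for j
    have J: "finite J" by (simp add: J_def)
    have cb: "c j \<in> sets borel" for j unfolding c_def by (intro rect_borel) auto
    \<comment> \<open>A point determines its cell through ceilings, which gives
      disjointness.\<close>
    have idx: "fst j = \<lceil>fst x / \<eta>\<rceil> - 1 \<and> snd j = \<lceil>(snd x - \<theta>) / \<eta>\<rceil> - 1" if "x \<in> c j" for x j
    proof -
      have "real_of_int (fst j) < fst x / \<eta>" "fst x / \<eta> \<le> real_of_int (fst j + 1)"
        "real_of_int (snd j) < (snd x - \<theta>) / \<eta>" "(snd x - \<theta>) / \<eta> \<le> real_of_int (snd j + 1)"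
        using that \<eta> by (auto simp: c_def field_simps)
      then show ?thesis by linarith
    qed
    have disj: "disjoint_family_on c J"
      unfolding disjoint_family_on_def
    proof (intro ballI impI)
      fix i j :: "int \<times> int" assume ij: "i \<noteq> j"
      have "x \<notin> c i \<inter> c j" for x
      proof
        assume "x \<in> c i \<inter> c j"
        then have "fst i = fst j \<and> snd i = snd j" using idx[of x i] idx[of x j] by auto
        then show False using ij by (simp add: prod_eq_iff)
      qed
      then show "c i \<inter> c j = {}" by blast
    qed
    have cover: "- (\<Union>j\<in>J. c j) \<subseteq> (- {0..T}) \<times> UNIV \<union> {p. \<bar>snd p\<bar> > R}"
    proof (rule subsetI, rule ccontr)
      fix x assume x: "x \<in> - (\<Union>j\<in>J. c j)" "x \<notin> (- {0..T}) \<times> UNIV \<union> {p. \<bar>snd p\<bar> > R}"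
      obtain t z where tz: "x = (t, z)" by (cases x)
      have b: "0 \<le> t" "t \<le> T" "\<bar>z\<bar> \<le> R" using x(2) by (auto simp: tz)
      define p k where "p = \<lceil>t / \<eta>\<rceil> - 1" and "k = \<lceil>(z - \<theta>) / \<eta>\<rceil> - 1"
      have pk: "real_of_int p < t / \<eta>" "t / \<eta> \<le> real_of_int p + 1"
        "real_of_int k < (z - \<theta>) / \<eta>" "(z - \<theta>) / \<eta> \<le> real_of_int k + 1"
        unfolding p_def k_def by linarith+
      then have pk': "real_of_int p * \<eta> < t" "t \<le> (real_of_int p + 1) * \<eta>"
        "real_of_int k * \<eta> < z - \<theta>" "z - \<theta> \<le> (real_of_int k + 1) * \<eta>"
        using \<eta> by (auto simp: field_simps)
      have "(p, k) \<in> J"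
      proof -
        have "0 \<le> t / \<eta>" using b \<eta> by simp
        then have "real_of_int p + 1 \<ge> 0" using pk(2) by linarith
        then have p1: "p \<ge> -1" by linarith
        have "real_of_int p * \<eta> < real P * \<eta>" using pk'(1) b P by linarith
        then have p2: "p \<le> int P" using \<eta> by simp
        have "z \<le> R" "0 < \<theta>" using b(3) \<theta>(1) by auto
        then have "real_of_int k * \<eta> < real L * \<eta>" using pk'(3) L \<eta> by linarith
        then have k2: "k \<le> int L" using \<eta> by simp
        have "- (real L - 1) * \<eta> \<le> (real_of_int k + 1) * \<eta>" using pk'(4) b L \<theta>(1) by (auto simp: left_diff_distrib)
        then have "- (real L - 1) \<le> real_of_int k + 1" using \<eta> by (simp only: mult_le_cancel_right_pos)
        then have k1: "k \<ge> - int L" by linarith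
        show ?thesis using p1 p2 k1 k2 by (simp add: J_def)
      qed
      moreover have "x \<in> c (p, k)" using pk' by (auto simp: c_def tz)
      ultimately show False using x(1) by blast
    qed
    have out: "measure \<alpha> (- (\<Union>j\<in>J. c j)) \<le> e / 2"
      if \<alpha>: "\<alpha> \<in> MT T" and t: "measure \<alpha> {p. \<bar>snd p\<bar> > R} \<le> e / 2" for \<alpha>
    proof -
      have "measure \<alpha> (- (\<Union>j\<in>J. c j)) \<le> measure \<alpha> ((- {0..T}) \<times> UNIV \<union> {p. \<bar>snd p\<bar> > R})"
        using cover tail_borel by (intro finite_measure.finite_measure_mono[OF MT_finite_measure(1)[OF \<alpha>]])
          (auto simp: MT_finite_measure(2)[OF \<alpha>] intro!: rect_borel)
      also have "\<dots> \<le> measure \<alpha> ((- {0..T}) \<times> UNIV) + measure \<alpha> {p. \<bar>snd p\<bar> > R}"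
        using tail_borel by (intro measure_Un_le) (auto simp: MT_finite_measure(2)[OF \<alpha>] intro!: rect_borel)
      finally show ?thesis using t MT_outside[OF \<alpha>] by simp
    qed
    have diam: "dist x y < e" if "x \<in> c j" "y \<in> c j" for x y j
    proof -
      have "\<bar>fst x - fst y\<bar> < \<eta>" "\<bar>snd x - snd y\<bar> < \<eta>"
        using that by (auto simp: c_def abs_less_iff algebra_simps)
      moreover have "dist x y \<le> \<bar>fst x - fst y\<bar> + \<bar>snd x - snd y\<bar>"
        unfolding dist_prod_def dist_real_def by (rule sqrt_sum_squares_le_sum_abs[THEN order_trans]) simp
      ultimately show ?thesis by (simp add: \<eta>_def)
    qed
    have cell_conv: "(\<lambda>n. measure (\<mu> n) (c j)) \<longlonglongrightarrow> measure \<nu> (c j)" for j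
    proof -
      have 1: "real_of_int (fst j) * \<eta> \<le> real_of_int (fst j + 1) * \<eta>"
        "\<theta> + real_of_int (snd j) * \<eta> \<le> \<theta> + real_of_int (snd j + 1) * \<eta>" using \<eta> by (auto intro: mult_right_mono)
      show ?thesis unfolding c_def dfun_rect[OF \<mu> 1] dfun_rect[OF \<nu> 1]
        by (intro tendsto_diff conv' good)
    qed
    have "(\<lambda>n. \<Sum>j\<in>J. \<bar>measure (\<mu> n) (c j) - measure \<nu> (c j)\<bar>) \<longlonglongrightarrow> (\<Sum>j\<in>J. \<bar>measure \<nu> (c j) - measure \<nu> (c j)\<bar>)"
      by (intro tendsto_sum tendsto_rabs tendsto_diff cell_conv tendsto_const)
    then have "\<forall>\<^sub>F n in sequentially. (\<Sum>j\<in>J. \<bar>measure (\<mu> n) (c j) - measure \<nu> (c j)\<bar>) < e / 2"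
      using e by (intro order_tendstoD(2)) auto
    then show ?thesis
    proof eventually_elim
      case (elim n)
      then show ?case
        by (intro lp_close_of_cells[OF \<mu> \<nu> e J cb disj diam out[OF \<mu> tail(1)] out[OF \<nu> tail(2)]]) auto
    qed
  qed
  show ?thesis
  proof (rule LIMSEQ_I)
    fix e :: real assume e: "e > 0"
    then obtain N where N: "\<And>n. n \<ge> N \<Longrightarrow> lp_close (e / 2) (\<mu> n) \<nu>"
      using close[of "e/2"] by (auto simp: eventually_sequentially)
    have "norm (levy_prokhorov (\<mu> n) \<nu> - 0) < e" if "n \<ge> N" for n
      using levy_prokhorov_le[OF N[OF that]] levy_prokhorov_nonneg[OF MT_finite_measure(1)[OF \<mu>] MT_finite_measure(1)[OF \<nu>], of n] e
      by simp
    then show "\<exists>N. \<forall>n\<ge>N. norm (levy_prokhorov (\<mu> n) \<nu> - 0) < e" by blast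
  qed
qed

text \<open>Prokhorov's theorem for kernel measures. Tightness prevents loss of mass in the space
  variable; in time the limits inherit the Lipschitz bound, so the limiting data come from a kernel
  again.\<close>

lemma tight_sequentially_compact:
  fixes \<mu> :: "nat \<Rightarrow> (real \<times> real) measure" and r :: "nat \<Rightarrow> real" and C :: real
  assumes T: "T > 0"
  defines "K \<equiv> {\<nu>\<in>MT T. \<forall>i. measure \<nu> {p. \<bar>snd p\<bar> > r i} \<le> C / real (Suc i)}"
  assumes \<mu>: "range \<mu> \<subseteq> K"
  shows "\<exists>\<nu>\<in>K. \<exists>k. strict_mono k \<and> (\<lambda>n. levy_prokhorov (\<mu> (k n)) \<nu>) \<longlonglongrightarrow> 0"
proof -
  have \<mu>T: "\<mu> n \<in> MT T" and \<mu>r: "measure (\<mu> n) {p. \<bar>snd p\<bar> > r i} \<le> C / real (Suc i)" for n i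
    using \<mu> by (auto simp: K_def)
  note fin = MT_finite_measure[OF \<mu>T]
  have small: "\<exists>i. C / real (Suc i) < e" if "e > 0" for e
  proof -
    have "(\<lambda>i. C * inverse (real (Suc i))) \<longlonglongrightarrow> C * 0" by (intro tendsto_intros LIMSEQ_inverse_real_of_nat)
    then have "\<forall>\<^sub>F i in sequentially. C * inverse (real (Suc i)) < e" using that by (intro order_tendstoD) auto
    then show ?thesis by (auto simp: eventually_sequentially divide_inverse)
  qed
  have bound: "\<bar>dfun (\<mu> n) t x\<bar> \<le> T" for n t x
    using MT_Times_le[OF \<mu>T, of UNIV n UNIV] T
      finite_measure.finite_measure_mono[OF fin(1)[of n], of "{..t} \<times> {..x}" UNIV] by (simp add: dfun_def fin)
  \<comment> \<open>The diagonal argument runs over pairs of a rational time and a rational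
    half-line.\<close>
  obtain k where k: "strict_mono (k :: nat \<Rightarrow> nat)"
    and kl: "\<And>p :: rat \<times> rat. convergent (\<lambda>n. dfun (\<mu> (k n)) (real_of_rat (fst p)) (real_of_rat (snd p)))"
    using convergent_subsequence_countable[of "\<lambda>n p :: rat \<times> rat. dfun (\<mu> n) (real_of_rat (fst p)) (real_of_rat (snd p))"]
      bound by blast
  define f where "f n t x = dfun (\<mu> (k n)) t x" for n t x
  have f_t: "s \<le> t \<Longrightarrow> f n s x \<le> f n t x" "s \<le> t \<Longrightarrow> f n t x - f n s x \<le> t - s" for n s t x
    unfolding f_def by (rule dfun_time[OF \<mu>T]; assumption)+
  have f_x: "x \<le> y \<Longrightarrow> f n t x \<le> f n t y" for n t x y
    unfolding f_def by (rule dfun_space[OF \<mu>T])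
  have f_lip: "\<bar>f n t x - f n s x\<bar> \<le> \<bar>t - s\<bar>" for n s t x
    using f_t[of s t n x] f_t[of t s n x] by (cases "s \<le> t") auto
  \<comment> \<open>Rational times suffice because each \<open>f n\<close> is 1-Lipschitz in
    time.\<close>
  have conv: "convergent (\<lambda>n. f n t (real_of_rat q))" for t q
  proof -
    have "Cauchy (\<lambda>n. f n t (real_of_rat q))"
    proof (rule metric_CauchyI)
      fix e :: real assume e: "e > 0"
      obtain a where a: "t < real_of_rat a" "real_of_rat a < t + e / 3" using of_rat_dense[of t "t + e/3"] e by auto
      have "convergent (\<lambda>n. f n (real_of_rat a) (real_of_rat q))"
        using kl[of "(a, q)"] by (simp add: f_def)
      then have "Cauchy (\<lambda>n. f n (real_of_rat a) (real_of_rat q))" by (rule convergent_Cauchy)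
      then obtain N where N: "\<And>m n. m \<ge> N \<Longrightarrow> n \<ge> N \<Longrightarrow> dist (f m (real_of_rat a) (real_of_rat q)) (f n (real_of_rat a) (real_of_rat q)) < e / 3"
        using e by (metis metric_CauchyD zero_less_divide_iff zero_less_numeral)
      have "dist (f m t (real_of_rat q)) (f n t (real_of_rat q)) < e" if "m \<ge> N" "n \<ge> N" for m n
        using N[OF that] f_lip[of m t "real_of_rat q" "real_of_rat a"] f_lip[of n t "real_of_rat q" "real_of_rat a"] a
        unfolding dist_real_def by linarith
      then show "\<exists>N. \<forall>m\<ge>N. \<forall>n\<ge>N. dist (f m t (real_of_rat q)) (f n t (real_of_rat q)) < e" by blast
    qed
    then show ?thesis by (simp add: Cauchy_convergent_iff)
  qed
  define g where "g t q = lim (\<lambda>n. f n t (real_of_rat q))" for t q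
  have g: "(\<lambda>n. f n t (real_of_rat q)) \<longlonglongrightarrow> g t q" for t q
    using conv by (simp add: g_def convergent_LIMSEQ_iff)
  have UNIV_T: "measure (\<mu> n) UNIV = T" for n
    using MT_marginal[OF \<mu>T, of UNIV n] T by simp
  \<comment> \<open>The total mass is \<open>T\<close>, and what \<open>f n T x\<close> misses lies
    in the tail or outside \<open>[0, T]\<close>.\<close>
  have f_T: "T - C / real (Suc i) \<le> f n T x" if "r i \<le> x" for n i x
  proof -
    have "measure (\<mu> (k n)) UNIV \<le> measure (\<mu> (k n)) (({..T} \<times> {..x} \<union> (- {0..T}) \<times> UNIV) \<union> {p. \<bar>snd p\<bar> > r i})"
      using that tail_borel by (intro finite_measure.finite_measure_mono[OF fin(1)])
        (auto simp: fin intro!: rect_borel sets.Un)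
    also have "\<dots> \<le> measure (\<mu> (k n)) ({..T} \<times> {..x} \<union> (- {0..T}) \<times> UNIV) + measure (\<mu> (k n)) {p. \<bar>snd p\<bar> > r i}"
      using tail_borel by (intro measure_Un_le) (auto simp: fin intro!: rect_borel sets.Un)
    also have "measure (\<mu> (k n)) ({..T} \<times> {..x} \<union> (- {0..T}) \<times> UNIV) \<le> measure (\<mu> (k n)) ({..T} \<times> {..x}) + measure (\<mu> (k n)) ((- {0..T}) \<times> UNIV)"
      by (intro measure_Un_le) (auto simp: fin intro!: rect_borel)
    finally show ?thesis using \<mu>r[of "k n" i] UNIV_T[of "k n"] MT_outside[OF \<mu>T[of "k n"]] by (simp add: f_def dfun_def)
  qed
  have f_B: "f n T x \<le> C / real (Suc i)" if "x < - r i" for n i x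
  proof -
    have "measure (\<mu> (k n)) ({..T} \<times> {..x}) \<le> measure (\<mu> (k n)) {p. \<bar>snd p\<bar> > r i}"
      using that tail_borel by (intro finite_measure.finite_measure_mono[OF fin(1)]) (auto simp: fin)
    then show ?thesis using \<mu>r[of "k n" i] by (simp add: f_def dfun_def)
  qed
  obtain \<nu> where \<nu>: "\<nu> \<in> MT T"
    and \<nu>1: "\<And>t q x. t \<in> {0..T} \<Longrightarrow> real_of_rat q \<le> x \<Longrightarrow> g t q \<le> dfun \<nu> t x"
    and \<nu>2: "\<And>t q x. t \<in> {0..T} \<Longrightarrow> x < real_of_rat q \<Longrightarrow> dfun \<nu> t x \<le> g t q"
  proof -
    have "\<exists>\<nu>\<in>MT T. \<forall>t\<in>{0..T}. \<forall>q x. (real_of_rat q \<le> x \<longrightarrow> g t q \<le> measure \<nu> ({..t} \<times> {..x})) \<and>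
     (x < real_of_rat q \<longrightarrow> measure \<nu> ({..t} \<times> {..x}) \<le> g t q)"
    proof (rule lipschitz_distribution_imp_MT[OF T])
      show "g 0 q = 0" for q
        using g[of 0 q] LIMSEQ_unique[OF _ tendsto_const] by (simp add: f_def dfun_at_0[OF \<mu>T] LIMSEQ_const_iff)
      show "g s q \<le> g t q" if "s \<le> t" for s t q
        using f_t(1)[OF that] by (intro LIMSEQ_le[OF g g]) auto
      show "g t q - g s q \<le> t - s" if "s \<le> t" for s t q
        using f_t(2)[OF that] by (intro LIMSEQ_le_const2[OF tendsto_diff[OF g g]]) auto
      show "g t q - g s q \<le> g t q' - g s q'" if "s \<le> t" "q \<le> q'" for s t q q'
      proof (rule LIMSEQ_le[OF tendsto_diff[OF g g] tendsto_diff[OF g g]], intro exI allI impI)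
        fix n
        have "real_of_rat q \<le> real_of_rat q'" using that(2) by (simp add: of_rat_less_eq)
        from dfun_rect[OF \<mu>T that(1) this, of "k n"]
        show "f n t (real_of_rat q) - f n s (real_of_rat q) \<le> f n t (real_of_rat q') - f n s (real_of_rat q')"
          using measure_nonneg[of "\<mu> (k n)" "{s<..t} \<times> {real_of_rat q<..real_of_rat q'}"] by (simp add: f_def)
      qed
      show "\<exists>q. g T q > T - e" if e: "e > 0" for e
      proof -
        obtain i where i: "C / real (Suc i) < e" using small[OF e] by blast
        obtain q where q: "r i < real_of_rat q" using of_rat_dense[of "r i" "r i + 1"] by auto
        have "T - C / real (Suc i) \<le> g T q"
          using f_T[of i "real_of_rat q"] q by (intro LIMSEQ_le_const[OF g]) auto
        then show ?thesis using i by (intro exI[of _ q]) linarith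
      qed
      show "\<exists>q. g T q < e" if e: "e > 0" for e
      proof -
        obtain i where i: "C / real (Suc i) < e" using small[OF e] by blast
        obtain q where q: "real_of_rat q < - r i" using of_rat_dense[of "- r i - 1" "- r i"] by auto
        have "g T q \<le> C / real (Suc i)"
          using f_B[of "real_of_rat q" i] q by (intro LIMSEQ_le_const2[OF g]) auto
        then show ?thesis using i by (intro exI[of _ q]) linarith
      qed
    qed
    then show ?thesis using that unfolding dfun_def by blast
  qed
  interpret N: finite_measure \<nu> by (rule MT_finite_measure[OF \<nu>])
  note sets\<nu> = MT_finite_measure(2)[OF \<nu>]
  have lp: "(\<lambda>n. levy_prokhorov (\<mu> (k n)) \<nu>) \<longlonglongrightarrow> 0"
  proof (rule levy_prokhorov_tendsto_0[OF T \<mu>T \<nu>])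
    show "\<exists>R. \<forall>n. measure (\<mu> (k n)) {p. \<bar>snd p\<bar> > R} \<le> e" if e: "e > 0" for e
    proof -
      obtain i where "C / real (Suc i) < e" using small[OF e] by blast
      then have "\<forall>n. measure (\<mu> (k n)) {p. \<bar>snd p\<bar> > r i} \<le> e"
        using order_trans[OF \<mu>r less_imp_le] by blast
      then show ?thesis ..
    qed
    fix t x assume t: "t \<in> {0..T}" and x: "measure \<nu> (UNIV \<times> {x}) = 0"
    \<comment> \<open>As \<open>x\<close> carries no mass of \<open>\<nu>\<close>, the limit is
      squeezed between rational half-lines ending slightly to the left and to the right of
      \<open>x\<close>.\<close>
    let ?y = "\<lambda>n. x - inverse (real (Suc n))" and ?z = "\<lambda>n. x + inverse (real (Suc n))"
    have up: "(\<lambda>n. dfun \<nu> t (?z n)) \<longlonglongrightarrow> dfun \<nu> t x"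
    proof -
      have "(\<lambda>n. measure \<nu> ({..t} \<times> {..?z n})) \<longlonglongrightarrow> measure \<nu> (\<Inter>n. {..t} \<times> {..?z n})"
      proof (rule N.finite_Lim_measure_decseq)
        show "decseq (\<lambda>n. {..t} \<times> {..?z n})"
          unfolding decseq_def by (auto intro: order_trans le_imp_inverse_le)
      qed (auto simp: sets\<nu> intro!: rect_borel)
      moreover have "(\<Inter>n. {..t} \<times> {..?z n}) = {..t} \<times> {..x}"
      proof -
        have "z \<le> x" if "\<And>n. z \<le> ?z n" for z
        proof (rule LIMSEQ_le_const)
          show "?z \<longlonglongrightarrow> x" using tendsto_add[OF tendsto_const[of x] LIMSEQ_inverse_real_of_nat] by simp
        qed (use that in auto)
        moreover have "z \<le> ?z n" if "z \<le> x" for z n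
        proof -
          have "0 \<le> inverse (real (Suc n))" by simp
          then show ?thesis using that by linarith
        qed
        ultimately show ?thesis by (auto simp del: of_nat_Suc)
      qed
      ultimately show ?thesis by (simp add: dfun_def del: of_nat_Suc)
    qed
    have low: "(\<lambda>n. dfun \<nu> t (?y n)) \<longlonglongrightarrow> dfun \<nu> t x"
    proof -
      have "(\<lambda>n. measure \<nu> ({..t} \<times> {..?y n})) \<longlonglongrightarrow> measure \<nu> (\<Union>n. {..t} \<times> {..?y n})"
      proof (rule N.finite_Lim_measure_incseq)
        show "incseq (\<lambda>n. {..t} \<times> {..?y n})"
          unfolding incseq_def by (auto intro: order_trans diff_left_mono le_imp_inverse_le)
      qed (auto simp: sets\<nu> intro!: rect_borel)
      moreover have "(\<Union>n. {..t} \<times> {..?y n}) = {..t} \<times> {..<x}"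
      proof -
        have "\<exists>n. z \<le> ?y n" if "z < x" for z
          using reals_Archimedean[of "x - z"] that by (auto simp: algebra_simps intro: less_imp_le)
        moreover have "z < x" if "z \<le> ?y n" for z n
        proof -
          have "0 < inverse (real (Suc n))" by simp
          then show ?thesis using that by linarith
        qed
        ultimately show ?thesis by (auto simp del: of_nat_Suc)
      qed
      moreover have "measure \<nu> ({..t} \<times> {..<x}) = measure \<nu> ({..t} \<times> {..x})"
      proof -
        have "measure \<nu> ({..t} \<times> {..x}) \<le> measure \<nu> ({..t} \<times> {..<x} \<union> UNIV \<times> {x})"
          by (intro N.finite_measure_mono) (auto simp: sets\<nu> intro!: rect_borel sets.Un)
        also have "\<dots> \<le> measure \<nu> ({..t} \<times> {..<x}) + measure \<nu> (UNIV \<times> {x})"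
          by (intro measure_Un_le) (auto simp: sets\<nu> intro!: rect_borel)
        finally have "measure \<nu> ({..t} \<times> {..x}) \<le> measure \<nu> ({..t} \<times> {..<x})" using x by simp
        moreover have "measure \<nu> ({..t} \<times> {..<x}) \<le> measure \<nu> ({..t} \<times> {..x})"
          by (intro N.finite_measure_mono) (auto simp: sets\<nu> intro!: rect_borel)
        ultimately show ?thesis by simp
      qed
      ultimately show ?thesis by (simp add: dfun_def del: of_nat_Suc)
    qed
    show "(\<lambda>n. dfun (\<mu> (k n)) t x) \<longlonglongrightarrow> dfun \<nu> t x"
    proof (rule order_tendstoI)
      fix a assume "a < dfun \<nu> t x"
      then have "\<forall>\<^sub>F n in sequentially. a < dfun \<nu> t (?y n)" by (rule order_tendstoD[OF low])
      then obtain m where m: "a < dfun \<nu> t (?y m)" by (auto simp: eventually_sequentially)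
      have "?y m < x" by simp
      then obtain q where q: "?y m < real_of_rat q" "real_of_rat q < x" using of_rat_dense by blast
      have "a < g t q" using m \<nu>2[OF t q(1)] by linarith
      then have "\<forall>\<^sub>F n in sequentially. a < f n t (real_of_rat q)" by (rule order_tendstoD[OF g])
      then show "\<forall>\<^sub>F n in sequentially. a < dfun (\<mu> (k n)) t x"
      proof eventually_elim
        case (elim n)
        then show ?case using f_x[of "real_of_rat q" x n t] q(2) by (simp add: f_def)
      qed
    next
      fix a assume "dfun \<nu> t x < a"
      then have "\<forall>\<^sub>F n in sequentially. dfun \<nu> t (?z n) < a" by (rule order_tendstoD[OF up])
      then obtain m where m: "dfun \<nu> t (?z m) < a" by (auto simp: eventually_sequentially)
      have "x < ?z m" by simp
      then obtain q where q: "x < real_of_rat q" "real_of_rat q < ?z m" using of_rat_dense by blast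
      have "g t q < a" using m \<nu>1[OF t less_imp_le[OF q(2)]] by linarith
      then have "\<forall>\<^sub>F n in sequentially. f n t (real_of_rat q) < a" by (rule order_tendstoD[OF g])
      then show "\<forall>\<^sub>F n in sequentially. dfun (\<mu> (k n)) t x < a"
      proof eventually_elim
        case (elim n)
        then show ?case using f_x[of x "real_of_rat q" n t] q(1) by (simp add: f_def)
      qed
    qed
  qed
  \<comment> \<open>Closedness of \<open>K\<close>. The tail set is open, as its inequality is
    strict, so it is exhausted by closed sets \<open>?S m\<close> that have a neighbourhood inside
    the tail; this is lower semicontinuity on open sets.\<close>
  have "measure \<nu> {p. \<bar>snd p\<bar> > r i} \<le> C / real (Suc i)" for i
  proof -
    let ?S = "\<lambda>m. {p :: real \<times> real. \<bar>snd p\<bar> \<ge> r i + inverse (real (Suc m))}"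
    have cl: "closed (?S m)" for m by (intro closed_Collect_le continuous_intros)
    have "measure \<nu> (?S m) \<le> C / real (Suc i)" for m
    proof (rule field_le_epsilon)
      fix e :: real assume e: "e > 0"
      \<comment> \<open>Distances below \<open>1 / (m + 1)\<close> keep the neighbourhood inside the
        tail, and distances below \<open>e\<close> make the additive error small.\<close>
      define e' where "e' = min e (inverse (real (Suc m)))"
      have e': "e' > 0" "e' \<le> e" "e' \<le> inverse (real (Suc m))" using e by (auto simp: e'_def)
      obtain n where n: "levy_prokhorov (\<mu> (k n)) \<nu> < e'"
        using order_tendstoD(2)[OF lp e'(1)] by (auto simp: eventually_sequentially)
      then obtain d where d: "d < e'" "lp_close d (\<mu> (k n)) \<nu>"
        using levy_prokhorov_less_D[OF fin(1) MT_finite_measure(1)[OF \<nu>]] by blast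
      have "measure \<nu> (?S m) \<le> measure (\<mu> (k n)) {x. infdist x (?S m) < d} + d"
        using d(2) cl by (auto simp: lp_close_def)
      also have "measure (\<mu> (k n)) {x. infdist x (?S m) < d} \<le> measure (\<mu> (k n)) {p. \<bar>snd p\<bar> > r i}"
      proof (rule finite_measure.finite_measure_mono[OF fin(1)])
        show "{x. infdist x (?S m) < d} \<subseteq> {p. \<bar>snd p\<bar> > r i}"
        proof (rule subsetI, rule CollectI)
          fix x assume x: "x \<in> {x. infdist x (?S m) < d}"
          have "(0, \<bar>r i\<bar> + 1 + inverse (real (Suc m))) \<in> ?S m" by auto
          then have ne: "?S m \<noteq> {}" by blast
          obtain y where y: "y \<in> ?S m" "infdist x (?S m) = dist x y"
            using infdist_attains_inf[OF cl ne] by blast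
          have "\<bar>snd x - snd y\<bar> \<le> dist x y" using dist_snd_le[of x y] by (simp add: dist_real_def)
          then have "\<bar>snd x - snd y\<bar> < inverse (real (Suc m))" using x y(2) d(1) e'(3) by simp
          then show "\<bar>snd x\<bar> > r i" using y(1) by simp
        qed
      qed (use tail_borel in \<open>simp add: fin\<close>)
      also have "\<dots> \<le> C / real (Suc i)" by (rule \<mu>r)
      finally show "measure \<nu> (?S m) \<le> C / real (Suc i) + e" using d(1) e'(2) by linarith
    qed
    moreover have "(\<lambda>m. measure \<nu> (?S m)) \<longlonglongrightarrow> measure \<nu> (\<Union>m. ?S m)"
    proof (rule N.finite_Lim_measure_incseq)
      show "incseq ?S"
        unfolding incseq_def by (auto intro: order_trans[rotated] add_left_mono le_imp_inverse_le)
    qed (use cl in \<open>auto simp: sets\<nu> intro: borel_closed\<close>)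
    moreover have "(\<Union>m. ?S m) = {p. \<bar>snd p\<bar> > r i}"
    proof -
      have "\<exists>m. r i + inverse (real (Suc m)) \<le> z" if "r i < z" for z
        using reals_Archimedean[of "z - r i"] that by (auto simp: algebra_simps intro: less_imp_le)
      moreover have "r i < z" if "r i + inverse (real (Suc m)) \<le> z" for z m
      proof -
        have "0 < inverse (real (Suc m))" by simp
        then show ?thesis using that by linarith
      qed
      ultimately show ?thesis by (auto simp del: of_nat_Suc)
    qed
    ultimately show ?thesis by (intro LIMSEQ_le_const2[of "\<lambda>m. measure \<nu> (?S m)"]) auto
  qed
  then have "\<nu> \<in> K" using \<nu> by (simp add: K_def)
  then show ?thesis using k lp by blast
qed

section \<open>Exponential tightness\<close>

text \<open>The kernel at time \<open>t\<close> is the point mass at the current position of the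
  path.\<close>

lemma occ_measure_facts:
  assumes c: "continuous_on {0..T} (\<lambda>t. \<xi> t \<omega>)"
  shows "occ_measure T \<xi> \<omega> \<in> MT T"
    and "B \<in> sets borel \<Longrightarrow> measure (occ_measure T \<xi> \<omega>) (snd -` B) = measure lborel {t\<in>{0..T}. \<xi> t \<omega> \<in> B}"
proof -
  let ?R = "restrict_space lborel {0..T}"
  \<comment> \<open>A kernel must be defined at all times; extended by 0 the path is measurable on
    the whole line.\<close>
  define u where "u t = (if t \<in> {0..T} then \<xi> t \<omega> else 0)" for t
  have \<xi>m: "(\<lambda>t. \<xi> t \<omega>) \<in> borel_measurable (restrict_space lborel {0..T})"
    using borel_measurable_continuous_on_restrict[OF c] by (simp add: measurable_def space_restrict_space sets_restrict_space)
  have u[measurable]: "u \<in> borel_measurable lborel"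
    unfolding u_def using \<xi>m by (subst measurable_If_restrict_space_iff) (simp_all del: atLeastAtMost_iff)
  have um: "(\<lambda>t. (t, u t)) \<in> lborel \<rightarrow>\<^sub>M borel" unfolding borel_prod[symmetric] by measurable
  have m: "(\<lambda>t. (t, \<xi> t \<omega>)) \<in> ?R \<rightarrow>\<^sub>M borel"
  proof -
    have "(\<lambda>t. (t, u t)) \<in> ?R \<rightarrow>\<^sub>M borel" using um by (rule measurable_restrict_space1)
    then show ?thesis by (rule measurable_cong[THEN iffD1, rotated]) (simp add: u_def space_restrict_space)
  qed
  have em: "emeasure (occ_measure T \<xi> \<omega>) S = emeasure lborel {t\<in>{0..T}. (t, \<xi> t \<omega>) \<in> S}" if S: "S \<in> sets borel" for S
  proof -
    have "emeasure (occ_measure T \<xi> \<omega>) S = emeasure ?R ((\<lambda>t. (t, \<xi> t \<omega>)) -` S \<inter> space ?R)"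
      unfolding occ_measure_def by (rule emeasure_distr[OF m S])
    also have "\<dots> = emeasure lborel ((\<lambda>t. (t, \<xi> t \<omega>)) -` S \<inter> space ?R)"
      by (rule emeasure_restrict_space) (auto simp: space_restrict_space)
    also have "(\<lambda>t. (t, \<xi> t \<omega>)) -` S \<inter> space ?R = {t\<in>{0..T}. (t, \<xi> t \<omega>) \<in> S}"
      by (auto simp: space_restrict_space)
    finally show ?thesis .
  qed
  show "measure (occ_measure T \<xi> \<omega>) (snd -` B) = measure lborel {t\<in>{0..T}. \<xi> t \<omega> \<in> B}" if B: "B \<in> sets borel" for B
  proof -
    have "snd -` B = (UNIV :: real set) \<times> B" by auto
    moreover have "UNIV \<times> B \<in> sets (borel :: (real \<times> real) measure)" by (rule rect_borel[OF _ B]) simp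
    ultimately have "snd -` B \<in> sets (borel :: (real \<times> real) measure)" by (simp only:)
    from em[OF this] show ?thesis by (simp add: measure_def)
  qed
  show "occ_measure T \<xi> \<omega> \<in> MT T"
    unfolding MT_def
  proof (intro CollectI conjI exI[of _ "\<lambda>t. return borel (u t)"] allI ballI)
    fix S :: "(real \<times> real) set" assume S: "S \<in> sets borel"
    have sl: "Pair t -` S \<in> sets borel" for t
    proof -
      have "S \<in> sets ((borel :: real measure) \<Otimes>\<^sub>M (borel :: real measure))" using S unfolding borel_prod .
      then show ?thesis by (rule sets_Pair1)
    qed
    have e: "emeasure (return borel (u t)) (Pair t -` S) = indicator S (t, u t)" for t
      using sl[of t] by (simp add: indicator_def)
    have im: "(\<lambda>t. indicator S (t, u t) :: ennreal) \<in> borel_measurable lborel"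
      using measurable_compose[OF um borel_measurable_indicator[OF S]] .
    then show "(\<lambda>t. emeasure (return borel (u t)) (Pair t -` S)) \<in> borel_measurable lborel" unfolding e .
    have "(\<lambda>t. (t, u t)) -` S \<inter> space lborel \<in> sets lborel" by (rule measurable_sets[OF um S])
    moreover have eq: "{t\<in>{0..T}. (t, \<xi> t \<omega>) \<in> S} = {0..T} \<inter> ((\<lambda>t. (t, u t)) -` S \<inter> space lborel)" by (auto simp: u_def)
    ultimately have "{t\<in>{0..T}. (t, \<xi> t \<omega>) \<in> S} \<in> sets lborel" by auto
    then have "emeasure lborel {t\<in>{0..T}. (t, \<xi> t \<omega>) \<in> S} = (\<integral>\<^sup>+t. indicator {t\<in>{0..T}. (t, \<xi> t \<omega>) \<in> S} t \<partial>lborel)"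
      by (rule nn_integral_indicator[symmetric])
    also have "\<dots> = (\<integral>\<^sup>+t. indicator {0..T} t * emeasure (return borel (u t)) (Pair t -` S) \<partial>lborel)"
      unfolding e by (intro nn_integral_cong) (auto simp: u_def split: split_indicator)
    finally show "emeasure (occ_measure T \<xi> \<omega>) S = (\<integral>\<^sup>+t. indicator {0..T} t * emeasure (return borel (u t)) (Pair t -` S) \<partial>lborel)"
      using em[OF S] by simp
  qed (auto simp: occ_measure_def prob_space_return)
qed

lemma path_on_CT: "continuous_on {0..T} (\<lambda>t. X t \<omega>) \<Longrightarrow> path_on T X \<omega> \<in> CT T"
  by (auto simp: path_on_def CT_def cong: continuous_on_cong_simp)

section \<open>Outer probability and the logarithmic scale\<close>

lemma outer_prob_le: "B \<in> sets M \<Longrightarrow> E \<subseteq> B \<Longrightarrow> outer_prob M E \<le> measure M B"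
  unfolding outer_prob_def by (intro cInf_lower bdd_belowI[of _ 0]) auto

lemma outer_prob_nonneg: "E \<subseteq> space M \<Longrightarrow> 0 \<le> outer_prob M E"
  unfolding outer_prob_def by (intro cInf_greatest) auto

lemma outer_prob_mono:
  assumes "E \<subseteq> E'" "E' \<subseteq> space M"
  shows "outer_prob M E \<le> outer_prob M E'"
  unfolding outer_prob_def using assms
  by (intro cInf_superset_mono bdd_belowI[of _ 0]) auto

text \<open>\<open>\<epsilon> * ln (c * exp (- r / \<epsilon>))\<close> equals
  \<open>\<epsilon> * ln c - r\<close>: the constant \<open>c\<close> disappears in the limit,
  however large.\<close>

lemma Limsup_eps_log_le:
  assumes c: "c > 0" and p: "\<And>\<epsilon>. 0 < \<epsilon> \<Longrightarrow> \<epsilon> \<le> 1 \<Longrightarrow> 0 \<le> p \<epsilon> \<and> p \<epsilon> \<le> c * exp (- r / \<epsilon>)"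
  shows "Limsup (at_right 0) (\<lambda>\<epsilon>. eps_log \<epsilon> (p \<epsilon>)) \<le> ereal (- r)"
proof -
  have "Limsup (at_right 0) (\<lambda>\<epsilon>. eps_log \<epsilon> (p \<epsilon>)) \<le> Limsup (at_right 0) (\<lambda>\<epsilon>. ereal (\<epsilon> * ln c - r))"
  proof (rule Limsup_mono)
    have "\<forall>\<^sub>F \<epsilon> in at_right (0::real). \<epsilon> \<in> {0<..<1}" by (rule eventually_at_right_real) simp
    then show "\<forall>\<^sub>F \<epsilon> in at_right 0. eps_log \<epsilon> (p \<epsilon>) \<le> ereal (\<epsilon> * ln c - r)"
    proof eventually_elim
      case (elim \<epsilon>)
      show ?case
      proof (cases "p \<epsilon> = 0")
        case False
        then have pos: "p \<epsilon> > 0" "p \<epsilon> \<le> c * exp (- r / \<epsilon>)" using p[of \<epsilon>] elim by auto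
        then have "ln (p \<epsilon>) \<le> ln (c * exp (- r / \<epsilon>))" using c by simp
        also have "\<dots> = ln c - r / \<epsilon>" using c by (simp add: ln_mult)
        finally have "\<epsilon> * ln (p \<epsilon>) \<le> \<epsilon> * (ln c - r / \<epsilon>)" using elim by (intro mult_left_mono) auto
        also have "\<dots> = \<epsilon> * ln c - r" using elim by (simp add: right_diff_distrib)
        finally show ?thesis using False by (simp add: eps_log_def)
      qed (simp add: eps_log_def)
    qed
  qed
  also have "\<dots> = ereal (- r)"
  proof (rule lim_imp_Limsup)
    have "((\<lambda>\<epsilon>. \<epsilon> * ln c - r) \<longlongrightarrow> 0 * ln c - r) (at_right 0)" by (intro tendsto_intros)
    then show "((\<lambda>\<epsilon>. ereal (\<epsilon> * ln c - r)) \<longlongrightarrow> ereal (- r)) (at_right 0)" by (intro tendsto_ereal) simp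
  qed (simp add: trivial_limit_at_right_real)
  finally show ?thesis .
qed

text \<open>\<psi> is \<open>- f' * b\<close> for \<open>f z = sqrt (1 + z\<^sup>2)\<close>. Far out
  \<open>f'\<close> is close to the sign, so the drift condition makes \<psi> tend to infinity; near
  the origin it may be negative, which \<beta> repairs. The radii depend on \<open>b\<close> alone
  and serve every \<epsilon> and every rate.\<close>

lemma drift_potential:
  fixes b :: "real \<Rightarrow> real"
  assumes b: "continuous_on UNIV b" and drift: "filterlim (\<lambda>z. b z * sgn z) at_bot at_infinity"
  defines "\<psi> \<equiv> \<lambda>z. - (z / sqrt (1 + z\<^sup>2)) * b z"
  shows "continuous_on UNIV \<psi>"
    and "\<exists>\<beta>\<ge>0. (\<forall>z. 0 \<le> \<psi> z + \<beta>) \<and> (\<exists>r :: nat \<Rightarrow> real. \<forall>i z. \<bar>z\<bar> > r i \<longrightarrow> \<psi> z + \<beta> \<ge> real (Suc i))"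
proof -
  have s0: "sqrt (1 + z\<^sup>2) \<noteq> 0" for z :: real
    using real_sqrt_gt_zero[of "1 + z\<^sup>2"] by (metis add_pos_nonneg less_irrefl zero_le_power2 zero_less_one)
  show c: "continuous_on UNIV \<psi>" unfolding \<psi>_def by (intro continuous_intros b ballI s0)
  have big: "\<exists>R. \<forall>z. \<bar>z\<bar> > R \<longrightarrow> \<psi> z \<ge> Q" if Q: "Q \<ge> 0" for Q
  proof -
    have "\<forall>\<^sub>F z in at_infinity. b z * sgn z \<le> - (2 * Q)" using drift by (auto simp: filterlim_at_bot)
    then obtain R where R: "\<And>z. R \<le> \<bar>z\<bar> \<Longrightarrow> b z * sgn z \<le> - (2 * Q)" by (auto simp: eventually_at_infinity)
    have "\<psi> z \<ge> Q" if z: "\<bar>z\<bar> > max R 1" for z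
    proof -
      \<comment> \<open>Beyond 1 the slope of \<open>f\<close> is at least 1/2 in absolute value,
        which explains the factor 2 in the bound requested of \<open>b\<close>.\<close>
      have "sqrt (1 + z\<^sup>2) \<le> 2 * \<bar>z\<bar>"
      proof (rule real_le_lsqrt)
        have "1 \<le> z\<^sup>2" using z power_mono[of 1 "\<bar>z\<bar>" 2] by simp
        then show "1 + z\<^sup>2 \<le> (2 * \<bar>z\<bar>)\<^sup>2" by (simp add: power_mult_distrib)
      qed auto
      moreover have "sqrt (1 + z\<^sup>2) > 0" by (simp add: add_pos_nonneg)
      ultimately have h: "1 / 2 \<le> \<bar>z\<bar> / sqrt (1 + z\<^sup>2)" by (simp add: field_simps)
      have "Q = 1 / 2 * (2 * Q)" by simp
      also have "\<dots> \<le> \<bar>z\<bar> / sqrt (1 + z\<^sup>2) * - (b z * sgn z)"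
        using R[of z] z h Q by (intro mult_mono) auto
      also have "\<dots> = \<psi> z"
        by (cases "z > 0"; cases "z = 0") (auto simp: \<psi>_def sgn_if)
      finally show ?thesis .
    qed
    then show ?thesis by blast
  qed
  obtain R where R: "\<And>z. \<bar>z\<bar> > R \<Longrightarrow> \<psi> z \<ge> 0" using big[of 0] by auto
  have "bounded (\<psi> ` {- R..R})"
    by (intro compact_imp_bounded compact_continuous_image continuous_on_subset[OF c]) auto
  then obtain \<beta> where \<beta>: "\<beta> > 0" "\<And>z. z \<in> {- R..R} \<Longrightarrow> \<bar>\<psi> z\<bar> \<le> \<beta>" unfolding bounded_pos by auto
  have low: "0 \<le> \<psi> z + \<beta>" for z
  proof (cases "\<bar>z\<bar> > R")
    case True then show ?thesis using R[of z] \<beta>(1) by simp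
  next
    case False
    then have "z \<in> {- R..R}" by auto
    from \<beta>(2)[OF this] show ?thesis by linarith
  qed
  have "\<forall>i::nat. \<exists>r. \<forall>z. \<bar>z\<bar> > r \<longrightarrow> \<psi> z \<ge> real (Suc i)" using big by simp
  then obtain r where "\<And>i z. \<bar>z\<bar> > r i \<Longrightarrow> \<psi> z \<ge> real (Suc i)" by metis
  then have "\<psi> z + \<beta> \<ge> real (Suc i)" if "\<bar>z\<bar> > r i" for i z
    using that \<beta>(1) by (meson add_increasing2 less_imp_le)
  then show "\<exists>\<beta>\<ge>0. (\<forall>z. 0 \<le> \<psi> z + \<beta>) \<and> (\<exists>r :: nat \<Rightarrow> real. \<forall>i z. \<bar>z\<bar> > r i \<longrightarrow> \<psi> z + \<beta> \<ge> real (Suc i))"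
    using low \<beta>(1) less_imp_le by blast
qed

text \<open>Markov's inequality for the nonnegative function \<open>\<psi> z + \<beta>\<close> along
  the path.\<close>

lemma occ_measure_tail:
  fixes \<psi> :: "real \<Rightarrow> real"
  assumes T: "T > 0" and c: "continuous_on {0..T} (\<lambda>t. \<xi> t \<omega>)" and \<psi>: "continuous_on UNIV \<psi>"
    and \<psi>0: "\<And>z. 0 \<le> \<psi> z + \<beta>" and \<psi>k: "\<And>z. \<bar>z\<bar> > R \<Longrightarrow> k \<le> \<psi> z + \<beta>" and k: "k > 0"
    and I: "integral {0..T} (\<lambda>t. \<psi> (\<xi> t \<omega>)) \<le> C"
  shows "measure (occ_measure T \<xi> \<omega>) {p. \<bar>snd p\<bar> > R} \<le> (C + \<beta> * T) / k"
proof -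
  let ?B = "{z :: real. \<bar>z\<bar> > R}" and ?E = "{t\<in>{0..T}. \<bar>\<xi> t \<omega>\<bar> > R}"
  have B: "?B \<in> sets borel" by (intro borel_open open_Collect_less continuous_intros)
  have cont: "continuous_on {0..T} (\<lambda>t. \<psi> (\<xi> t \<omega>) + \<beta>)"
    by (intro continuous_intros continuous_on_compose2[OF \<psi> c]) auto
  have si: "set_integrable lborel {0..T} (\<lambda>t. \<psi> (\<xi> t \<omega>) + \<beta>)"
    by (rule borel_integrable_atLeastAtMost'[OF cont])
  have E: "?E \<in> sets lborel"
  proof -
    have "(\<lambda>t. \<xi> t \<omega>) \<in> borel_measurable (restrict_space borel {0..T})"
      by (rule borel_measurable_continuous_on_restrict[OF c])
    from measurable_sets[OF this B] have "?E \<in> sets (restrict_space borel {0..T})"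
      by (simp add: vimage_def space_restrict_space Int_def conj_commute)
    then show ?thesis by (auto simp: sets_restrict_space)
  qed
  have Efin: "emeasure lborel ?E < \<infinity>"
  proof -
    have "emeasure lborel ?E \<le> emeasure lborel {0..T}" by (intro emeasure_mono) auto
    also have "\<dots> < \<infinity>" by (simp add: emeasure_lborel_Icc_eq)
    finally show ?thesis .
  qed
  have "k * measure lborel ?E = (\<integral>t. k * indicator ?E t \<partial>lborel)" using E Efin by simp
  also have "\<dots> \<le> (LINT t:{0..T}|lborel. \<psi> (\<xi> t \<omega>) + \<beta>)"
    unfolding set_lebesgue_integral_def
  proof (rule integral_mono)
    show "integrable lborel (\<lambda>t. k * indicator ?E t)" using E Efin by simp
    show "integrable lborel (\<lambda>t. indicator {0..T} t *\<^sub>R (\<psi> (\<xi> t \<omega>) + \<beta>))" using si by (simp add: set_integrable_def)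
    show "k * indicator ?E t \<le> indicator {0..T} t *\<^sub>R (\<psi> (\<xi> t \<omega>) + \<beta>)" for t
      using \<psi>0[of "\<xi> t \<omega>"] \<psi>k[of "\<xi> t \<omega>"] by (auto simp: indicator_def)
  qed
  also have "\<dots> = integral {0..T} (\<lambda>t. \<psi> (\<xi> t \<omega>) + \<beta>)" by (rule set_borel_integral_eq_integral(2)[OF si])
  also have "\<dots> = integral {0..T} (\<lambda>t. \<psi> (\<xi> t \<omega>)) + integral {0..T} (\<lambda>t. \<beta>)"
    by (intro Henstock_Kurzweil_Integration.integral_add integrable_continuous_real continuous_on_compose2[OF \<psi> c]) auto
  also have "\<dots> \<le> C + \<beta> * T" using I T by simp
  finally have "measure lborel ?E \<le> (C + \<beta> * T) / k" using k by (simp add: field_simps)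
  moreover have "{p :: real \<times> real. \<bar>snd p\<bar> > R} = snd -` ?B" by auto
  ultimately show ?thesis using occ_measure_facts(2)[of T \<xi> \<omega> ?B, OF c B] by simp
qed

theorem theorem4p1:
  fixes M :: "'w measure" and F :: "real \<Rightarrow> 'w set set"
    and W V :: "real \<Rightarrow> 'w \<Rightarrow> real"
    and A B :: "real \<Rightarrow> real \<Rightarrow> real" and b \<sigma> :: "real \<Rightarrow> real"
    and x0 z0 T :: real
    and X \<xi> :: "real \<Rightarrow> real \<Rightarrow> 'w \<Rightarrow> real"
  assumes fps: "filtered_prob_space M F"
    and wiener: "indep_wiener_pair M F W V"
    and A1_cont: "continuous_on UNIV (\<lambda>(x, z). A x z)" "continuous_on UNIV (\<lambda>(x, z). B x z)"
    and A1_lip: "\<exists>L. \<forall>x y z. \<bar>A x z - A y z\<bar> \<le> L * \<bar>x - y\<bar> \<and> \<bar>B x z - B y z\<bar> \<le> L * \<bar>x - y\<bar>"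
    and A1_bdd: "\<exists>C. \<forall>z. \<bar>A 0 z\<bar> + \<bar>B 0 z\<bar> \<le> C"
    and A2_bdd: "\<exists>c C. 0 < c \<and> (\<forall>z. c \<le> (\<sigma> z)\<^sup>2 \<and> (\<sigma> z)\<^sup>2 \<le> C)"
    and A2_diff: "\<exists>\<sigma>'. (\<forall>z. (\<sigma> has_real_derivative \<sigma>' z) (at z)) \<and>
                    (\<exists>C. \<forall>z. \<bar>\<sigma>' z\<bar> \<le> C) \<and>
                    (\<exists>L. \<forall>y z. \<bar>\<sigma>' y - \<sigma>' z\<bar> \<le> L * \<bar>y - z\<bar>)"
    and A3_lip: "\<exists>L. \<forall>y z. \<bar>b y - b z\<bar> \<le> L * \<bar>y - z\<bar>"
    and A3_drift: "filterlim (\<lambda>z. b z * sgn z) at_bot at_infinity"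
    and sol: "\<And>\<epsilon>. \<epsilon> > 0 \<Longrightarrow> sde_solution M F W V A B b \<sigma> \<epsilon> x0 z0 (X \<epsilon>) (\<xi> \<epsilon>)"
    and T: "T > 0"
  shows "\<exists>K :: nat \<Rightarrow> ((real \<Rightarrow> real) \<times> (real \<times> real) measure) set.
           incseq K \<and> (\<forall>j. compactin (CM_topology T) (K j)) \<and>
           ((\<lambda>j. Limsup (at_right 0) (\<lambda>\<epsilon>. eps_log \<epsilon>
               (outer_prob M {\<omega>\<in>space M. (path_on T (X \<epsilon>) \<omega>, occ_measure T (\<xi> \<epsilon>) \<omega>) \<notin> K j})))
            \<longlonglongrightarrow> -\<infinity>)"
proof -
  have fil: "filtration_space M F"
    using fps unfolding filtered_prob_space_def by (intro filtration_space.intro filtration_space_axioms.intro) auto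
  interpret filtration_space M F by (rule fil)
  note W = brownian_of_wiener_pair(1)[OF fil wiener] and V = brownian_of_wiener_pair(2)[OF fil wiener]
  have bc: "continuous_on UNIV b"
  proof -
    obtain L where L: "\<And>y z. \<bar>b y - b z\<bar> \<le> L * \<bar>y - z\<bar>" using A3_lip by blast
    have "(max L 0)-lipschitz_on UNIV b"
    proof (rule lipschitz_onI)
      show "dist (b y) (b z) \<le> max L 0 * dist y z" for y z
        using L[of y z] mult_right_mono[of L "max L 0" "\<bar>y - z\<bar>"] by (simp add: dist_real_def)
    qed simp
    then show ?thesis by (rule lipschitz_on_continuous_on)
  qed
  have \<sigma>c: "continuous_on UNIV \<sigma>"
    using A2_diff by (metis DERIV_isCont continuous_at_imp_continuous_on)
  obtain C where C: "C > 0" "\<And>z. (\<sigma> z)\<^sup>2 \<le> C"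
  proof -
    obtain c C where "0 < c" "\<forall>z. c \<le> (\<sigma> z)\<^sup>2 \<and> (\<sigma> z)\<^sup>2 \<le> C" using A2_bdd by blast
    then show ?thesis by (intro that[of C]) (auto intro: less_le_trans order_trans)
  qed
  \<comment> \<open>Linear growth uniformly in \<open>z\<close>, from the Lipschitz condition and
    the bound at \<open>x = 0\<close>.\<close>
  obtain C0 where C0: "C0 > 0" "\<And>x z. \<bar>A x z\<bar> \<le> C0 * (1 + \<bar>x\<bar>)" "\<And>x z. \<bar>B x z\<bar> \<le> C0 * (1 + \<bar>x\<bar>)"
  proof -
    obtain L where L: "\<And>x y z. \<bar>A x z - A y z\<bar> \<le> L * \<bar>x - y\<bar> \<and> \<bar>B x z - B y z\<bar> \<le> L * \<bar>x - y\<bar>" using A1_lip by blast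
    obtain D where D: "\<And>z. \<bar>A 0 z\<bar> + \<bar>B 0 z\<bar> \<le> D" using A1_bdd by blast
    let ?C = "max (max L D) 1"
    have b: "L * \<bar>x\<bar> + D \<le> ?C * (1 + \<bar>x\<bar>)" for x :: real
      using mult_right_mono[of L ?C "\<bar>x\<bar>"] by (simp add: ring_distribs) linarith
    show ?thesis
    proof (rule that[of ?C])
      show "\<bar>A x z\<bar> \<le> ?C * (1 + \<bar>x\<bar>)" "\<bar>B x z\<bar> \<le> ?C * (1 + \<bar>x\<bar>)" for x z
        using L[of x z 0] D[of z] b[of x] by simp_all linarith+
    qed simp
  qed
  define \<psi> where "\<psi> z = - (z / sqrt (1 + z\<^sup>2)) * b z" for z
  have \<psi>c: "continuous_on UNIV \<psi>" unfolding \<psi>_def by (rule drift_potential(1)[OF bc A3_drift])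
  obtain \<beta> r where \<beta>: "\<beta> \<ge> 0" "\<And>z. 0 \<le> \<psi> z + \<beta>" and r: "\<And>(i::nat) z. \<bar>z\<bar> > r i \<Longrightarrow> real (Suc i) \<le> \<psi> z + \<beta>"
    using drift_potential(2)[OF bc A3_drift] unfolding \<psi>_def by blast
  \<comment> \<open>One product of compact sets for each rate \<open>j\<close>; the constant in
    front may depend on \<open>j\<close> but not on \<epsilon>.\<close>
  have level: "\<exists>K. compactin (CM_topology T) K \<and> (\<exists>c>0. \<forall>\<epsilon>. 0 < \<epsilon> \<longrightarrow> \<epsilon> \<le> 1 \<longrightarrow>
      outer_prob M {\<omega>\<in>space M. (path_on T (X \<epsilon>) \<omega>, occ_measure T (\<xi> \<epsilon>) \<omega>) \<notin> K} \<le> c * exp (- real j / \<epsilon>))" for j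
  proof -
    \<comment> \<open>Solves \<open>c\<^sup>2 / (8 * C0\<^sup>2 * T) = 16 + j\<close>: the rate
      \<open>j\<close>, and 16 for the summation over all scales.\<close>
    define c where "c = sqrt (8 * C0\<^sup>2 * T * (16 + real j))"
    have c: "c > 0" using C0 T by (simp add: c_def)
    have \<kappa>: "16 + real j = c\<^sup>2 / (8 * C0\<^sup>2 * T)" "16 + real j \<ge> 16" using C0 T by (simp_all add: c_def)
    define D where "D = 2 * C0 * T + c"
    have D: "D > 0" using C0 T c by (simp add: D_def add_pos_pos)
    obtain m0 :: nat where m0: "7 * D * (3/4)^m0 < 3/4"
    proof -
      have "(\<lambda>m. 7 * D * (3/4::real)^m) \<longlonglongrightarrow> 7 * D * 0" by (intro tendsto_intros LIMSEQ_realpow_zero) auto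
      then have "\<forall>\<^sub>F m in sequentially. 7 * D * (3/4::real)^m < 3/4" by (intro order_tendstoD) auto
      then show ?thesis using that by (auto simp: eventually_sequentially)
    qed
    \<comment> \<open>With \<open>\<mu> = 1\<close> both exponents of the fast estimate become
      \<open>- j / \<epsilon>\<close>.\<close>
    define a1 a2 where "a1 = sqrt (2 * C * T * real j)" and "a2 = 2 * C * T + real j"
    have a1: "a1 \<ge> 0" "a1\<^sup>2 = 2 * C * T * real j" using C T by (simp_all add: a1_def)
    define S where "S = sqrt (1 + z0\<^sup>2) + a1 + a2 + 1"
    define d where "d = D * (4^(2^m0) * (1 + \<bar>x0\<bar>))"
    have d: "d \<ge> 0" using D by (simp add: d_def)
    define K1 where "K1 = {f\<in>CT T. f 0 = x0 \<and> dyadic_increments T T d f}"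
    define K2 where "K2 = {\<nu>\<in>MT T. \<forall>i. measure \<nu> {p. \<bar>snd p\<bar> > r i} \<le> (S + \<beta> * T) / real (Suc i)}"
    have "compactin (CM_topology T) (K1 \<times> K2)"
    proof (rule compactin_CM_topology_Times)
      show "\<exists>g\<in>K1. \<exists>r. strict_mono r \<and> (\<lambda>n. rT T (f (r n)) g) \<longlonglongrightarrow> 0" if "range f \<subseteq> K1" for f :: "nat \<Rightarrow> real \<Rightarrow> real"
        using dyadic_increments_sequentially_compact[OF T d that[unfolded K1_def]] by (simp add: K1_def)
      show "\<exists>\<nu>\<in>K2. \<exists>r. strict_mono r \<and> (\<lambda>n. levy_prokhorov (\<mu> (r n)) \<nu>) \<longlonglongrightarrow> 0" if "range \<mu> \<subseteq> K2" for \<mu> :: "nat \<Rightarrow> (real \<times> real) measure"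
        using tight_sequentially_compact[OF T that[unfolded K2_def]] by (simp add: K2_def)
    qed (use T in \<open>auto simp: K1_def K2_def\<close>)
    moreover have "outer_prob M {\<omega>\<in>space M. (path_on T (X \<epsilon>) \<omega>, occ_measure T (\<xi> \<epsilon>) \<omega>) \<notin> K1 \<times> K2}
        \<le> (real (Suc (2^m0)) * 4 + 2) * exp (- real j / \<epsilon>)" if \<epsilon>: "0 < \<epsilon>" "\<epsilon> \<le> 1" for \<epsilon>
    proof -
      have s: "sde_solution M F W V A B b \<sigma> \<epsilon> x0 z0 (X \<epsilon>) (\<xi> \<epsilon>)" by (rule sol[OF \<epsilon>(1)])
      have Xm: "\<And>t. 0 \<le> t \<Longrightarrow> X \<epsilon> t \<in> borel_measurable (G t)" and \<xi>m: "\<And>t. 0 \<le> t \<Longrightarrow> \<xi> \<epsilon> t \<in> borel_measurable (G t)"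
        using s by (auto simp: sde_solution_def intro: adapted_proc_measurable)
      have Xc: "\<And>\<omega>. \<omega> \<in> space M \<Longrightarrow> continuous_on {0..} (\<lambda>t. X \<epsilon> t \<omega>)"
        and \<xi>c: "\<And>\<omega>. \<omega> \<in> space M \<Longrightarrow> continuous_on {0..} (\<lambda>t. \<xi> \<epsilon> t \<omega>)"
        using s by (auto simp: sde_solution_def)
      have eq: "\<exists>I J. is_ito_integral M (\<lambda>s \<omega>. B (X \<epsilon> s \<omega>) (\<xi> \<epsilon> s \<omega>)) W t I \<and>
        is_ito_integral M (\<lambda>s \<omega>. \<sigma> (\<xi> \<epsilon> s \<omega>)) V t J \<and>
        (AE \<omega> in M.
           X \<epsilon> t \<omega> = x0 + integral {0..t} (\<lambda>s. A (X \<epsilon> s \<omega>) (\<xi> \<epsilon> s \<omega>)) + sqrt \<epsilon> * I \<omega> \<and>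
           \<xi> \<epsilon> t \<omega> = z0 + integral {0..t} (\<lambda>s. b (\<xi> \<epsilon> s \<omega>) / \<epsilon>) + J \<omega> / sqrt \<epsilon>)" if "0 \<le> t" for t
        using s that unfolding sde_solution_def by blast
      \<comment> \<open>Both equations stand under one almost sure statement and share their
        quantifiers; each component's estimate takes its own.\<close>
      have pick: "(\<exists>I. P I \<and> (AE \<omega> in M. R I \<omega>)) \<and> (\<exists>J. Q J \<and> (AE \<omega> in M. R' J \<omega>))"
        if "\<exists>I J. P I \<and> Q J \<and> (AE \<omega> in M. R I \<omega> \<and> R' J \<omega>)" for P Q :: "('w \<Rightarrow> real) \<Rightarrow> bool" and R R'
        using that unfolding AE_conj_iff by blast
      have eqX: "\<exists>I. is_ito_integral M (\<lambda>s \<omega>. B (X \<epsilon> s \<omega>) (\<xi> \<epsilon> s \<omega>)) W t I \<and>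
        (AE \<omega> in M. X \<epsilon> t \<omega> = x0 + integral {0..t} (\<lambda>s. A (X \<epsilon> s \<omega>) (\<xi> \<epsilon> s \<omega>)) + sqrt \<epsilon> * I \<omega>)" if t: "0 \<le> t" for t
        by (rule pick[OF eq[OF t], THEN conjunct1])
      have eq\<xi>: "\<exists>J. is_ito_integral M (\<lambda>s \<omega>. \<sigma> (\<xi> \<epsilon> s \<omega>)) V t J \<and>
        (AE \<omega> in M. \<xi> \<epsilon> t \<omega> = z0 + integral {0..t} (\<lambda>s. b (\<xi> \<epsilon> s \<omega>) / \<epsilon>) + J \<omega> / sqrt \<epsilon>)" if t: "0 \<le> t" for t
        by (rule pick[OF eq[OF t], THEN conjunct2])
      have "\<exists>E\<in>sets M. measure M E \<le> real (Suc (2^m0)) * (4 * exp (- (16 + real j) / \<epsilon>)) \<and>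
        (\<forall>\<omega>\<in>space M - E. X \<epsilon> 0 \<omega> = x0 \<and> dyadic_increments T T d (\<lambda>t. X \<epsilon> t \<omega>))"
        unfolding d_def D_def
        by (rule slow_increments_tail[OF W T \<epsilon> Xm Xc \<xi>m \<xi>c A1_cont C0 eqX c \<kappa> m0[unfolded D_def]])
      then obtain E where E: "E \<in> sets M" "measure M E \<le> real (Suc (2^m0)) * (4 * exp (- (16 + real j) / \<epsilon>))"
        and EX: "\<forall>\<omega>\<in>space M - E. X \<epsilon> 0 \<omega> = x0 \<and> dyadic_increments T T d (\<lambda>t. X \<epsilon> t \<omega>)"
        by (elim bexE conjE)
      define E' where "E' = {\<omega>\<in>space M. integral {0..T} (\<lambda>t. \<psi> (\<xi> \<epsilon> t \<omega>)) > S}"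
      have E': "E' \<in> sets M" "measure M E' \<le> exp (- a1\<^sup>2 / (2 * \<epsilon> * C * T)) + exp (2 * 1 * C * T / \<epsilon> - 1 * a2 / \<epsilon>)"
        unfolding E'_def S_def \<psi>_def
        by (rule fast_occupation_tail(1)[OF V T \<epsilon> bc \<xi>m \<xi>c \<sigma>c C eq\<xi> a1(1) zero_less_one]; assumption)
          (rule fast_occupation_tail(2)[OF V T \<epsilon> bc \<xi>m \<xi>c \<sigma>c C eq\<xi> a1(1) zero_less_one]; assumption)
      \<comment> \<open>The exit event is only shown to lie in the measurable set
        \<open>E \<union> E'\<close>, which is all that an outer probability asks for.\<close>
      have "outer_prob M {\<omega>\<in>space M. (path_on T (X \<epsilon>) \<omega>, occ_measure T (\<xi> \<epsilon>) \<omega>) \<notin> K1 \<times> K2} \<le> measure M (E \<union> E')"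
      proof (rule outer_prob_le)
        show "{\<omega>\<in>space M. (path_on T (X \<epsilon>) \<omega>, occ_measure T (\<xi> \<epsilon>) \<omega>) \<notin> K1 \<times> K2} \<subseteq> E \<union> E'"
        proof (rule subsetI, rule ccontr)
          fix \<omega> assume om: "\<omega> \<in> {\<omega>\<in>space M. (path_on T (X \<epsilon>) \<omega>, occ_measure T (\<xi> \<epsilon>) \<omega>) \<notin> K1 \<times> K2}" "\<omega> \<notin> E \<union> E'"
          then have omM: "\<omega> \<in> space M" by simp
          have Xc': "continuous_on {0..T} (\<lambda>t. X \<epsilon> t \<omega>)" and \<xi>c': "continuous_on {0..T} (\<lambda>t. \<xi> \<epsilon> t \<omega>)"
            by (rule continuous_on_subset[OF Xc[OF omM]], simp) (rule continuous_on_subset[OF \<xi>c[OF omM]], simp)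
          have x: "X \<epsilon> 0 \<omega> = x0" "dyadic_increments T T d (\<lambda>t. X \<epsilon> t \<omega>)" using bspec[OF EX, of \<omega>] om by auto
          have "dyadic_increments T T d (path_on T (X \<epsilon>) \<omega>)"
            unfolding dyadic_increments_def
          proof (intro allI impI)
            fix m i assume i: "real (Suc i) * (T / 2^m) \<le> T"
            have "0 \<le> real i * (T / 2^m)" "real i * (T / 2^m) \<le> real (Suc i) * (T / 2^m)"
              using T mult_right_mono[of "real i" "real (Suc i)" "T / 2^m"] by auto
            then have "path_on T (X \<epsilon>) \<omega> (real (Suc i) * (T / 2^m)) = X \<epsilon> (real (Suc i) * (T / 2^m)) \<omega>"
              "path_on T (X \<epsilon>) \<omega> (real i * (T / 2^m)) = X \<epsilon> (real i * (T / 2^m)) \<omega>"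
              using i unfolding path_on_def by (auto simp del: of_nat_Suc)
            then show "\<bar>path_on T (X \<epsilon>) \<omega> (real (Suc i) * (T / 2^m)) - path_on T (X \<epsilon>) \<omega> (real i * (T / 2^m))\<bar> \<le> d * (3/4)^m"
              using x(2) i unfolding dyadic_increments_def by simp
          qed
          moreover have "path_on T (X \<epsilon>) \<omega> 0 = x0" using x(1) T by (simp add: path_on_def)
          ultimately have "path_on T (X \<epsilon>) \<omega> \<in> K1" using path_on_CT[of T "X \<epsilon>" \<omega>, OF Xc'] by (simp add: K1_def)
          moreover have "occ_measure T (\<xi> \<epsilon>) \<omega> \<in> K2"
          proof -
            have "integral {0..T} (\<lambda>t. \<psi> (\<xi> \<epsilon> t \<omega>)) \<le> S" using om omM by (auto simp: E'_def not_less)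
            then have "measure (occ_measure T (\<xi> \<epsilon>) \<omega>) {p. \<bar>snd p\<bar> > r i} \<le> (S + \<beta> * T) / real (Suc i)" for i
              by (intro occ_measure_tail[of T "\<xi> \<epsilon>" \<omega>, OF T \<xi>c' \<psi>c \<beta>(2) r]) auto
            then show ?thesis using occ_measure_facts(1)[of T "\<xi> \<epsilon>" \<omega>, OF \<xi>c'] by (simp add: K2_def)
          qed
          ultimately show False using om by simp
        qed
      qed (use E E' in auto)
      also have "\<dots> \<le> measure M E + measure M E'" using E E' by (intro measure_Un_le)
      also have "\<dots> \<le> real (Suc (2^m0)) * (4 * exp (- real j / \<epsilon>)) + (exp (- real j / \<epsilon>) + exp (- real j / \<epsilon>))"
      proof (intro add_mono)
        have "- (16 + real j) / \<epsilon> \<le> - real j / \<epsilon>" using \<epsilon> by (intro divide_right_mono) auto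
        then have "exp (- (16 + real j) / \<epsilon>) \<le> exp (- real j / \<epsilon>)" by simp
        then have "real (Suc (2^m0)) * (4 * exp (- (16 + real j) / \<epsilon>)) \<le> real (Suc (2^m0)) * (4 * exp (- real j / \<epsilon>))"
          by (intro mult_left_mono) auto
        then show "measure M E \<le> real (Suc (2^m0)) * (4 * exp (- real j / \<epsilon>))" using E(2) by linarith
        have "- a1\<^sup>2 / (2 * \<epsilon> * C * T) = - real j / \<epsilon>" unfolding a1(2) using C T \<epsilon> by simp
        moreover have "2 * 1 * C * T / \<epsilon> - 1 * a2 / \<epsilon> = - real j / \<epsilon>"
          by (simp add: a2_def diff_divide_distrib[symmetric])
        ultimately show "measure M E' \<le> exp (- real j / \<epsilon>) + exp (- real j / \<epsilon>)" using E'(2) by simp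
      qed
      also have "\<dots> = (real (Suc (2^m0)) * 4 + 2) * exp (- real j / \<epsilon>)" by (simp add: algebra_simps)
      finally show ?thesis .
    qed
    moreover have "real (Suc (2^m0)) * 4 + 2 > 0" by (simp add: add_pos_pos)
    ultimately show ?thesis by blast
  qed
  have "\<exists>K. \<forall>j. compactin (CM_topology T) (K j) \<and> (\<exists>c>0. \<forall>\<epsilon>. 0 < \<epsilon> \<longrightarrow> \<epsilon> \<le> 1 \<longrightarrow>
      outer_prob M {\<omega>\<in>space M. (path_on T (X \<epsilon>) \<omega>, occ_measure T (\<xi> \<epsilon>) \<omega>) \<notin> K j} \<le> c * exp (- real j / \<epsilon>))"
    by (intro choice allI level)
  then obtain K where KK: "\<forall>j. compactin (CM_topology T) (K j) \<and> (\<exists>c>0. \<forall>\<epsilon>. 0 < \<epsilon> \<longrightarrow> \<epsilon> \<le> 1 \<longrightarrow>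
      outer_prob M {\<omega>\<in>space M. (path_on T (X \<epsilon>) \<omega>, occ_measure T (\<xi> \<epsilon>) \<omega>) \<notin> K j} \<le> c * exp (- real j / \<epsilon>))" ..
  note K = KK[rule_format, THEN conjunct1] and Kp = KK[THEN spec, THEN conjunct2]
  \<comment> \<open>Finite unions are increasing and still compact, and enlarging the sets only
    lowers the probability of leaving them.\<close>
  define K' where "K' j = (\<Union>i\<le>j. K i)" for j
  let ?p = "\<lambda>j \<epsilon>. outer_prob M {\<omega>\<in>space M. (path_on T (X \<epsilon>) \<omega>, occ_measure T (\<xi> \<epsilon>) \<omega>) \<notin> K' j}"
  have L: "Limsup (at_right 0) (\<lambda>\<epsilon>. eps_log \<epsilon> (?p j \<epsilon>)) \<le> ereal (- real j)" for j
  proof -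
    obtain c where c: "c > 0" and cp: "\<And>\<epsilon>. 0 < \<epsilon> \<Longrightarrow> \<epsilon> \<le> 1 \<Longrightarrow>
      outer_prob M {\<omega>\<in>space M. (path_on T (X \<epsilon>) \<omega>, occ_measure T (\<xi> \<epsilon>) \<omega>) \<notin> K j} \<le> c * exp (- real j / \<epsilon>)"
      using Kp[of j] by (elim exE conjE) (blast intro: that)
    show ?thesis
    proof (rule Limsup_eps_log_le[OF c])
      fix \<epsilon> :: real assume \<epsilon>: "0 < \<epsilon>" "\<epsilon> \<le> 1"
      have "?p j \<epsilon> \<le> outer_prob M {\<omega>\<in>space M. (path_on T (X \<epsilon>) \<omega>, occ_measure T (\<xi> \<epsilon>) \<omega>) \<notin> K j}"
        by (rule outer_prob_mono) (auto simp: K'_def)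
      moreover have "0 \<le> ?p j \<epsilon>" by (rule outer_prob_nonneg) auto
      ultimately show "0 \<le> ?p j \<epsilon> \<and> ?p j \<epsilon> \<le> c * exp (- real j / \<epsilon>)" using cp[OF \<epsilon>] by linarith
    qed
  qed
  show ?thesis
  proof (intro exI[of _ K'] conjI allI)
    show "incseq K'" unfolding incseq_def K'_def by (intro allI impI UN_mono) auto
    show "compactin (CM_topology T) (K' j)" for j
      unfolding K'_def by (intro compactin_Union) (use K in auto)
    show "(\<lambda>j. Limsup (at_right 0) (\<lambda>\<epsilon>. eps_log \<epsilon> (?p j \<epsilon>))) \<longlonglongrightarrow> -\<infinity>"
      unfolding tendsto_MInfty
    proof
      fix a :: real
      obtain n :: nat where n: "- a < real n" using reals_Archimedean2 by blast
      have "Limsup (at_right 0) (\<lambda>\<epsilon>. eps_log \<epsilon> (?p j \<epsilon>)) < ereal a" if "n \<le> j" for j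
      proof -
        have "ereal (- real j) < ereal a" using n that by simp
        then show ?thesis by (rule le_less_trans[OF L])
      qed
      then show "\<forall>\<^sub>F j in sequentially. Limsup (at_right 0) (\<lambda>\<epsilon>. eps_log \<epsilon> (?p j \<epsilon>)) < ereal a"
        by (auto simp: eventually_sequentially)
    qed
  qed
qed

end
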